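(* Let $\Omega$ be a domain in the hemisphere $\mathbb{S}^2_+$, and let $\lambda_1(\Omega)<\lambda_2(\Omega)\le\cdots$ be the eigenvalues of the Dirichlet Laplacian on $\Omega$, repeated according to multiplicity. Then for all $z\geq 0$ $$ R_1^D(z)=\sum_{j\geq 1}(z-\lambda_j(\Omega))_+\leq \frac{1}{8\pi}|\Omega|z^2 . $$
   Context: $\mathbb{S}^2_+=\mathbb{S}^2\cap\{x_3>0\}$ is the open hemisphere of the round unit sphere $\mathbb{S}^2\subset\mathbb{R}^3$. A domain is an open connected set; $|\Omega|$ is its surface measure; $a_+=\max(a,0)$. The Dirichlet eigenvalues are understood in the weak sense: $\lambda$ is an eigenvalue if there is $0\neq u\in H^1_0(\Omega)$ (closure of $C_c^\infty(\Omega)$ in $H^1(\Omega)$) with $\int_\Omega\nabla u\cdot\nabla\phi=\lambda\int_\Omega u\phi$ for all $\phi\in H_0^1(\Omega)$. *)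

theory Defs
  imports "HOL-Analysis.Analysis"
begin

section \<open>The round sphere: measure and first-order calculus\<close>

type_synonym R3 = "real ^ 3"

abbreviation S2 :: "R3 set" where
  "S2 \<equiv> sphere 0 1"

definition hemisphere :: "R3 set" where
  "hemisphere = {x \<in> S2. x $ 3 > 0}"

text \<open>Surface measure from polar coordinates: the area of \<open>A \<subseteq> S2\<close> is three times the
  volume of the solid cone \<open>{r x | x \<in> A, 0 < r \<le> 1}\<close>. It is a Borel measure on the ambient
  space, concentrated on the sphere (the centre of the ball, where \<open>sgn 0 = 0\<close>, is a null set).\<close>

definition surface_measure :: "R3 measure" where
  "surface_measure = scale_measure 3 (distr (restrict_space lborel (cball 0 1)) borel sgn)"

abbreviation area_on :: "R3 set \<Rightarrow> R3 measure" where
  "area_on \<Omega> \<equiv> restrict_space surface_measure \<Omega>"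

text \<open>Functions on the sphere are represented by functions on the ambient space whose values off
  the sphere are irrelevant. Derivatives are those of the extension \<open>y \<mapsto> f (y / norm y)\<close>, which
  is constant along rays; at points of the sphere its Euclidean gradient is therefore tangential
  and equals the Riemannian gradient of \<open>f\<close>.\<close>

definition surface_grad :: "(R3 \<Rightarrow> real) \<Rightarrow> R3 \<Rightarrow> R3" where
  "surface_grad f x = (THE D. GDERIV (\<lambda>y. f (sgn y)) x :> D)"

text \<open>For a tangential field \<open>X\<close>, the trace of the derivative of its radially constant extension
  is the Riemannian divergence.\<close>

definition surface_div :: "(R3 \<Rightarrow> R3) \<Rightarrow> R3 \<Rightarrow> real" where
  "surface_div X x = (\<Sum>i\<in>UNIV. surface_grad (\<lambda>y. X y $ i) x $ i)"

primrec C_k_on :: "nat \<Rightarrow> (R3 \<Rightarrow> real) \<Rightarrow> R3 set \<Rightarrow> bool" where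
  "C_k_on 0 = (\<lambda>f U. continuous_on U f)"
| "C_k_on (Suc k) = (\<lambda>f U. (\<forall>x\<in>U. f differentiable (at x)) \<and>
     (\<forall>i. C_k_on k (\<lambda>x. frechet_derivative f (at x) (axis i 1)) U))"

definition smooth_on_sphere :: "(R3 \<Rightarrow> real) \<Rightarrow> bool" where
  "smooth_on_sphere f \<longleftrightarrow> (\<forall>k. C_k_on k (\<lambda>y. f (sgn y)) (- {0}))"


section \<open>Sobolev spaces on open subsets of the sphere\<close>

text \<open>\<open>C\<^sub>c\<^sup>\<infinity>(\<Omega>)\<close>, its elements being extended by zero to the whole sphere.\<close>

definition test_function :: "R3 set \<Rightarrow> (R3 \<Rightarrow> real) \<Rightarrow> bool" where
  "test_function \<Omega> f \<longleftrightarrow> smooth_on_sphere f \<and>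
     (\<exists>K. compact K \<and> K \<subseteq> \<Omega> \<and> (\<forall>x\<in>S2 - K. f x = 0))"

definition test_field :: "R3 set \<Rightarrow> (R3 \<Rightarrow> R3) \<Rightarrow> bool" where
  "test_field \<Omega> X \<longleftrightarrow> (\<forall>i. test_function \<Omega> (\<lambda>x. X x $ i)) \<and> (\<forall>x\<in>S2. X x \<bullet> x = 0)"

definition L2 :: "R3 set \<Rightarrow> (R3 \<Rightarrow> 'b::euclidean_space) \<Rightarrow> bool" where
  "L2 \<Omega> u \<longleftrightarrow> u \<in> borel_measurable (area_on \<Omega>) \<and>
     integrable (area_on \<Omega>) (\<lambda>x. (norm (u x))\<^sup>2)"

definition weak_grad :: "R3 set \<Rightarrow> (R3 \<Rightarrow> real) \<Rightarrow> (R3 \<Rightarrow> R3) \<Rightarrow> bool" where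
  "weak_grad \<Omega> u g \<longleftrightarrow> (AE x in area_on \<Omega>. g x \<bullet> x = 0) \<and>
     (\<forall>X. test_field \<Omega> X \<longrightarrow>
        (LINT x|area_on \<Omega>. u x * surface_div X x) = - (LINT x|area_on \<Omega>. g x \<bullet> X x))"

text \<open>Weak gradients are unique up to null sets, so the two relations below are the graphs of the
  gradient on \<open>H\<^sup>1(\<Omega>)\<close> and on \<open>H\<^sup>1\<^sub>0(\<Omega>)\<close>: \<open>H1 \<Omega> u g\<close> says that \<open>u \<in> H\<^sup>1(\<Omega>)\<close> with weak gradient \<open>g\<close>.
  Functions that agree almost everywhere are not identified.\<close>

definition H1 :: "R3 set \<Rightarrow> (R3 \<Rightarrow> real) \<Rightarrow> (R3 \<Rightarrow> R3) \<Rightarrow> bool" where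
  "H1 \<Omega> u g \<longleftrightarrow> L2 \<Omega> u \<and> L2 \<Omega> g \<and> weak_grad \<Omega> u g"

definition H10 :: "R3 set \<Rightarrow> (R3 \<Rightarrow> real) \<Rightarrow> (R3 \<Rightarrow> R3) \<Rightarrow> bool" where
  "H10 \<Omega> u g \<longleftrightarrow> H1 \<Omega> u g \<and>
     (\<exists>f :: nat \<Rightarrow> R3 \<Rightarrow> real. (\<forall>n. test_function \<Omega> (f n)) \<and>
        (\<lambda>n. LINT x|area_on \<Omega>. (f n x - u x)\<^sup>2 + (norm (surface_grad (f n) x - g x))\<^sup>2)
          \<longlonglongrightarrow> 0)"


section \<open>Dirichlet eigenvalues\<close>

text \<open>The zero function is included here.\<close>

definition dirichlet_eigenspace :: "R3 set \<Rightarrow> real \<Rightarrow> (R3 \<Rightarrow> real) set" where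
  "dirichlet_eigenspace \<Omega> \<mu> =
     {u. \<exists>g. H10 \<Omega> u g \<and>
        (\<forall>\<phi> h. H10 \<Omega> \<phi> h \<longrightarrow>
           (LINT x|area_on \<Omega>. g x \<bullet> h x) = \<mu> * (LINT x|area_on \<Omega>. u x * \<phi> x))}"

definition dirichlet_eigenvalue :: "R3 set \<Rightarrow> real \<Rightarrow> bool" where
  "dirichlet_eigenvalue \<Omega> \<mu> \<longleftrightarrow>
     (\<exists>u \<in> dirichlet_eigenspace \<Omega> \<mu>. \<not> (AE x in area_on \<Omega>. u x = 0))"

text \<open>The space of functions \<open>E\<close> has dimension \<open>n\<close> modulo almost everywhere equality.\<close>

definition has_dim_ae :: "'a measure \<Rightarrow> ('a \<Rightarrow> real) set \<Rightarrow> nat \<Rightarrow> bool" where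
  "has_dim_ae M E n \<longleftrightarrow>
     (\<exists>b :: nat \<Rightarrow> 'a \<Rightarrow> real.
        (\<forall>i<n. b i \<in> E) \<and>
        (\<forall>c. (AE x in M. (\<Sum>i<n. c i * b i x) = 0) \<longrightarrow> (\<forall>i<n. c i = 0)) \<and>
        (\<forall>u\<in>E. \<exists>c. AE x in M. u x = (\<Sum>i<n. c i * b i x)))"

text \<open>\<open>ev 1 \<le> ev 2 \<le> \<dots>\<close> lists all Dirichlet eigenvalues, repeated according to multiplicity; the
  value \<open>ev 0\<close> is not used.\<close>

definition dirichlet_spectrum :: "R3 set \<Rightarrow> (nat \<Rightarrow> real) \<Rightarrow> bool" where
  "dirichlet_spectrum \<Omega> ev \<longleftrightarrow>
     mono_on {1..} ev \<and>
     ev ` {1..} = {\<mu>. dirichlet_eigenvalue \<Omega> \<mu>} \<and>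
     (\<forall>\<mu>. dirichlet_eigenvalue \<Omega> \<mu> \<longrightarrow>
        finite {j\<in>{1..}. ev j = \<mu>} \<and>
        has_dim_ae (area_on \<Omega>) (dirichlet_eigenspace \<Omega> \<mu>) (card {j\<in>{1..}. ev j = \<mu>}))"

end

theory Submission
  imports Defs
begin

text \<open>Write \<open>L l = l (l + 1)\<close> for the eigenvalues of the sphere and \<open>\<lambda> j\<close> for those of \<open>\<Omega>\<close>. Berezin's method
  bounds the Riesz mean of \<open>\<Omega>\<close> by the one of the sphere, expanding the eigenfunctions of \<open>\<Omega>\<close>, extended by
  zero, in spherical harmonics. On the whole sphere the resulting bound equals \<open>z\<^sup>2 / (8 \<pi>)\<close> per unit of area
  when \<open>z\<close> is one of the \<open>L l\<close> and is larger otherwise. The hemisphere is used to gain a term of lower order.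

  The antipodal map takes \<open>\<Omega>\<close> to a set disjoint from \<open>\<Omega>\<close>. Hence a function \<open>u\<close> on \<open>\<Omega>\<close> can be extended as
  \<open>u x + (-1)\<^sup>l u (- x)\<close>, for either parity of \<open>l\<close>, at the price of doubling both the energy and the square
  norm (lemma \<open>c1_test_bound\<close>). The extension involves spherical harmonics of degrees \<open>n\<close> of the parity of
  \<open>l\<close> only, and dropping the nonnegative contribution of the degrees above \<open>l\<close> gives
  \<open>energy \<ge> L l * (square norm) - \<Sum> (L l - L n) * (mass in degree n)\<close>, the sum over \<open>n < l\<close> of this parity
  (theorem \<open>sphere_energy_bound\<close>). Evaluated at orthonormal eigenfunctions and added up with Bessel's
  inequality, this bounds \<open>\<Sum> max 0 (L l - \<lambda> j)\<close> by the area of \<open>\<Omega>\<close> over \<open>8 \<pi>\<close> times \<open>(L l)\<^sup>2 - 2 L l\<close>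
  (lemma \<open>riesz_mean_at_sphere_eigenvalue\<close>): using one parity saves the term \<open>2 L l\<close>. For
  \<open>z\<close> between \<open>L l\<close> and \<open>L (l + 1)\<close>, the parities for the two endpoints being different, convexity of the
  Riesz mean in \<open>z\<close> puts it below the chord of \<open>x\<^sup>2 - 2 x\<close>, and what was saved outweighs the excess of the chord
  over the parabola (lemma \<open>riesz_mean_bound\<close>).

  The harmonic analysis rests on the spaces \<open>V n\<close> of homogeneous polynomials of degree \<open>n\<close> on the sphere, in
  which \<open>V (n - 2)\<close> sits through multiplication by \<open>x \<bullet> x = 1\<close>. The Laplacian preserves \<open>V n\<close> and acts on the
  orthogonal complement of \<open>V (n - 2)\<close> as \<open>- L n\<close> (lemmas \<open>casimir_eq\<close> and \<open>projection_step\<close>), so these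
  complements are the spherical harmonics. Rotation invariance makes the sum of squares of an
  orthonormal basis of \<open>V n\<close> constant on the sphere; since \<open>V n\<close> is spanned by \<open>(n + 1) (n + 2) / 2\<close>
  monomials, the constant is at most \<open>(n + 1) (n + 2) / (8 \<pi>)\<close> (lemma \<open>onb_density_bound\<close>). Completeness is the
  theorem of Stone and Weierstrass. Integration by parts needs no charts: the fields
  \<open>x\<^sub>i \<partial>\<^sub>j - x\<^sub>j \<partial>\<^sub>i\<close> generate rotations, which preserve the measure (lemma \<open>integral_rot_by_parts\<close>).\<close>

section \<open>The surface measure and its rotation invariance\<close>

lemma sgn_in_S2: "y \<noteq> 0 \<Longrightarrow> sgn y \<in> S2" for y :: R3
  by (simp add: norm_sgn)

lemma sgn_on_S2: "x \<in> S2 \<Longrightarrow> sgn x = x" for x :: R3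
  by (simp add: sgn_div_norm)

lemma S2_nonzero: "x \<in> S2 \<Longrightarrow> x \<noteq> 0"
  by auto

text \<open>Functions on the sphere enter through extensions that are regular away from the centre, the typical
  one being \<open>y \<mapsto> f (sgn y)\<close>. The value at the centre is arbitrary, whence continuity on \<open>- {0}\<close> is the
  working regularity class for everything that is integrated.\<close>

lemma borel_measurable_punctured:
  fixes f :: "R3 \<Rightarrow> 'b::euclidean_space"
  assumes "continuous_on (- {0}) f"
  shows "f \<in> borel_measurable borel"
proof -
  have "(\<lambda>x. if x \<in> - {0} then f x else f 0) \<in> borel_measurable borel"
    by (rule borel_measurable_continuous_on_if) (use assms in auto)
  moreover have "(\<lambda>x. if x \<in> - {0} then f x else f 0) = f"
    by auto
  ultimately show ?thesis by simp
qed

lemma continuous_sgn: "continuous_on (- {0}) (sgn :: R3 \<Rightarrow> R3)"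
  unfolding sgn_div_norm by (intro continuous_intros) auto

lemma measurable_sgn [measurable]: "(sgn :: R3 \<Rightarrow> R3) \<in> borel_measurable borel"
  by (rule borel_measurable_punctured[OF continuous_sgn])

lemma sets_surface [simp, measurable_cong]: "sets surface_measure = sets borel"
  by (simp add: surface_measure_def)

lemma space_surface [simp]: "space surface_measure = UNIV"
  by (simp add: surface_measure_def space_scale_measure)

lemma emeasure_surface:
  assumes "A \<in> sets borel"
  shows "emeasure surface_measure A = 3 * emeasure lborel (sgn -` A \<inter> cball 0 1)"
proof -
  have 1: "sgn \<in> measurable (restrict_space lborel (cball 0 1)) (borel :: R3 measure)"
    by (rule measurable_restrict_space1) simp
  show ?thesis
    using assms 1
    by (simp add: surface_measure_def emeasure_distr space_restrict_space emeasure_restrict_space)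
qed

lemma measure_cball_R3: "measure lborel (cball (0::R3) 1) = 4 * pi / 3"
  by (simp add: content_cball unit_ball_vol_3)

lemma emeasure_surface_UNIV: "emeasure surface_measure UNIV = ennreal (4 * pi)"
proof -
  have "emeasure lborel (cball (0::R3) 1) = ennreal (4 * pi / 3)"
    using emeasure_eq_ennreal_measure[of lborel "cball (0::R3) 1"] emeasure_lborel_cball_finite[of "0::R3" 1]
    by (simp add: measure_cball_R3 infinity_ennreal_def less_top[symmetric])
  then have "emeasure surface_measure UNIV = ennreal 3 * ennreal (4 * pi / 3)"
    by (simp add: emeasure_surface)
  also have "\<dots> = ennreal (4 * pi)"
    by (subst ennreal_mult[symmetric]) auto
  finally show ?thesis .
qed

lemma finite_surface: "finite_measure surface_measure"
  by (rule finite_measureI) (simp add: emeasure_surface_UNIV)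

lemma measure_surface_UNIV: "measure surface_measure UNIV = 4 * pi"
  by (simp add: measure_def emeasure_surface_UNIV)

lemma AE_surface: "AE x in surface_measure. x \<in> S2"
proof (rule AE_I)
  have "emeasure surface_measure (- S2) = 3 * emeasure lborel (sgn -` (- S2) \<inter> cball (0::R3) 1)"
    by (rule emeasure_surface) auto
  also have "sgn -` (- S2) \<inter> cball (0::R3) 1 = {0}"
    by (auto simp: norm_sgn split: if_splits)
  finally show "emeasure surface_measure (- S2) = 0"
    by simp
qed auto

lemma integrable_surface:
  fixes f :: "R3 \<Rightarrow> real"
  assumes "continuous_on (- {0}) f"
  shows "integrable surface_measure f"
proof -
  have "continuous_on S2 f"
    by (rule continuous_on_subset[OF assms]) auto
  then have "bounded (f ` S2)"
    by (intro compact_imp_bounded compact_continuous_image) auto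
  then obtain B where "\<forall>y\<in>f ` S2. norm y \<le> B"
    unfolding bounded_iff by blast
  then have B: "\<And>x. x \<in> S2 \<Longrightarrow> \<bar>f x\<bar> \<le> B"
    by simp
  have "AE x in surface_measure. norm (f x) \<le> B"
    using AE_surface by eventually_elim (use B in auto)
  moreover have "f \<in> borel_measurable surface_measure"
    using borel_measurable_punctured[OF assms] by simp
  ultimately show ?thesis
    using finite_measure.integrable_const_bound[OF finite_surface] by blast
qed

lemma integral_surface_cong:
  fixes f g :: "R3 \<Rightarrow> real"
  assumes "continuous_on (- {0}) f" "continuous_on (- {0}) g" "\<And>x. x \<in> S2 \<Longrightarrow> f x = g x"
  shows "(LINT x|surface_measure. f x) = (LINT x|surface_measure. g x)"
proof (rule integral_cong_AE)
  show "AE x in surface_measure. f x = g x"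
    using AE_surface by eventually_elim (use assms in auto)
qed (use borel_measurable_punctured[OF assms(1)] borel_measurable_punctured[OF assms(2)] in simp_all)

lemma orthogonal_lborel:
  fixes R :: "R3 \<Rightarrow> R3"
  assumes "orthogonal_transformation R"
  shows "distr lborel borel R = lborel"
proof -
  have meas: "R \<in> borel_measurable borel"
    using assms by (intro borel_measurable_continuous_onI linear_continuous_on)
      (simp add: linear_linear orthogonal_transformation_linear)
  have "bij R" by (rule orthogonal_transformation_bij[OF assms])
  have inv: "orthogonal_transformation (inv R)"
    by (rule orthogonal_transformation_inv[OF assms])
  show ?thesis
  proof (rule lborel_eqI[symmetric])
    fix l u :: R3
    assume lu: "\<And>b. b \<in> Basis \<Longrightarrow> l \<bullet> b \<le> u \<bullet> b"
    have "R -` box l u = inv R ` box l u"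
      using \<open>bij R\<close> by (simp add: bij_vimage_eq_inv_image)
    moreover have "box l u \<in> lmeasurable" by simp
    ultimately have a: "R -` box l u \<in> lmeasurable" "measure lebesgue (R -` box l u) = measure lebesgue (box l u)"
      using measurable_orthogonal_image[OF inv] measure_orthogonal_image[OF inv] by simp_all
    have b: "R -` box l u \<in> sets borel"
      using meas by (simp add: borel_measurable_vimage_open measurable_sets_borel)
    have "emeasure (distr lborel borel R) (box l u) = emeasure lborel (R -` box l u)"
      using meas by (simp add: emeasure_distr)
    also have "\<dots> = emeasure lebesgue (R -` box l u)"
      using b by simp
    also have "\<dots> = ennreal (measure lebesgue (R -` box l u))"
      using a by (simp add: emeasure_eq_measure2)
    also have "\<dots> = ennreal (measure lebesgue (box l u))"
      using a by simp
    also have "\<dots> = emeasure lebesgue (box l u)"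
      using emeasure_eq_measure2[of "box l u" lebesgue] by simp
    also have "\<dots> = (\<Prod>b\<in>Basis. (u - l) \<bullet> b)"
      using lu by (simp add: emeasure_lborel_box)
    finally show "emeasure (distr lborel borel R) (box l u) = ennreal (\<Prod>b\<in>Basis. (u - l) \<bullet> b)" .
  qed simp
qed

lemma measurable_orthogonal:
  fixes R :: "R3 \<Rightarrow> R3"
  assumes "orthogonal_transformation R"
  shows "R \<in> borel_measurable borel"
  using assms by (intro borel_measurable_continuous_onI linear_continuous_on)
      (simp add: linear_linear orthogonal_transformation_linear)

text \<open>An orthogonal map preserves Lebesgue measure and the unit ball, and it commutes with \<open>sgn\<close>.\<close>

lemma orthogonal_surface:
  fixes R :: "R3 \<Rightarrow> R3"
  assumes R: "orthogonal_transformation R"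
  shows "distr surface_measure borel R = surface_measure"
proof (rule measure_eqI)
  fix A assume "A \<in> sets (distr surface_measure borel R)"
  then have A: "A \<in> sets borel" by simp
  have meas: "R \<in> borel_measurable borel"
    by (rule measurable_orthogonal[OF R])
  have RA: "R -` A \<in> sets borel"
    using measurable_sets_borel[OF meas A] by simp
  have sgnR: "sgn (R y) = R (sgn y)" for y
    using R by (simp add: sgn_div_norm orthogonal_transformation_norm orthogonal_transformation_scaleR)
  have B: "sgn -` A \<inter> cball (0::R3) 1 \<in> sets borel"
    using measurable_sets_borel[OF measurable_sgn A] by auto
  have "emeasure (distr surface_measure borel R) A = emeasure surface_measure (R -` A)"
    using A meas by (simp add: emeasure_distr cong: measurable_cong_sets)
  also have "\<dots> = 3 * emeasure lborel (sgn -` (R -` A) \<inter> cball 0 1)"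
    by (rule emeasure_surface[OF RA])
  also have "sgn -` (R -` A) \<inter> cball 0 1 = R -` (sgn -` A \<inter> cball 0 1)"
    using R by (auto simp: sgnR orthogonal_transformation_norm)
  also have "emeasure lborel (R -` (sgn -` A \<inter> cball 0 1)) = emeasure (distr lborel borel R) (sgn -` A \<inter> cball 0 1)"
    using B meas by (simp add: emeasure_distr)
  also have "\<dots> = emeasure lborel (sgn -` A \<inter> cball 0 1)"
    by (simp add: orthogonal_lborel[OF R])
  also have "3 * \<dots> = emeasure surface_measure A"
    by (rule emeasure_surface[OF A, symmetric])
  finally show "emeasure (distr surface_measure borel R) A = emeasure surface_measure A" .
qed simp

lemma integral_surface_orthogonal:
  fixes R :: "R3 \<Rightarrow> R3" and f :: "R3 \<Rightarrow> real"
  assumes "orthogonal_transformation R" "f \<in> borel_measurable borel"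
  shows "(LINT x|surface_measure. f (R x)) = (LINT x|surface_measure. f x)"
proof -
  have "(LINT x|surface_measure. f x) = (LINT x|distr surface_measure borel R. f x)"
    by (simp add: orthogonal_surface[OF assms(1)])
  also have "\<dots> = (LINT x|surface_measure. f (R x))"
    by (rule integral_distr) (use assms(2) measurable_orthogonal[OF assms(1)] in simp_all)
  finally show ?thesis by simp
qed

text \<open>If \<open>f\<close> is nonzero at a point of the sphere, then \<open>f \<circ> sgn\<close> is nonzero on a nonempty open subset of
  the ball, and this set has positive volume. The lemma turns equalities in mean square between
  polynomials into equalities at each point.\<close>

lemma surface_null_imp_zero:
  fixes f :: "R3 \<Rightarrow> real"
  assumes f: "continuous_on (- {0}) f" and null: "(LINT x|surface_measure. f x * f x) = 0" and x: "x \<in> S2"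
  shows "f x = 0"
proof (rule ccontr)
  assume nz: "f x \<noteq> 0"
  have meas: "f \<in> borel_measurable borel"
    by (rule borel_measurable_punctured[OF f])
  have int: "integrable surface_measure (\<lambda>x. f x * f x)"
    by (rule integrable_surface) (intro continuous_intros f)
  have AE: "AE x in surface_measure. f x * f x = 0"
    using integral_nonneg_eq_0_iff_AE[OF int] null by simp
  define A where "A = {x. f x \<noteq> 0}"
  have A: "A \<in> sets borel"
    unfolding A_def using meas by measurable
  have "emeasure surface_measure A = 0"
    using AE AE_iff_measurable[of A surface_measure "\<lambda>x. f x = 0"] A by (simp add: A_def)
  then have 0: "emeasure lborel (sgn -` A \<inter> cball 0 1) = 0"
    by (simp add: emeasure_surface[OF A])
  have fs: "continuous_on (- {0}) (\<lambda>y. f (sgn y))"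
    by (rule continuous_on_compose2[OF f continuous_sgn]) (auto simp: sgn_zero_iff)
  have op: "open {y \<in> ball 0 1 - {0}. f (sgn y) \<noteq> 0}" (is "open ?U")
  proof -
    have "continuous_on (ball 0 1 - {0}) (\<lambda>y. f (sgn y))"
      by (rule continuous_on_subset[OF fs]) auto
    then have "open ((\<lambda>y. f (sgn y)) -` (- {0}) \<inter> (ball 0 1 - {0}))"
      by (subst (asm) continuous_on_open_vimage) auto
    moreover have "(\<lambda>y. f (sgn y)) -` (- {0}) \<inter> (ball 0 1 - {0}) = ?U" by auto
    ultimately show ?thesis by simp
  qed
  have "(1/2) *\<^sub>R x \<in> ?U"
    using x nz by (auto simp: sgn_scaleR sgn_on_S2)
  moreover have "?U \<subseteq> sgn -` A \<inter> cball 0 1"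
    by (auto simp: A_def)
  then have "emeasure lborel ?U \<le> emeasure lborel (sgn -` A \<inter> cball 0 1)"
    using measurable_sets_borel[OF measurable_sgn A] by (intro emeasure_mono) auto
  then have "emeasure lborel ?U = 0" using 0 by simp
  then have "?U \<in> null_sets lborel"
    using op by (auto simp: null_sets_def)
  then have "negligible ?U"
    by (simp only: negligible_iff_null_sets null_sets_completionI)
  ultimately show False
    using open_not_negligible[OF op] by blast
qed

section \<open>Angular derivatives and integration by parts\<close>

definition partial :: "3 \<Rightarrow> (R3 \<Rightarrow> real) \<Rightarrow> R3 \<Rightarrow> real" where
  "partial i F x = frechet_derivative F (at x) (axis i 1)"

text \<open>The generator \<open>x\<^sub>i \<partial>\<^sub>j - x\<^sub>j \<partial>\<^sub>i\<close> of the rotations in the plane of the coordinates \<open>i\<close> and \<open>j\<close>. These fields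
  are tangent to the sphere, annihilate radial functions and span the tangent space at every point,
  so they replace charts: on the sphere half the sum of their squares over all pairs is the squared
  length of the tangential gradient.\<close>

definition rot :: "3 \<Rightarrow> 3 \<Rightarrow> (R3 \<Rightarrow> real) \<Rightarrow> R3 \<Rightarrow> real" where
  "rot i j F x = x $ i * partial j F x - x $ j * partial i F x"

definition C1 :: "(R3 \<Rightarrow> real) \<Rightarrow> bool" where
  "C1 F \<longleftrightarrow> (\<forall>x. x \<noteq> 0 \<longrightarrow> F differentiable (at x)) \<and> (\<forall>i. continuous_on (- {0}) (partial i F))"

lemma C1_differentiable: "C1 F \<Longrightarrow> x \<noteq> 0 \<Longrightarrow> F differentiable (at x)"
  by (simp add: C1_def)

lemma C1_has_derivative: "C1 F \<Longrightarrow> x \<noteq> 0 \<Longrightarrow> (F has_derivative frechet_derivative F (at x)) (at x)"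
  using C1_differentiable frechet_derivative_works by blast

lemma C1_continuous: "C1 F \<Longrightarrow> continuous_on (- {0}) F"
  by (intro continuous_at_imp_continuous_on ballI differentiable_imp_continuous_within)
     (auto simp: C1_differentiable)

lemma C1_continuous_partial: "C1 F \<Longrightarrow> continuous_on (- {0}) (partial i F)"
  by (simp add: C1_def)

lemma C1_continuous_rot: "C1 F \<Longrightarrow> continuous_on (- {0}) (rot i j F)"
  unfolding rot_def by (intro continuous_intros C1_continuous_partial)

lemma partial_eqI: "(F has_derivative F') (at x) \<Longrightarrow> partial i F x = F' (axis i 1)"
  unfolding partial_def using frechet_derivative_at by metis

lemma partial_const [simp]: "partial i (\<lambda>x. c) x = 0"
  by (rule partial_eqI[where F' = "\<lambda>_. 0", simplified]) simp

lemma partial_coord: "partial i (\<lambda>x. x $ k) x = (if i = k then 1 else 0)"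
  by (subst partial_eqI[where F' = "\<lambda>v. v $ k"])
     (auto simp: axis_def intro!: bounded_linear_imp_has_derivative bounded_linear_vec_nth)

lemma partial_add: "F differentiable (at x) \<Longrightarrow> G differentiable (at x) \<Longrightarrow>
    partial i (\<lambda>x. F x + G x) x = partial i F x + partial i G x"
  unfolding frechet_derivative_works
  by (subst partial_eqI[OF has_derivative_add]) (auto simp: partial_def)

lemma partial_mult: "F differentiable (at x) \<Longrightarrow> G differentiable (at x) \<Longrightarrow>
    partial i (\<lambda>x. F x * G x) x = F x * partial i G x + partial i F x * G x"
  unfolding frechet_derivative_works
  by (subst partial_eqI[OF has_derivative_mult]) (auto simp: partial_def)

lemma partial_cmult: "F differentiable (at x) \<Longrightarrow> partial i (\<lambda>x. c * F x) x = c * partial i F x"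
  by (subst partial_mult) auto

lemma derivative_eq_partial:
  assumes "F differentiable (at x)"
  shows "frechet_derivative F (at x) v = (\<Sum>i\<in>UNIV. v $ i * partial i F x)"
proof -
  have lin: "linear (frechet_derivative F (at x))"
    using assms by (rule linear_frechet_derivative)
  have "frechet_derivative F (at x) v = frechet_derivative F (at x) (\<Sum>i\<in>UNIV. v $ i *\<^sub>R axis i 1)"
    using basis_expansion[of v] by (simp add: scalar_mult_eq_scaleR)
  also have "\<dots> = (\<Sum>i\<in>UNIV. v $ i * partial i F x)"
    using lin by (simp add: linear_sum linear_scale partial_def)
  finally show ?thesis .
qed

lemma C1_const: "C1 (\<lambda>x. c)"
  by (simp add: C1_def)

lemma C1_coord: "C1 (\<lambda>x. x $ k)"
  by (auto simp: C1_def partial_coord[abs_def] intro!: bounded_linear_imp_differentiable bounded_linear_vec_nth)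

lemma C1_add:
  assumes "C1 F" "C1 G" shows "C1 (\<lambda>x. F x + G x)"
proof -
  have "continuous_on (- {0}) (\<lambda>x. partial i F x + partial i G x)" for i
    by (intro continuous_intros C1_continuous_partial assms)
  then have "continuous_on (- {0}) (partial i (\<lambda>x. F x + G x))" for i
    by (rule continuous_on_eq) (use assms in \<open>auto simp: partial_add C1_differentiable\<close>)
  with assms show ?thesis by (auto simp: C1_def)
qed

lemma C1_mult:
  assumes "C1 F" "C1 G" shows "C1 (\<lambda>x. F x * G x)"
proof -
  have "continuous_on (- {0}) (\<lambda>x. F x * partial i G x + partial i F x * G x)" for i
    by (intro continuous_intros C1_continuous_partial C1_continuous[OF assms(1)] C1_continuous[OF assms(2)] assms)
  then have "continuous_on (- {0}) (partial i (\<lambda>x. F x * G x))" for i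
    by (rule continuous_on_eq) (use assms in \<open>auto simp: partial_mult C1_differentiable\<close>)
  with assms show ?thesis by (auto simp: C1_def)
qed

lemma C1_cmult: "C1 F \<Longrightarrow> C1 (\<lambda>x. c * F x)"
  by (intro C1_mult C1_const)

lemma C1_diff: "C1 F \<Longrightarrow> C1 G \<Longrightarrow> C1 (\<lambda>x. F x - G x)"
  using C1_add[of F "\<lambda>x. (-1) * G x"] C1_cmult[of G "-1"] by simp

lemma rot_add: "F differentiable (at x) \<Longrightarrow> G differentiable (at x) \<Longrightarrow>
    rot i j (\<lambda>x. F x + G x) x = rot i j F x + rot i j G x"
  by (simp add: rot_def partial_add algebra_simps)

lemma rot_cmult: "F differentiable (at x) \<Longrightarrow> rot i j (\<lambda>x. c * F x) x = c * rot i j F x"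
  by (simp add: rot_def partial_cmult algebra_simps)

lemma rot_mult: "F differentiable (at x) \<Longrightarrow> G differentiable (at x) \<Longrightarrow>
    rot i j (\<lambda>x. F x * G x) x = F x * rot i j G x + rot i j F x * G x"
  by (simp add: rot_def partial_mult algebra_simps)

text \<open>Composition with the antipodal map commutes with every \<open>rot i j\<close>, because the sign of the derivative
  and the sign of the coordinate cancel.\<close>

lemma C1_antipode:
  assumes "C1 G"
  shows "C1 (\<lambda>y. G (- y))" and "x \<noteq> 0 \<Longrightarrow> rot i j (\<lambda>y. G (- y)) x = rot i j G (- x)"
proof -
  have der: "((\<lambda>y. G (- y)) has_derivative (\<lambda>v. frechet_derivative G (at (- x)) (- v))) (at x)" if "x \<noteq> 0" for x
    by (rule has_derivative_compose[of uminus uminus x UNIV G "frechet_derivative G (at (- x))"])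
       (use that C1_has_derivative[OF assms, of "- x"] in \<open>auto intro!: derivative_eq_intros\<close>)
  have partial: "partial i (\<lambda>y. G (- y)) x = - partial i G (- x)" if "x \<noteq> 0" for i x
  proof -
    have "linear (frechet_derivative G (at (- x)))"
      using C1_differentiable[OF assms, of "- x"] that by (intro linear_frechet_derivative) auto
    then show ?thesis
      using partial_eqI[OF der[OF that], of i] by (simp add: partial_def linear_neg)
  qed
  have "continuous_on (- {0}) (\<lambda>x. - partial i G (- x))" for i
    by (intro continuous_intros continuous_on_compose2[OF C1_continuous_partial[OF assms, of i]]) auto
  then have "continuous_on (- {0}) (partial i (\<lambda>y. G (- y)))" for i
    by (rule continuous_on_eq) (simp add: partial)
  then show "C1 (\<lambda>y. G (- y))"
    unfolding C1_def using der by (auto simp: differentiable_def)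
  show "x \<noteq> 0 \<Longrightarrow> rot i j (\<lambda>y. G (- y)) x = rot i j G (- x)"
    by (simp add: rot_def partial)
qed

text \<open>The rotation by the angle \<open>t\<close> in the plane of the coordinates \<open>i\<close> and \<open>j\<close>, for \<open>i \<noteq> j\<close>.\<close>

definition turn :: "3 \<Rightarrow> 3 \<Rightarrow> real \<Rightarrow> R3 \<Rightarrow> R3" where
  "turn i j t x = x + ((cos t - 1) * x $ i - sin t * x $ j) *\<^sub>R axis i 1
                    + (sin t * x $ i + (cos t - 1) * x $ j) *\<^sub>R axis j 1"

lemma turn_0: "turn i j 0 x = x"
  by (simp add: turn_def)

lemma turn_nth:
  assumes "i \<noteq> j"
  shows "turn i j t x $ i = cos t * x $ i - sin t * x $ j"
    "turn i j t x $ j = sin t * x $ i + cos t * x $ j"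
  using assms by (auto simp: turn_def axis_def algebra_simps)

lemma orthogonal_turn:
  assumes "i \<noteq> j"
  shows "orthogonal_transformation (turn i j t)"
  unfolding orthogonal_transformation
proof (intro conjI allI)
  show "linear (turn i j t)"
    by (rule linearI) (auto simp: turn_def algebra_simps)
  fix v :: R3
  define a b where "a = (cos t - 1) * v $ i - sin t * v $ j" and "b = sin t * v $ i + (cos t - 1) * v $ j"
  have ax: "axis i (1::real) $ j = 0" "axis j (1::real) $ i = 0"
    using assms by (auto simp: axis_def)
  have "turn i j t v \<bullet> turn i j t v = v \<bullet> v + 2 * a * v $ i + 2 * b * v $ j + a\<^sup>2 + b\<^sup>2"
    unfolding turn_def a_def[symmetric] b_def[symmetric]
    by (simp add: inner_add_left inner_add_right inner_axis inner_axis' ax inner_axis_axis assms power2_eq_square algebra_simps)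
  also have "\<dots> = v \<bullet> v"
    using sin_cos_squared_add[of t] unfolding a_def b_def by algebra
  finally show "norm (turn i j t v) = norm v"
    by (simp add: norm_eq_sqrt_inner)
qed

lemma turn_S2: "i \<noteq> j \<Longrightarrow> x \<in> S2 \<Longrightarrow> turn i j t x \<in> S2"
  using orthogonal_transformation_norm[OF orthogonal_turn] by simp

lemma turn_deriv:
  assumes F: "C1 F" and "i \<noteq> j" and x: "x \<in> S2"
  shows "((\<lambda>t. F (turn i j t x)) has_real_derivative rot i j F (turn i j t x)) (at t)"
proof -
  define y where "y = turn i j t x"
  have y: "y \<noteq> 0" using turn_S2[OF assms(2) x] S2_nonzero unfolding y_def by blast
  define v where "v = y $ i *\<^sub>R axis j 1 - y $ j *\<^sub>R axis i (1::real)"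
  have "((\<lambda>t. turn i j t x) has_vector_derivative
      (0 + (((- sin t) * x $ i - cos t * x $ j) *\<^sub>R axis i 1)
         + ((cos t * x $ i + (- sin t) * x $ j) *\<^sub>R axis j 1))) (at t)"
    unfolding turn_def has_real_derivative_iff_has_vector_derivative[symmetric]
    by (auto intro!: derivative_eq_intros simp: has_real_derivative_iff_has_vector_derivative[symmetric])
  also have "(0 + (((- sin t) * x $ i - cos t * x $ j) *\<^sub>R axis i 1)
         + ((cos t * x $ i + (- sin t) * x $ j) *\<^sub>R axis j 1)) = v"
    unfolding v_def y_def turn_nth[OF assms(2)] by (simp add: algebra_simps)
  finally have "((\<lambda>t. turn i j t x) has_derivative (\<lambda>h. h *\<^sub>R v)) (at t)"
    by (simp add: has_vector_derivative_def)
  then have "((\<lambda>t. F (turn i j t x)) has_derivative (\<lambda>h. frechet_derivative F (at y) (h *\<^sub>R v))) (at t)"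
    by (rule has_derivative_compose) (use C1_has_derivative[OF F y] in \<open>simp add: y_def\<close>)
  moreover have "frechet_derivative F (at y) (h *\<^sub>R v) = rot i j F y * h" for h
  proof -
    have "linear (frechet_derivative F (at y))"
      using C1_differentiable[OF F y] by (rule linear_frechet_derivative)
    then show ?thesis
      by (simp add: v_def linear_scale linear_diff rot_def partial_def algebra_simps)
  qed
  ultimately show ?thesis
    by (simp add: has_field_derivative_def y_def)
qed

text \<open>By rotation invariance the integral of \<open>F \<circ> turn i j t\<close> does not depend on \<open>t\<close>, and its derivative at
  \<open>t = 0\<close> is the integral of \<open>rot i j F\<close>. The difference quotients are bounded by the maximum of
  \<open>rot i j F\<close> on the sphere, which justifies differentiating under the integral sign.\<close>

lemma integral_rot:
  assumes F: "C1 F"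
  shows "(LINT x|surface_measure. rot i j F x) = 0"
proof (cases "i = j")
  case True
  then show ?thesis by (simp add: rot_def)
next
  case ij: False
  \<comment> \<open>a null sequence of angles along which the difference quotients are formed\<close>
  define s where "s n = 1 / real (Suc n)" for n
  have s: "s n > 0" for n by (simp add: s_def)
  have s0: "s \<longlonglongrightarrow> 0" unfolding s_def by (rule LIMSEQ_Suc[OF lim_1_over_n])
  define g where "g n x = (F (turn i j (s n) x) - F x) / s n" for n x
  have rotc: "continuous_on (- {0}) (rot i j F)"
    by (rule C1_continuous_rot[OF F])
  have turnc: "continuous_on (- {0}) (\<lambda>x. F (turn i j t x))" for t
  proof (rule continuous_on_compose2[OF C1_continuous[OF F]])
    show "continuous_on (- {0}) (turn i j t)"
      using orthogonal_transformation_linear[OF orthogonal_turn[OF ij, of t]]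
      by (intro linear_continuous_on) (simp add: linear_linear)
    show "turn i j t ` (- {0}) \<subseteq> - {0}"
      using orthogonal_transformation_norm[OF orthogonal_turn[OF ij, of t]] by (metis Compl_iff image_subsetI norm_eq_zero singletonI singletonD)
  qed
  have g0: "(LINT x|surface_measure. g n x) = 0" for n
  proof -
    have "(LINT x|surface_measure. g n x) =
        ((LINT x|surface_measure. F (turn i j (s n) x)) - (LINT x|surface_measure. F x)) / s n"
      unfolding g_def using integrable_surface[OF turnc] integrable_surface[OF C1_continuous[OF F]] by simp
    then show ?thesis
      using integral_surface_orthogonal[OF orthogonal_turn[OF ij] borel_measurable_punctured[OF C1_continuous[OF F]]]
      by simp
  qed
  have "bounded (rot i j F ` S2)"
    by (intro compact_imp_bounded compact_continuous_image continuous_on_subset[OF rotc]) auto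
  then obtain B where "\<forall>y\<in>rot i j F ` S2. norm y \<le> B"
    unfolding bounded_iff by blast
  then have B: "\<And>x. x \<in> S2 \<Longrightarrow> \<bar>rot i j F x\<bar> \<le> B" by simp
  have gB: "\<bar>g n x\<bar> \<le> B" if x: "x \<in> S2" for n x
  proof -
    obtain z where "F (turn i j (s n) x) - F (turn i j 0 x) = (s n - 0) * rot i j F (turn i j z x)"
      using MVT2[OF s, of n "\<lambda>t. F (turn i j t x)" "\<lambda>t. rot i j F (turn i j t x)"] turn_deriv[OF F ij x] by blast
    then have "g n x = rot i j F (turn i j z x)"
      using s[of n] by (simp add: g_def turn_0)
    then show ?thesis using B[OF turn_S2[OF ij x]] by simp
  qed
  have glim: "(\<lambda>n. g n x) \<longlonglongrightarrow> rot i j F x" if x: "x \<in> S2" for x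
  proof -
    have "((\<lambda>h. (F (turn i j (0 + h) x) - F (turn i j 0 x)) / h) \<longlongrightarrow> rot i j F (turn i j 0 x)) (at 0)"
      using turn_deriv[OF F ij x, of 0] by (simp add: DERIV_def)
    moreover have "filterlim s (at 0) sequentially"
      using s0 s by (intro filterlim_atI) (auto intro!: always_eventually simp: less_imp_neq[symmetric])
    ultimately have "(\<lambda>n. (F (turn i j (0 + s n) x) - F (turn i j 0 x)) / s n) \<longlonglongrightarrow> rot i j F (turn i j 0 x)"
      by (rule filterlim_compose)
    then show ?thesis by (simp add: g_def turn_0)
  qed
  have "(\<lambda>n. LINT x|surface_measure. g n x) \<longlonglongrightarrow> (LINT x|surface_measure. rot i j F x)"
  proof (rule integral_dominated_convergence[where w = "\<lambda>_. B"])
    show "rot i j F \<in> borel_measurable surface_measure"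
      using borel_measurable_punctured[OF rotc] by simp
    show "g n \<in> borel_measurable surface_measure" for n
    proof -
      have "continuous_on (- {0}) (g n)"
        unfolding g_def by (intro continuous_intros turnc C1_continuous[OF F]) (use s[of n] in auto)
      from borel_measurable_punctured[OF this] show ?thesis by simp
    qed
    show "integrable surface_measure (\<lambda>_. B)"
      by (rule integrable_surface) (rule continuous_on_const)
    show "AE x in surface_measure. (\<lambda>n. g n x) \<longlonglongrightarrow> rot i j F x"
      using AE_surface by eventually_elim (rule glim)
    show "AE x in surface_measure. norm (g n x) \<le> B" for n
      using AE_surface by eventually_elim (simp only: real_norm_def gB)
  qed
  then show ?thesis
    by (simp add: g0 LIMSEQ_const_iff)
qed

lemma integral_rot_by_parts:
  assumes F: "C1 F" and G: "C1 G"
  shows "(LINT x|surface_measure. rot i j F x * G x) = - (LINT x|surface_measure. F x * rot i j G x)"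
proof -
  have c: "continuous_on (- {0}) (\<lambda>x. F x * rot i j G x)" "continuous_on (- {0}) (\<lambda>x. rot i j F x * G x)"
    by (intro continuous_intros C1_continuous[OF F] C1_continuous[OF G] C1_continuous_rot F G)+
  have "0 = (LINT x|surface_measure. rot i j (\<lambda>x. F x * G x) x)"
    by (simp add: integral_rot C1_mult F G)
  also have "\<dots> = (LINT x|surface_measure. F x * rot i j G x + rot i j F x * G x)"
  proof (rule integral_surface_cong)
    show "continuous_on (- {0}) (rot i j (\<lambda>x. F x * G x))"
      by (intro C1_continuous_rot C1_mult F G)
    show "continuous_on (- {0}) (\<lambda>x. F x * rot i j G x + rot i j F x * G x)"
      by (intro continuous_intros c)
    fix x :: R3 assume "x \<in> S2"
    then have "x \<noteq> 0" by (rule S2_nonzero)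
    then show "rot i j (\<lambda>x. F x * G x) x = F x * rot i j G x + rot i j F x * G x"
      by (simp add: rot_mult C1_differentiable F G)
  qed
  also have "\<dots> = (LINT x|surface_measure. F x * rot i j G x) + (LINT x|surface_measure. rot i j F x * G x)"
    by (rule Bochner_Integration.integral_add) (intro integrable_surface c)+
  finally show ?thesis by simp
qed

section \<open>Homogeneous polynomials on the sphere\<close>

text \<open>Homogeneous polynomials of a fixed degree, as functions. Restricted to the sphere those of degree
  \<open>n\<close> are the direct sum of the spherical harmonics of degrees \<open>n, n - 2, n - 4, \<dots>\<close>, since multiplication by
  \<open>x \<bullet> x\<close> embeds the polynomials of degree \<open>n - 2\<close>. Working with this filtration replaces the spherical
  harmonics by spaces that are visibly invariant under rotations and under \<open>rot i j\<close>.\<close>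

inductive hom_poly :: "nat \<Rightarrow> (R3 \<Rightarrow> real) \<Rightarrow> bool" where
  hom_poly_const: "hom_poly 0 (\<lambda>x. c)"
| hom_poly_coord: "hom_poly n p \<Longrightarrow> hom_poly (Suc n) (\<lambda>x. x $ i * p x)"
| hom_poly_add: "hom_poly n p \<Longrightarrow> hom_poly n q \<Longrightarrow> hom_poly n (\<lambda>x. p x + q x)"

lemma hom_poly_zero: "hom_poly n (\<lambda>x. 0)"
proof (induction n)
  case (Suc n)
  from hom_poly_coord[OF this, of undefined] show ?case by simp
qed (rule hom_poly_const)

lemma hom_poly_cmult: "hom_poly n p \<Longrightarrow> hom_poly n (\<lambda>x. c * p x)"
proof (induction rule: hom_poly.induct)
  case (hom_poly_coord n p i)
  from hom_poly.hom_poly_coord[OF hom_poly_coord.IH, of i] show ?case by (simp add: mult.left_commute)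
qed (auto intro: hom_poly.intros simp: distrib_left)

lemma hom_poly_diff: "hom_poly n p \<Longrightarrow> hom_poly n q \<Longrightarrow> hom_poly n (\<lambda>x. p x - q x)"
  using hom_poly_add[of n p "\<lambda>x. (-1) * q x"] hom_poly_cmult[of n q "-1"] by simp

lemma hom_poly_sum: "(\<And>k. k \<in> A \<Longrightarrow> hom_poly n (f k)) \<Longrightarrow> hom_poly n (\<lambda>x. \<Sum>k\<in>A. f k x)"
  by (induction A rule: infinite_finite_induct) (auto intro: hom_poly_zero hom_poly_add)

lemma hom_poly_mult: "hom_poly m p \<Longrightarrow> hom_poly n q \<Longrightarrow> hom_poly (m + n) (\<lambda>x. p x * q x)"
proof (induction rule: hom_poly.induct)
  case (hom_poly_coord m p i)
  from hom_poly.hom_poly_coord[OF hom_poly_coord.IH[OF hom_poly_coord.prems], of i] show ?case by (simp add: mult.assoc)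
qed (auto intro: hom_poly_cmult hom_poly_add simp: distrib_right)

lemma hom_poly_x: "hom_poly 1 (\<lambda>x. x $ i)"
  using hom_poly_coord[OF hom_poly_const[of 1], of i] by simp

lemma hom_poly_x_power: "hom_poly n (\<lambda>x. x $ i ^ n)"
  by (induction n) (auto intro: hom_poly.intros hom_poly_const[of 1, simplified] hom_poly_coord)

lemma hom_poly_raise:
  assumes "hom_poly n p"
  shows "hom_poly (n + 2) (\<lambda>x. (x \<bullet> x) * p x)"
proof -
  have "hom_poly (n + 2) (\<lambda>x. \<Sum>i\<in>UNIV. x $ i * (x $ i * p x))"
    using assms by (auto intro!: hom_poly_sum hom_poly_coord)
  then show ?thesis
    by (simp add: inner_vec_def sum_distrib_right mult.assoc)
qed

lemma hom_poly_parity: "hom_poly n p \<Longrightarrow> p (- x) = (-1) ^ n * p x"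
  by (induction rule: hom_poly.induct) (auto simp: algebra_simps)

lemma hom_poly_linear: "hom_poly n p \<Longrightarrow> linear R \<Longrightarrow> hom_poly n (\<lambda>x. p (R x))"
proof (induction rule: hom_poly.induct)
  case (hom_poly_coord n p i)
  have R_eq: "R x $ i = (\<Sum>k\<in>UNIV. R (axis k 1) $ i * x $ k)" for x
  proof -
    have "R x = R (\<Sum>k\<in>UNIV. x $ k *\<^sub>R axis k 1)"
      using basis_expansion[of x] by (simp add: scalar_mult_eq_scaleR)
    also have "\<dots> = (\<Sum>k\<in>UNIV. x $ k *\<^sub>R R (axis k 1))"
      using hom_poly_coord.prems by (simp add: linear_sum linear_scale)
    finally show ?thesis by (simp add: mult.commute)
  qed
  have "hom_poly 1 (\<lambda>x. \<Sum>k\<in>UNIV. R (axis k 1) $ i * x $ k)"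
    by (intro hom_poly_sum hom_poly_cmult hom_poly_x)
  then have "hom_poly 1 (\<lambda>x. R x $ i)"
    by (subst R_eq)
  from hom_poly_mult[OF this hom_poly_coord.IH[OF hom_poly_coord.prems]] show ?case
    by simp
qed (auto intro: hom_poly.intros)

lemma hom_poly_differentiable: "hom_poly n p \<Longrightarrow> p differentiable (at x)"
  by (induction rule: hom_poly.induct)
     (auto intro!: differentiable_mult bounded_linear_imp_differentiable[OF bounded_linear_vec_nth])

lemma hom_poly_C1: "hom_poly n p \<Longrightarrow> C1 p"
  by (induction rule: hom_poly.induct) (auto intro: C1_const C1_mult C1_coord C1_add)

lemma coord_differentiable: "(\<lambda>x::R3. x $ i) differentiable (at x)"
  by (rule bounded_linear_imp_differentiable[OF bounded_linear_vec_nth])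

lemma partial_coord_mult: "hom_poly n p \<Longrightarrow> partial k (\<lambda>x. x $ i * p x) = (\<lambda>x. x $ i * partial k p x + (if k = i then 1 else 0) * p x)"
  by (rule ext) (simp add: partial_mult hom_poly_differentiable coord_differentiable partial_coord)

lemma partial_hom_poly_add: "hom_poly n p \<Longrightarrow> hom_poly m q \<Longrightarrow> partial k (\<lambda>x. p x + q x) = (\<lambda>x. partial k p x + partial k q x)"
  by (rule ext) (simp add: partial_add hom_poly_differentiable)

text \<open>Truncated subtraction makes the case of degree zero special, so the two cases are proved together.\<close>

lemma partial_hom_poly_aux: "hom_poly n p \<Longrightarrow> (case n of 0 \<Rightarrow> partial k p = (\<lambda>x. 0) | Suc m \<Rightarrow> hom_poly m (partial k p))"
proof (induction rule: hom_poly.induct)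
  case (hom_poly_const c)
  then show ?case by auto
next
  case (hom_poly_coord n p i)
  have "hom_poly n (\<lambda>x. x $ i * partial k p x)"
    using hom_poly_coord.IH by (cases n) (auto intro: hom_poly_zero hom_poly.hom_poly_coord)
  then show ?case
    using hom_poly_coord.hyps by (auto simp: partial_coord_mult intro!: hom_poly_add hom_poly_cmult hom_poly_zero)
next
  case (hom_poly_add n p q)
  show ?case
    unfolding partial_hom_poly_add[OF hom_poly_add.hyps] using hom_poly_add.IH by (auto split: nat.splits intro: hom_poly.hom_poly_add)
qed

lemma partial_hom_poly: "hom_poly (Suc n) p \<Longrightarrow> hom_poly n (partial k p)"
  using partial_hom_poly_aux[of "Suc n" p k] by simp

lemma partial_hom_poly_0: "hom_poly 0 p \<Longrightarrow> partial k p = (\<lambda>x. 0)"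
  using partial_hom_poly_aux[of 0 p k] by simp

lemma partial_hom_poly': "hom_poly n p \<Longrightarrow> hom_poly (n - 1) (partial k p)"
  using partial_hom_poly[of "n - 1" p k] partial_hom_poly_0[of p k] hom_poly_zero by (cases n) auto

lemma rot_hom_poly: "hom_poly n p \<Longrightarrow> hom_poly n (rot i j p)"
  unfolding rot_def
  using hom_poly_coord[OF partial_hom_poly] partial_hom_poly_0 hom_poly_zero[of 0]
  by (cases n) (auto intro!: hom_poly_diff)

lemma hom_poly_euler: "hom_poly n p \<Longrightarrow> (\<Sum>k\<in>UNIV. x $ k * partial k p x) = n * p x"
proof (induction rule: hom_poly.induct)
  case (hom_poly_coord n p i)
  have "(\<Sum>k\<in>UNIV. x $ k * partial k (\<lambda>x. x $ i * p x) x)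
      = x $ i * (\<Sum>k\<in>UNIV. x $ k * partial k p x) + (\<Sum>k\<in>UNIV. if k = i then x $ k * p x else 0)"
    unfolding partial_coord_mult[OF hom_poly_coord.hyps] sum_distrib_left sum.distrib[symmetric]
    by (intro sum.cong) (auto simp: algebra_simps)
  then show ?case using hom_poly_coord.IH by (simp add: algebra_simps)
next
  case (hom_poly_add n p q)
  then show ?case by (simp add: partial_hom_poly_add sum.distrib algebra_simps)
qed simp

lemma partial_commute: "hom_poly n p \<Longrightarrow> partial a (partial b p) x = partial b (partial a p) x"
proof (induction rule: hom_poly.induct)
  case (hom_poly_coord n p i)
  have eq: "partial c (partial d (\<lambda>x. x $ i * p x)) x = x $ i * partial c (partial d p) x
      + (if c = i then 1 else 0) * partial d p x + (if d = i then 1 else 0) * partial c p x" for c d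
    unfolding partial_coord_mult[OF hom_poly_coord.hyps]
    using hom_poly_coord.hyps partial_hom_poly'[OF hom_poly_coord.hyps, of d]
    by (subst partial_hom_poly_add[OF hom_poly.hom_poly_coord hom_poly_cmult]) (auto simp: partial_coord_mult partial_cmult hom_poly_differentiable)
  show ?case
    unfolding eq using hom_poly_coord.IH by simp
next
  case (hom_poly_add n p q)
  have "partial c (partial d (\<lambda>x. p x + q x)) x = partial c (partial d p) x + partial c (partial d q) x" for c d
    using hom_poly_add.hyps by (simp add: partial_hom_poly_add[OF hom_poly_add.hyps] partial_hom_poly_add[OF partial_hom_poly' partial_hom_poly'])
  then show ?case using hom_poly_add.IH by simp
qed simp

lemma partial_rot:
  assumes "hom_poly n p"
  shows "partial k (rot i j p) x = (if k = i then 1 else 0) * partial j p x + x $ i * partial k (partial j p) x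
     - (if k = j then 1 else 0) * partial i p x - x $ j * partial k (partial i p) x"
proof -
  have h: "hom_poly (n-1) (partial a p)" for a by (rule partial_hom_poly'[OF assms])
  have "rot i j p = (\<lambda>x. x $ i * partial j p x + (-1) * (x $ j * partial i p x))"
    by (auto simp: rot_def)
  then have "partial k (rot i j p) x = partial k (\<lambda>x. x $ i * partial j p x) x + partial k (\<lambda>x. (-1) * (x $ j * partial i p x)) x"
    by (simp only: partial_hom_poly_add[OF hom_poly_coord[OF h, of i j] hom_poly_cmult[OF hom_poly_coord[OF h, of j i]]])
  also have "partial k (\<lambda>x. (-1) * (x $ j * partial i p x)) x = (-1) * partial k (\<lambda>x. x $ j * partial i p x) x"
    by (rule partial_cmult) (rule hom_poly_differentiable[OF hom_poly_coord[OF h]])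
  finally show ?thesis
    by (simp add: partial_coord_mult[OF h])
qed

text \<open>On the sphere this is the operator \<open>- \<Delta>\<close> of the round metric, the Casimir operator of the rotation
  group; each unordered pair of coordinates occurs twice in the sum, hence the factor one half.\<close>

definition casimir :: "(R3 \<Rightarrow> real) \<Rightarrow> R3 \<Rightarrow> real" where
  "casimir p x = - (1/2) * (\<Sum>i\<in>UNIV. \<Sum>j\<in>UNIV. rot i j (rot i j p) x)"

definition laplacian :: "(R3 \<Rightarrow> real) \<Rightarrow> R3 \<Rightarrow> real" where
  "laplacian p x = (\<Sum>i\<in>UNIV. partial i (partial i p) x)"

lemma casimir_hom_poly: "hom_poly n p \<Longrightarrow> hom_poly n (casimir p)"
  unfolding casimir_def by (intro hom_poly_cmult hom_poly_sum rot_hom_poly)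

lemma laplacian_hom_poly: "hom_poly (n + 2) p \<Longrightarrow> hom_poly n (laplacian p)"
  unfolding laplacian_def by (intro hom_poly_sum partial_hom_poly) simp

lemma laplacian_hom_poly_small: "hom_poly n p \<Longrightarrow> n < 2 \<Longrightarrow> laplacian p = (\<lambda>x. 0)"
proof -
  assume p: "hom_poly n p" and n: "n < 2"
  have "hom_poly 0 (partial i p)" for i
    using partial_hom_poly'[OF p, of i] n by (cases n) auto
  then show ?thesis
    using partial_hom_poly_0 by (auto simp: laplacian_def)
qed

text \<open>This is the identity \<open>r\<^sup>2 \<Delta> = (r \<partial>\<^sub>r)\<^sup>2 + r \<partial>\<^sub>r + \<Delta>\<^sub>S\<close> for functions on which \<open>r \<partial>\<^sub>r\<close> acts as \<open>n\<close>.
  It says that on the polynomials of degree \<open>n\<close>, modulo those coming from degree \<open>n - 2\<close>, the operator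
  acts as the scalar \<open>n (n + 1)\<close>.\<close>

lemma casimir_eq:
  assumes p: "hom_poly n p"
  shows "casimir p x = real n * (real n + 1) * p x - (x \<bullet> x) * laplacian p x"
proof -
  have 1: "(\<Sum>k\<in>UNIV. x $ k * partial k p x) = n * p x"
    by (rule hom_poly_euler[OF p])
  have 2: "(\<Sum>k\<in>UNIV. x $ k * partial k (partial i p) x) = (real n - 1) * partial i p x" for i
  proof (cases n)
    case 0
    then show ?thesis using partial_hom_poly_0 p by simp
  next
    case (Suc m)
    then show ?thesis using hom_poly_euler[OF partial_hom_poly', OF p, of x i] by simp
  qed
  have com: "partial 2 (partial 1 p) x = partial 1 (partial 2 p) x" "partial 3 (partial 1 p) x = partial 1 (partial 3 p) x" "partial 3 (partial 2 p) x = partial 2 (partial 3 p) x"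
    using partial_commute[OF p] by blast+
  have c: "casimir p x = - (1/2) * (\<Sum>i\<in>UNIV. \<Sum>j\<in>UNIV. x $ i * partial j (rot i j p) x - x $ j * partial i (rot i j p) x)"
    by (simp add: casimir_def rot_def[of _ _ "rot _ _ p"])
  have "casimir p x = - ((x \<bullet> x) * laplacian p x) + (\<Sum>i\<in>UNIV. x $ i * (\<Sum>k\<in>UNIV. x $ k * partial k (partial i p) x))
      + 2 * (\<Sum>k\<in>UNIV. x $ k * partial k p x)"
    unfolding c partial_rot[OF p]
    by (simp add: sum_3 com laplacian_def inner_vec_def algebra_simps power2_eq_square)
  also have "\<dots> = - ((x \<bullet> x) * laplacian p x) + (real n - 1) * (\<Sum>i\<in>UNIV. x $ i * partial i p x) + 2 * (n * p x)"
    unfolding 2 1[symmetric] by (simp add: sum_distrib_left mult.left_commute)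
  also have "\<dots> = real n * (real n + 1) * p x - (x \<bullet> x) * laplacian p x"
    unfolding 1 by (simp add: algebra_simps)
  finally show ?thesis .
qed

text \<open>Linear combinations of the monomials \<open>x\<^sub>1\<^sup>a x\<^sub>2\<^sup>b x\<^sub>3\<^sup>c\<close> with \<open>a + b + c = n\<close>; the pair \<open>(a, b)\<close> determines the
  monomial.\<close>

definition monomial_span :: "nat \<Rightarrow> (R3 \<Rightarrow> real) \<Rightarrow> bool" where
  "monomial_span n p \<longleftrightarrow> (\<exists>c. \<forall>x. p x = (\<Sum>(a, b)\<in>(SIGMA a:{..n}. {..n-a}). c a b * (x $ 1 ^ a * x $ 2 ^ b * x $ 3 ^ (n - a - b))))"

lemma monomial_span_add: "monomial_span n p \<Longrightarrow> monomial_span n q \<Longrightarrow> monomial_span n (\<lambda>x. p x + q x)"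
proof -
  assume "monomial_span n p" "monomial_span n q"
  then obtain c d where "\<forall>x. p x = (\<Sum>(a, b)\<in>(SIGMA a:{..n}. {..n-a}). c a b * (x $ 1 ^ a * x $ 2 ^ b * x $ 3 ^ (n - a - b)))"
    "\<forall>x. q x = (\<Sum>(a, b)\<in>(SIGMA a:{..n}. {..n-a}). d a b * (x $ 1 ^ a * x $ 2 ^ b * x $ 3 ^ (n - a - b)))"
    unfolding monomial_span_def by blast
  then show ?thesis unfolding monomial_span_def
    by (intro exI[of _ "\<lambda>a b. c a b + d a b"]) (auto simp: sum.distrib[symmetric] algebra_simps intro!: sum.cong)
qed

lemma monomial_span_cmult: "monomial_span n p \<Longrightarrow> monomial_span n (\<lambda>x. e * p x)"
proof -
  assume "monomial_span n p"
  then obtain c where "\<forall>x. p x = (\<Sum>(a, b)\<in>(SIGMA a:{..n}. {..n-a}). c a b * (x $ 1 ^ a * x $ 2 ^ b * x $ 3 ^ (n - a - b)))"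
    unfolding monomial_span_def by blast
  then show ?thesis unfolding monomial_span_def
    by (intro exI[of _ "\<lambda>a b. e * c a b"]) (auto simp: sum_distrib_left algebra_simps intro!: sum.cong)
qed

lemma monomial_span_zero: "monomial_span n (\<lambda>x. 0)"
  unfolding monomial_span_def by (intro exI[of _ "\<lambda>a b. 0"]) auto

lemma monomial_span_sum: "(\<And>k. k \<in> A \<Longrightarrow> monomial_span n (f k)) \<Longrightarrow> monomial_span n (\<lambda>x. \<Sum>k\<in>A. f k x)"
  by (induction A rule: infinite_finite_induct) (auto intro: monomial_span_zero monomial_span_add)

lemma monomial_span_monomial:
  assumes "a + b + c = n"
  shows "monomial_span n (\<lambda>x. x $ 1 ^ a * x $ 2 ^ b * x $ 3 ^ c)"
  unfolding monomial_span_def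
proof (intro exI[of _ "\<lambda>a' b'. if (a', b') = (a, b) then 1 else 0"] allI)
  fix x :: R3
  have c: "c = n - a - b" using assms by simp
  have "(\<Sum>(a', b')\<in>(SIGMA a:{..n}. {..n-a}). (if (a', b') = (a, b) then 1 else 0) * (x $ 1 ^ a' * x $ 2 ^ b' * x $ 3 ^ (n - a' - b')))
     = (\<Sum>k\<in>(SIGMA a:{..n}. {..n-a}). if k = (a, b) then x $ 1 ^ a * x $ 2 ^ b * x $ 3 ^ (n - a - b) else 0)"
    by (intro sum.cong) (auto split: if_splits)
  also have "\<dots> = x $ 1 ^ a * x $ 2 ^ b * x $ 3 ^ (n - a - b)"
    by (subst sum.delta) (use assms in auto)
  finally show "x $ 1 ^ a * x $ 2 ^ b * x $ 3 ^ c = (\<Sum>(a', b')\<in>(SIGMA a:{..n}. {..n-a}). (if (a', b') = (a, b) then 1 else 0) * (x $ 1 ^ a' * x $ 2 ^ b' * x $ 3 ^ (n - a' - b')))"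
    unfolding c by simp
qed

lemma hom_poly_monomial_span: "hom_poly n p \<Longrightarrow> monomial_span n p"
proof (induction rule: hom_poly.induct)
  case (hom_poly_const c)
  from monomial_span_cmult[OF monomial_span_monomial[of 0 0 0 0], of c] show ?case by simp
next
  case (hom_poly_add n p q)
  then show ?case by (intro monomial_span_add)
next
  case (hom_poly_coord n p i)
  then obtain c where c: "\<And>x. p x = (\<Sum>(a, b)\<in>(SIGMA a:{..n}. {..n-a}). c a b * (x $ 1 ^ a * x $ 2 ^ b * x $ 3 ^ (n - a - b)))"
    unfolding monomial_span_def by blast
  have eq: "(\<lambda>x. x $ i * p x) = (\<lambda>x. \<Sum>k\<in>(SIGMA a:{..n}. {..n-a}). case k of (a, b) \<Rightarrow>
      c a b * (x $ i * (x $ 1 ^ a * x $ 2 ^ b * x $ 3 ^ (n - a - b))))"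
    unfolding c by (auto simp: sum_distrib_left mult.left_commute intro!: sum.cong)
  have "monomial_span (Suc n) (\<lambda>x. case k of (a, b) \<Rightarrow> c a b * (x $ i * (x $ 1 ^ a * x $ 2 ^ b * x $ 3 ^ (n - a - b))))"
    if k: "k \<in> (SIGMA a:{..n}. {..n-a})" for k
  proof -
    obtain a b where [simp]: "k = (a, b)" and ab: "a + b \<le> n" using k by (cases k) auto
    have "monomial_span (Suc n) (\<lambda>x. x $ i * (x $ 1 ^ a * x $ 2 ^ b * x $ 3 ^ (n - a - b)))"
    proof -
      consider "i = 1" | "i = 2" | "i = 3" using exhaust_3[of i] by blast
      then show ?thesis
      proof cases
        case 1
        show ?thesis using monomial_span_monomial[of "Suc a" b "n - a - b" "Suc n"] ab 1 by (simp add: mult.assoc mult.left_commute)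
      next
        case 2
        show ?thesis using monomial_span_monomial[of a "Suc b" "n - a - b" "Suc n"] ab 2 by (simp add: mult.assoc mult.left_commute)
      next
        case 3
        show ?thesis using monomial_span_monomial[of a b "Suc (n - a - b)" "Suc n"] ab 3 by (simp add: mult.assoc mult.left_commute)
      qed
    qed
    from monomial_span_cmult[OF this] show ?thesis by simp
  qed
  then show ?case unfolding eq by (rule monomial_span_sum)
qed

lemma card_exponents: "card (SIGMA a:{..n}. {..n-a}) = (n + 1) * (n + 2) div 2"
proof -
  have "card (SIGMA a:{..n}. {..n-a}) = (\<Sum>a\<le>n. Suc (n - a))"
    by simp
  also have "\<dots> = (\<Sum>a\<le>n. Suc a)"
    using sum.nat_diff_reindex[of "\<lambda>a. Suc a" "Suc n"] by (simp add: lessThan_Suc_atMost)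
  also have "\<dots> = (n + 1) * (n + 2) div 2"
    by (induction n) auto
  finally show ?thesis .
qed

lemma hom_poly_basis:
  obtains b :: "nat \<Rightarrow> R3 \<Rightarrow> real" where "\<And>i. hom_poly n (b i)"
    "\<And>p. hom_poly n p \<Longrightarrow> \<exists>c. \<forall>x. p x = (\<Sum>i<(n + 1) * (n + 2) div 2. c i * b i x)"
proof -
  let ?I = "SIGMA a:{..n}. {..n-a}"
  have fin: "finite ?I" by auto
  obtain h where h: "bij_betw h {..<card ?I} ?I"
    using ex_bij_betw_nat_finite[OF fin] by (auto simp: lessThan_atLeast0)
  define m :: "nat \<times> nat \<Rightarrow> R3 \<Rightarrow> real" where "m = (\<lambda>(a, b) x. x $ 1 ^ a * x $ 2 ^ b * x $ 3 ^ (n - a - b))"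
  have m: "hom_poly n (m k)" if k: "k \<in> ?I" for k
  proof -
    obtain a b where [simp]: "k = (a, b)" and ab: "a + b \<le> n" using k by (cases k) auto
    show ?thesis
      using hom_poly_mult[OF hom_poly_mult[OF hom_poly_x_power[of a 1] hom_poly_x_power[of b 2]] hom_poly_x_power[of "n - a - b" 3]] ab by (simp add: m_def)
  qed
  define b where "b i = (if i < card ?I then m (h i) else (\<lambda>x. 0))" for i
  show thesis
  proof
    show "hom_poly n (b i)" for i
      using m bij_betwE[OF h] by (auto simp: b_def simp del: card_SigmaI mem_Sigma_iff intro: hom_poly_zero)
    fix p assume "hom_poly n p"
    then obtain c where c: "\<And>x. p x = (\<Sum>(a, b)\<in>?I. c a b * (x $ 1 ^ a * x $ 2 ^ b * x $ 3 ^ (n - a - b)))"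
      using hom_poly_monomial_span unfolding monomial_span_def by blast
    have "p x = (\<Sum>i<card ?I. case_prod c (h i) * b i x)" for x
    proof -
      have "p x = (\<Sum>k\<in>?I. case_prod c k * m k x)"
        unfolding c m_def by (intro sum.cong) auto
      also have "\<dots> = (\<Sum>i<card ?I. case_prod c (h i) * m (h i) x)"
        by (rule sum.reindex_bij_betw[OF h, symmetric])
      also have "\<dots> = (\<Sum>i<card ?I. case_prod c (h i) * b i x)"
        by (intro sum.cong) (auto simp: b_def simp del: card_SigmaI)
      finally show ?thesis .
    qed
    then show "\<exists>c. \<forall>x. p x = (\<Sum>i<(n + 1) * (n + 2) div 2. c i * b i x)"
      unfolding card_exponents by (intro exI[of _ "\<lambda>i. case_prod c (h i)"] allI)
  qed
qed

text \<open>Since \<open>x \<bullet> x = 1\<close> on the sphere, every polynomial agrees there with the sum of two homogeneous ones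
  whose degrees are consecutive and as large as desired. One of the two is the even part and the other
  one the odd part.\<close>

definition even_odd_split :: "nat \<Rightarrow> (R3 \<Rightarrow> real) \<Rightarrow> bool" where
  "even_odd_split N f \<longleftrightarrow> (\<exists>p q. hom_poly N p \<and> hom_poly (Suc N) q \<and> (\<forall>x\<in>S2. f x = p x + q x))"

lemma even_odd_split_Suc: "even_odd_split N f \<Longrightarrow> even_odd_split (Suc N) f"
proof -
  assume "even_odd_split N f"
  then obtain p q where "hom_poly N p" "hom_poly (Suc N) q" "\<forall>x\<in>S2. f x = p x + q x"
    unfolding even_odd_split_def by blast
  then show ?thesis
    unfolding even_odd_split_def using hom_poly_raise[of N p]
    by (intro exI[of _ q] exI[of _ "\<lambda>x. (x \<bullet> x) * p x"]) (auto simp: dot_square_norm)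
qed

lemma even_odd_split_mono: "N \<le> M \<Longrightarrow> even_odd_split N f \<Longrightarrow> even_odd_split M f"
  by (induction rule: dec_induct) (auto intro: even_odd_split_Suc)

lemma even_odd_split_polynomial: "real_polynomial_function f \<Longrightarrow> \<exists>N. even_odd_split N f"
proof (induction rule: real_polynomial_function.induct)
  case (linear f)
  then have lin: "linear f" by (simp add: linear_linear)
  have "f x = (\<Sum>k\<in>UNIV. f (axis k 1) * x $ k)" for x
  proof -
    have "f x = f (\<Sum>k\<in>UNIV. x $ k *\<^sub>R axis k 1)"
      using basis_expansion[of x] by (simp add: scalar_mult_eq_scaleR)
    then show ?thesis using lin by (simp add: linear_sum linear_scale mult.commute)
  qed
  then have "f = (\<lambda>x. \<Sum>k\<in>UNIV. f (axis k 1) * x $ k)" by (rule ext)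
  moreover have "hom_poly (Suc 0) (\<lambda>x. \<Sum>k\<in>UNIV. f (axis k 1) * x $ k)"
    using hom_poly_x by (intro hom_poly_sum hom_poly_cmult) simp
  ultimately have "hom_poly (Suc 0) f" by (rule ssubst[where P = "hom_poly (Suc 0)"])
  with hom_poly_zero[of 0] have "even_odd_split 0 f"
    unfolding even_odd_split_def by (intro exI[of _ "\<lambda>x. 0"] exI[of _ f]) simp
  then show ?case ..
next
  case (const c)
  have "even_odd_split 0 (\<lambda>x. c)"
    unfolding even_odd_split_def using hom_poly_const[of c] hom_poly_zero[of "Suc 0"] by (intro exI[of _ "\<lambda>x. c"] exI[of _ "\<lambda>x. 0"]) simp
  then show ?case ..
next
  case (add f g)
  then obtain N M where N: "even_odd_split N f" and M: "even_odd_split M g" by blast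
  have "even_odd_split (max N M) f" "even_odd_split (max N M) g"
    using even_odd_split_mono[OF _ N, of "max N M"] even_odd_split_mono[OF _ M, of "max N M"] by simp_all
  then obtain p q p' q' where "hom_poly (max N M) p" "hom_poly (Suc (max N M)) q" "\<forall>x\<in>S2. f x = p x + q x"
      "hom_poly (max N M) p'" "hom_poly (Suc (max N M)) q'" "\<forall>x\<in>S2. g x = p' x + q' x"
    unfolding even_odd_split_def by blast
  then have "even_odd_split (max N M) (\<lambda>x. f x + g x)"
    unfolding even_odd_split_def
    by (intro exI[of _ "\<lambda>x. p x + p' x"] exI[of _ "\<lambda>x. q x + q' x"]) (auto intro: hom_poly_add)
  then show ?case ..
next
  case (mult f g)
  then obtain N M where "even_odd_split N f" "even_odd_split M g" by blast
  then obtain p q p' q' where 1: "hom_poly N p" "hom_poly (Suc N) q" "\<forall>x\<in>S2. f x = p x + q x"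
      "hom_poly M p'" "hom_poly (Suc M) q'" "\<forall>x\<in>S2. g x = p' x + q' x"
    unfolding even_odd_split_def by blast
  have "hom_poly (Suc (N + M)) (\<lambda>x. p x * q' x + q x * p' x)"
    using hom_poly_mult[OF 1(1,5)] hom_poly_mult[OF 1(2,4)] by (intro hom_poly_add) auto
  moreover have "hom_poly (Suc (Suc (N + M))) (\<lambda>x. (x \<bullet> x) * (p x * p' x) + q x * q' x)"
    using hom_poly_raise[OF hom_poly_mult[OF 1(1,4)]] hom_poly_mult[OF 1(2,5)] by (intro hom_poly_add) auto
  ultimately have "even_odd_split (Suc (N + M)) (\<lambda>x. f x * g x)"
    unfolding even_odd_split_def using 1(3,6)
    by (intro exI[of _ "\<lambda>x. p x * q' x + q x * p' x"] exI[of _ "\<lambda>x. (x \<bullet> x) * (p x * p' x) + q x * q' x"])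
       (auto simp: dot_square_norm algebra_simps)
  then show ?case ..
qed

text \<open>Stone-Weierstrass approximates \<open>F\<close> by a polynomial; averaging it with its reflection removes the part
  of the wrong parity and does not increase the error.\<close>

lemma hom_poly_dense:
  assumes F: "continuous_on S2 F" and par: "\<And>x. x \<in> S2 \<Longrightarrow> F (- x) = (-1) ^ l * F x" and e: "e > 0"
  obtains k q where "hom_poly (l + 2 * k) q" "\<And>x. x \<in> S2 \<Longrightarrow> \<bar>F x - q x\<bar> < e"
proof -
  obtain f where f: "real_polynomial_function f" "\<And>x. x \<in> S2 \<Longrightarrow> \<bar>F x - f x\<bar> < e"
    using Stone_Weierstrass_real_polynomial_function[OF compact_sphere F e] by blast
  obtain N where "even_odd_split N f" using even_odd_split_polynomial[OF f(1)] by blast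
  then have "even_odd_split (l + 2 * N) f" by (rule even_odd_split_mono[rotated]) simp
  then obtain p q where pq: "hom_poly (l + 2 * N) p" "hom_poly (Suc (l + 2 * N)) q" "\<And>x. x \<in> S2 \<Longrightarrow> f x = p x + q x"
    unfolding even_odd_split_def by blast
  show thesis
  proof
    show "hom_poly (l + 2 * N) p" by fact
    fix x :: R3 assume x: "x \<in> S2"
    then have mx: "- x \<in> S2" by simp
    have s: "(-1::real) ^ l * (-1) ^ l = 1" by (simp flip: power_add mult_2)
    have "\<bar>(-1) ^ l * (F (-x) - f (-x))\<bar> < e"
      using f(2)[OF mx] by (simp add: abs_mult)
    also have "(-1) ^ l * (F (-x) - f (-x)) = F x - (p x - q x)"
      unfolding pq(3)[OF mx] hom_poly_parity[OF pq(1)] hom_poly_parity[OF pq(2)] par[OF x]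
      using s by (simp add: algebra_simps power_add)
    finally show "\<bar>F x - p x\<bar> < e"
      using f(2)[OF x] pq(3)[OF x] by linarith
  qed
qed

section \<open>Orthogonalisation with respect to a semi-inner product\<close>

lemma lin_closed_sum:
  assumes "(\<lambda>x. 0) \<in> A" "\<And>f g c. f \<in> A \<Longrightarrow> g \<in> A \<Longrightarrow> (\<lambda>x. f x + c *\<^sub>R g x) \<in> A"
    and "\<And>i. i \<in> I \<Longrightarrow> f i \<in> A"
  shows "(\<lambda>x. \<Sum>i\<in>I. t i *\<^sub>R f i x) \<in> A"
  using assms(3)
proof (induction I rule: infinite_finite_induct)
  case (insert a I)
  then have "(\<lambda>x. (\<Sum>i\<in>I. t i *\<^sub>R f i x) + t a *\<^sub>R f a x) \<in> A"
    by (intro assms(2)) auto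
  then show ?case using insert by (simp add: add.commute)
qed (auto simp: assms(1))

text \<open>Real bilinear forms that are only semidefinite, on a set of functions closed under linear
  combinations: square-integrable functions are not identified when they agree almost everywhere. The
  values lie in a vector space of their own so that a function and its gradient can be treated as one
  object.\<close>

locale semi_inner =
  fixes S :: "('a \<Rightarrow> 'v::real_vector) set" and B :: "('a \<Rightarrow> 'v) \<Rightarrow> ('a \<Rightarrow> 'v) \<Rightarrow> real"
  assumes zero: "(\<lambda>x. 0) \<in> S"
    and lin: "\<And>f g c. f \<in> S \<Longrightarrow> g \<in> S \<Longrightarrow> (\<lambda>x. f x + c *\<^sub>R g x) \<in> S"
    and sym: "\<And>f g. f \<in> S \<Longrightarrow> g \<in> S \<Longrightarrow> B f g = B g f"
    and B_lin: "\<And>f g h c. f \<in> S \<Longrightarrow> g \<in> S \<Longrightarrow> h \<in> S \<Longrightarrow>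
      B (\<lambda>x. f x + c *\<^sub>R g x) h = B f h + c * B g h"
    and nonneg: "\<And>f. f \<in> S \<Longrightarrow> 0 \<le> B f f"
begin

lemma B_zero: "h \<in> S \<Longrightarrow> B (\<lambda>x. 0) h = 0"
  using B_lin[OF zero zero, of h 1] by simp

lemma lin_sum: "(\<And>i. i \<in> A \<Longrightarrow> f i \<in> S) \<Longrightarrow> (\<lambda>x. \<Sum>i\<in>A. c i *\<^sub>R f i x) \<in> S"
  by (rule lin_closed_sum[OF zero lin])

lemma B_sum: "(\<And>i. i \<in> A \<Longrightarrow> f i \<in> S) \<Longrightarrow> h \<in> S \<Longrightarrow>
    B (\<lambda>x. \<Sum>i\<in>A. c i *\<^sub>R f i x) h = (\<Sum>i\<in>A. c i * B (f i) h)"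
proof (induction A rule: infinite_finite_induct)
  case (insert a A)
  have "B (\<lambda>x. (\<Sum>i\<in>A. c i *\<^sub>R f i x) + c a *\<^sub>R f a x) h = B (\<lambda>x. \<Sum>i\<in>A. c i *\<^sub>R f i x) h + c a * B (f a) h"
    using insert by (intro B_lin lin_sum) auto
  then show ?case using insert by (simp add: add.commute)
qed (auto simp: B_zero)

lemma B_minus: "f \<in> S \<Longrightarrow> g \<in> S \<Longrightarrow> h \<in> S \<Longrightarrow> B (\<lambda>x. f x - g x) h = B f h - B g h"
  using B_lin[of f g h "-1"] by simp

lemma minus_in: "f \<in> S \<Longrightarrow> g \<in> S \<Longrightarrow> (\<lambda>x. f x - g x) \<in> S"
  using lin[of f g "-1"] by simp

lemma B_minus_minus:
  assumes "f \<in> S" "g \<in> S"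
  shows "B (\<lambda>x. f x - g x) (\<lambda>x. f x - g x) = B f f - 2 * B f g + B g g"
  using assms by (simp add: B_minus minus_in sym[of _ "\<lambda>x. f x - g x"] sym[of g f])

lemma B_null:
  assumes f: "f \<in> S" and g: "g \<in> S" and null: "B f f = 0"
  shows "B g f = 0"
proof (rule ccontr)
  assume nz: "B g f \<noteq> 0"
  define c where "c = - (B g g + 1) / (2 * B g f)"
  have "0 \<le> B (\<lambda>x. g x + c *\<^sub>R f x) (\<lambda>x. g x + c *\<^sub>R f x)"
    by (rule nonneg[OF lin[OF g f]])
  also have "\<dots> = B g g + 2 * c * B g f + c * c * B f f"
    using f g lin[OF g f, of c] by (simp add: B_lin sym[of _ "\<lambda>x. g x + c *\<^sub>R f x"] sym[of f g] algebra_simps)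
  also have "\<dots> = -1"
    using nz by (simp add: null c_def field_simps)
  finally show False by simp
qed

text \<open>Orthonormal families in which null vectors are admitted, so that Gram-Schmidt applies to any finite
  family. A null vector is orthogonal to everything (lemma \<open>B_null\<close>), hence projections and Bessel's
  inequality keep their usual form.\<close>

definition ortho :: "'i set \<Rightarrow> ('i \<Rightarrow> 'a \<Rightarrow> 'v) \<Rightarrow> bool" where
  "ortho A e \<longleftrightarrow> finite A \<and> (\<forall>i\<in>A. e i \<in> S \<and> (B (e i) (e i) = 0 \<or> B (e i) (e i) = 1)) \<and>
     (\<forall>i\<in>A. \<forall>j\<in>A. i \<noteq> j \<longrightarrow> B (e i) (e j) = 0)"

definition proj :: "'i set \<Rightarrow> ('i \<Rightarrow> 'a \<Rightarrow> 'v) \<Rightarrow> ('a \<Rightarrow> 'v) \<Rightarrow> 'a \<Rightarrow> 'v" where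
  "proj A e f = (\<lambda>x. \<Sum>i\<in>A. B f (e i) *\<^sub>R e i x)"

lemma proj_in: "ortho A e \<Longrightarrow> proj A e f \<in> S"
  unfolding proj_def by (intro lin_sum) (auto simp: ortho_def)

lemma B_proj:
  assumes "ortho A e" "f \<in> S" "k \<in> A"
  shows "B (proj A e f) (e k) = B f (e k)"
proof -
  have "B (proj A e f) (e k) = (\<Sum>i\<in>A. B f (e i) * B (e i) (e k))"
    unfolding proj_def using assms by (intro B_sum) (auto simp: ortho_def)
  also have "\<dots> = (\<Sum>i\<in>A. if i = k then B f (e k) else 0)"
    using assms B_null[of "e k" f] by (intro sum.cong) (auto simp: ortho_def)
  also have "\<dots> = B f (e k)"
    using assms by (simp add: ortho_def)
  finally show ?thesis .
qed

lemma B_proj_sq: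
  assumes "ortho A e" "f \<in> S" "g \<in> S"
  shows "B (proj A e f) g = (\<Sum>i\<in>A. B f (e i) * B g (e i))"
proof -
  have "B (proj A e f) g = (\<Sum>i\<in>A. B f (e i) * B (e i) g)"
    unfolding proj_def using assms by (intro B_sum) (auto simp: ortho_def)
  then show ?thesis using assms sym by (auto simp: ortho_def intro!: sum.cong)
qed

lemma B_proj_proj:
  assumes "ortho A e" "f \<in> S"
  shows "B (proj A e f) (proj A e f) = (\<Sum>i\<in>A. (B f (e i))\<^sup>2)"
  using assms by (simp add: B_proj_sq proj_in B_proj power2_eq_square)

lemma bessel:
  assumes "ortho A e" "f \<in> S"
  shows "(\<Sum>i\<in>A. (B f (e i))\<^sup>2) \<le> B f f"
proof -
  have "0 \<le> B (\<lambda>x. f x - proj A e f x) (\<lambda>x. f x - proj A e f x)"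
    using assms by (intro nonneg minus_in proj_in)
  also have "\<dots> = B f f - 2 * B (proj A e f) f + B (proj A e f) (proj A e f)"
    using assms by (simp add: B_minus_minus proj_in sym[of f "proj A e f"])
  also have "\<dots> = B f f - (\<Sum>i\<in>A. (B f (e i))\<^sup>2)"
    unfolding B_proj_proj[OF assms] unfolding B_proj_sq[OF assms assms(2)] by (simp add: power2_eq_square)
  finally show ?thesis by simp
qed

text \<open>The condition \<open>t j \<noteq> 0\<close> records that \<open>e j\<close> is a nontrivial combination of the given vectors. When these
  are independent modulo null vectors, no \<open>e j\<close> is null and the family is orthonormal.\<close>

lemma gram_schmidt:
  fixes n :: nat
  assumes "\<And>i. i < n \<Longrightarrow> b i \<in> S"
  shows "\<exists>e. ortho {..<n} e \<and>
    (\<forall>j<n. \<exists>t. t j \<noteq> 0 \<and> (\<forall>x. e j x = (\<Sum>i<n. t i *\<^sub>R b i x))) \<and>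
    (\<forall>j<n. \<exists>s. \<forall>x. b j x = (\<Sum>i<n. s i *\<^sub>R e i x))"
  using assms
proof (induction n)
  case 0
  then show ?case by (auto simp: ortho_def)
next
  case (Suc n)
  then obtain e where e: "ortho {..<n} e"
    and et: "\<forall>j<n. \<exists>t. t j \<noteq> 0 \<and> (\<forall>x. e j x = (\<Sum>i<n. t i *\<^sub>R b i x))"
    and es: "\<forall>j<n. \<exists>s. \<forall>x. b j x = (\<Sum>i<n. s i *\<^sub>R e i x)"
    by force
  have bn: "b n \<in> S" using Suc.prems by simp
  define r where "r = (\<lambda>x. b n x - proj {..<n} e (b n) x)"
  have r: "r \<in> S" unfolding r_def by (intro minus_in bn proj_in e)
  have re: "B r (e k) = 0" if "k < n" for k
    unfolding r_def using that e by (subst B_minus) (auto simp: bn proj_in[OF e] B_proj[OF e bn] ortho_def)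
  \<comment> \<open>a null residue is kept as it is: the new vectors must still span the old ones exactly\<close>
  define d where "d = (if B r r = 0 then 1 else 1 / sqrt (B r r))"
  have d: "d \<noteq> 0" using nonneg[OF r] by (simp add: d_def)
  define en where "en = (\<lambda>x. d *\<^sub>R r x)"
  have en: "en \<in> S" unfolding en_def using lin[OF zero r, of d] by simp
  have Ben: "B en h = d * B r h" if "h \<in> S" for h
    unfolding en_def using B_lin[OF zero r that, of d] B_zero[OF that] by simp
  have Benen: "B en en = 0 \<or> B en en = 1"
  proof -
    have "B en en = d * d * B r r"
      using Ben[OF en] Ben[OF r] sym[OF r en] by simp
    then show ?thesis using nonneg[OF r] by (auto simp: d_def)
  qed
  define e' where "e' = e(n := en)"
  have e'n: "e' n = en" and e'e: "\<And>i. i < n \<Longrightarrow> e' i = e i" by (auto simp: e'_def)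
  have "ortho {..<Suc n} e'"
  proof -
    have z: "B en (e i) = 0 \<and> B (e i) en = 0" if "i < n" for i
      using that e Ben[of "e i"] re[OF that] sym[OF en, of "e i"] by (auto simp: ortho_def)
    show ?thesis
      using e z Benen en unfolding ortho_def lessThan_Suc ball_simps by (simp add: e'n e'e)
  qed
  moreover have "\<forall>j<Suc n. \<exists>t. t j \<noteq> 0 \<and> (\<forall>x. e' j x = (\<Sum>i<Suc n. t i *\<^sub>R b i x))"
  proof (intro allI impI)
    fix j assume "j < Suc n"
    then consider "j < n" | "j = n" by linarith
    then show "\<exists>t. t j \<noteq> 0 \<and> (\<forall>x. e' j x = (\<Sum>i<Suc n. t i *\<^sub>R b i x))"
    proof cases
      case 1
      then obtain t where t: "t j \<noteq> 0" "\<forall>x. e j x = (\<Sum>i<n. t i *\<^sub>R b i x)" using et by blast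
      then show ?thesis using 1 by (intro exI[of _ "t(n := 0)"]) (auto simp: e'e)
    next
      case 2
      from et obtain t where t: "\<forall>j<n. \<forall>x. e j x = (\<Sum>i<n. t j i *\<^sub>R b i x)" by metis
      have "en x = (\<Sum>i<Suc n. (if i = n then d else - d * (\<Sum>j<n. B (b n) (e j) * t j i)) *\<^sub>R b i x)" for x
      proof -
        have "proj {..<n} e (b n) x = (\<Sum>j<n. B (b n) (e j) *\<^sub>R (\<Sum>i<n. t j i *\<^sub>R b i x))"
          unfolding proj_def using t by (intro sum.cong) auto
        also have "\<dots> = (\<Sum>i<n. \<Sum>j<n. (B (b n) (e j) * t j i) *\<^sub>R b i x)"
          unfolding scaleR_sum_right by (subst sum.swap) simp
        finally have "en x = d *\<^sub>R b n x - d *\<^sub>R (\<Sum>i<n. \<Sum>j<n. (B (b n) (e j) * t j i) *\<^sub>R b i x)"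
          by (simp add: en_def r_def scaleR_diff_right)
        then show ?thesis
          by (simp add: scaleR_sum_left[symmetric] scaleR_sum_right sum_negf)
      qed
      then show ?thesis using d 2
        by (intro exI[of _ "\<lambda>i. if i = n then d else - d * (\<Sum>j<n. B (b n) (e j) * t j i)"])
           (auto simp: e'n simp del: sum.lessThan_Suc)
    qed
  qed
  moreover have "\<forall>j<Suc n. \<exists>s. \<forall>x. b j x = (\<Sum>i<Suc n. s i *\<^sub>R e' i x)"
  proof (intro allI impI)
    fix j assume "j < Suc n"
    then consider "j < n" | "j = n" by linarith
    then show "\<exists>s. \<forall>x. b j x = (\<Sum>i<Suc n. s i *\<^sub>R e' i x)"
    proof cases
      case 1
      then obtain s where "\<forall>x. b j x = (\<Sum>i<n. s i *\<^sub>R e i x)" using es by blast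
      then show ?thesis by (intro exI[of _ "s(n := 0)"]) (auto simp: e'e)
    next
      case 2
      have "b n x = (\<Sum>i<n. B (b n) (e i) *\<^sub>R e i x) + (1 / d) *\<^sub>R en x" for x
        using d by (simp add: en_def r_def proj_def)
      then show ?thesis using 2
        by (intro exI[of _ "\<lambda>i. if i = n then 1 / d else B (b n) (e i)"]) (auto simp: e'n e'e)
    qed
  qed
  ultimately show ?case by blast
qed

end

lemma (in semi_inner) B_lin_lin:
  assumes "f \<in> S" "g \<in> S"
  shows "B (\<lambda>x. f x + c *\<^sub>R g x) (\<lambda>x. f x + c *\<^sub>R g x) = B f f + 2 * c * B f g + c * c * B g g"
  using assms lin[OF assms, of c]
  by (simp add: B_lin sym[of _ "\<lambda>x. f x + c *\<^sub>R g x"] sym[of g f] algebra_simps)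

lemma (in semi_inner) cauchy_schwarz:
  assumes f: "f \<in> S" and g: "g \<in> S"
  shows "(B f g)\<^sup>2 \<le> B f f * B g g"
proof (cases "B g g = 0")
  case True
  then show ?thesis using B_null[OF g f] by simp
next
  case False
  then have pos: "B g g > 0" using nonneg[OF g] by simp
  define c where "c = - B f g / B g g"
  have "0 \<le> B f f + 2 * c * B f g + c * c * B g g"
    using nonneg[OF lin[OF f g, of c]] B_lin_lin[OF f g, of c] by simp
  also have "\<dots> = B f f - (B f g)\<^sup>2 / B g g"
    using pos by (simp add: c_def field_simps power2_eq_square)
  finally show ?thesis using pos by (simp add: field_simps)
qed

lemma (in semi_inner) tendsto_B_null:
  assumes "\<And>n. f n \<in> S" "\<And>n. g n \<in> S"
    and "(\<lambda>n. B (f n) (f n)) \<longlonglongrightarrow> 0" "(\<lambda>n. B (g n) (g n)) \<longlonglongrightarrow> b"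
  shows "(\<lambda>n. B (f n) (g n)) \<longlonglongrightarrow> 0"
proof (rule Lim_null_comparison)
  show "\<forall>\<^sub>F n in sequentially. norm (B (f n) (g n)) \<le> sqrt (B (f n) (f n) * B (g n) (g n))"
    by (intro always_eventually allI real_le_rsqrt) (use cauchy_schwarz assms in auto)
  show "(\<lambda>n. sqrt (B (f n) (f n) * B (g n) (g n))) \<longlonglongrightarrow> 0"
    using tendsto_real_sqrt[OF tendsto_mult[OF assms(3,4)]] by simp
qed

lemma (in semi_inner) tendsto_B:
  assumes "\<And>n. f n \<in> S" "g \<in> S" "h \<in> S"
    and lim: "(\<lambda>n. B (\<lambda>x. f n x - g x) (\<lambda>x. f n x - g x)) \<longlonglongrightarrow> 0"
  shows "(\<lambda>n. B (f n) h) \<longlonglongrightarrow> B g h" "(\<lambda>n. B (f n) (f n)) \<longlonglongrightarrow> B g g"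
proof -
  have *: "(\<lambda>n. B (\<lambda>x. f n x - g x) h) \<longlonglongrightarrow> 0" if "h \<in> S" for h
    using assms that by (intro tendsto_B_null[OF _ _ lim tendsto_const] minus_in)
  have lim_h: "(\<lambda>n. B (f n) h) \<longlonglongrightarrow> B g h" if "h \<in> S" for h
  proof -
    have "(\<lambda>n. B (\<lambda>x. f n x - g x) h + B g h) \<longlonglongrightarrow> 0 + B g h"
      by (intro tendsto_add * that tendsto_const)
    then show ?thesis using assms that by (simp add: B_minus)
  qed
  then show "(\<lambda>n. B (f n) h) \<longlonglongrightarrow> B g h" using assms by blast
  have "(\<lambda>n. B (\<lambda>x. f n x - g x) (\<lambda>x. f n x - g x) + 2 * B (f n) g - B g g) \<longlonglongrightarrow> 0 + 2 * B g g - B g g"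
    by (intro tendsto_intros lim lim_h assms)
  then show "(\<lambda>n. B (f n) (f n)) \<longlonglongrightarrow> B g g"
    using assms by (simp add: B_minus_minus)
qed

section \<open>The energy of functions of given parity on the sphere\<close>

definition sphere_ip :: "(R3 \<Rightarrow> real) \<Rightarrow> (R3 \<Rightarrow> real) \<Rightarrow> real" where
  "sphere_ip f g = (LINT x|surface_measure. f x * g x)"

lemma integrable_mult_surface:
  "continuous_on (- {0}) f \<Longrightarrow> continuous_on (- {0}) g \<Longrightarrow> integrable surface_measure (\<lambda>x. f x * g x :: real)"
  by (intro integrable_surface continuous_intros)

interpretation sph: semi_inner "{f :: R3 \<Rightarrow> real. continuous_on (- {0}) f}" sphere_ip
proof
  fix f g h :: "R3 \<Rightarrow> real" and c :: real
  assume "f \<in> {f. continuous_on (- {0}) f}" "g \<in> {f. continuous_on (- {0}) f}" "h \<in> {f. continuous_on (- {0}) f}"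
  then have "integrable surface_measure (\<lambda>x. f x * h x)" "integrable surface_measure (\<lambda>x. g x * h x)"
    by (simp_all add: integrable_mult_surface)
  then show "sphere_ip (\<lambda>x. f x + c *\<^sub>R g x) h = sphere_ip f h + c * sphere_ip g h"
    by (simp add: sphere_ip_def distrib_right mult.assoc)
qed (auto simp: sphere_ip_def mult.commute intro!: continuous_intros)

text \<open>The Dirichlet form \<open>\<integral> \<nabla>F \<bullet> \<nabla>G\<close> of the sphere, written with the rotation fields.\<close>

definition energy :: "(R3 \<Rightarrow> real) \<Rightarrow> (R3 \<Rightarrow> real) \<Rightarrow> real" where
  "energy F G = (LINT x|surface_measure. (1/2) * (\<Sum>i\<in>UNIV. \<Sum>j\<in>UNIV. rot i j F x * rot i j G x))"

lemma energy_integrable: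
  assumes "C1 F" "C1 G"
  shows "integrable surface_measure (\<lambda>x. rot i j F x * rot i j G x)"
  using assms by (intro integrable_mult_surface C1_continuous_rot)

lemma energy_sphere_ip:
  assumes "C1 F" "C1 G"
  shows "energy F G = (1/2) * (\<Sum>i\<in>UNIV. \<Sum>j\<in>UNIV. sphere_ip (rot i j F) (rot i j G))"
  unfolding energy_def sphere_ip_def using energy_integrable[OF assms] by simp

interpretation en: semi_inner "{F. C1 F}" energy
proof
  show "(\<lambda>x. 0) \<in> {F. C1 F}" by (simp add: C1_const)
  fix f g h :: "R3 \<Rightarrow> real" and c :: real
  show "0 \<le> energy f f"
    unfolding energy_def by (rule integral_nonneg_AE, rule AE_I2) (simp add: sum_nonneg)
  show "energy f g = energy g f"
    by (simp add: energy_def mult.commute)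
  assume C: "f \<in> {F. C1 F}" "g \<in> {F. C1 F}"
  then have C': "C1 f" "C1 g" by auto
  then show S: "(\<lambda>x. f x + c *\<^sub>R g x) \<in> {F. C1 F}"
    by (simp add: C1_add C1_cmult)
  assume "h \<in> {F. C1 F}"
  then have h: "C1 h" by simp
  have "sphere_ip (rot i j (\<lambda>x. f x + c *\<^sub>R g x)) (rot i j h) = sphere_ip (rot i j f) (rot i j h) + c * sphere_ip (rot i j g) (rot i j h)" for i j
  proof -
    have "sphere_ip (rot i j (\<lambda>x. f x + c *\<^sub>R g x)) (rot i j h) = sphere_ip (\<lambda>x. rot i j f x + c *\<^sub>R rot i j g x) (rot i j h)"
      unfolding sphere_ip_def
    proof (rule integral_surface_cong)
      show "continuous_on (- {0}) (\<lambda>x. rot i j (\<lambda>x. f x + c *\<^sub>R g x) x * rot i j h x)"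
        using S h by (intro continuous_intros C1_continuous_rot) auto
      show "continuous_on (- {0}) (\<lambda>x. (rot i j f x + c *\<^sub>R rot i j g x) * rot i j h x)"
        by (intro continuous_intros C1_continuous_rot C' h)
      fix x :: R3 assume "x \<in> S2"
      then have "x \<noteq> 0" by (rule S2_nonzero)
      then show "rot i j (\<lambda>x. f x + c *\<^sub>R g x) x * rot i j h x = (rot i j f x + c *\<^sub>R rot i j g x) * rot i j h x"
        using C' by (simp add: rot_add rot_cmult C1_differentiable C1_cmult)
    qed
    also have "\<dots> = sphere_ip (rot i j f) (rot i j h) + c * sphere_ip (rot i j g) (rot i j h)"
      by (rule sph.B_lin) (simp_all add: C1_continuous_rot C' h)
    finally show ?thesis .
  qed
  then show "energy (\<lambda>x. f x + c *\<^sub>R g x) h = energy f h + c * energy g h"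
    using S h C' by (simp add: energy_sphere_ip sum.distrib sum_distrib_left algebra_simps)
qed

lemma sphere_ip_sym: "sphere_ip f g = sphere_ip g f"
  by (simp add: sphere_ip_def mult.commute)

lemma sphere_ip_cmult: "sphere_ip f (\<lambda>x. c * g x) = c * sphere_ip f g"
proof -
  have "(\<lambda>x. f x * (c * g x)) = (\<lambda>x. c * (f x * g x))" by (auto simp: mult.left_commute)
  then show ?thesis by (simp add: sphere_ip_def)
qed

lemma sphere_ip_cong:
  assumes "continuous_on (- {0}) f" "continuous_on (- {0}) f'" "continuous_on (- {0}) g" "continuous_on (- {0}) g'"
    and "\<And>x. x \<in> S2 \<Longrightarrow> f x = f' x" "\<And>x. x \<in> S2 \<Longrightarrow> g x = g' x"
  shows "sphere_ip f g = sphere_ip f' g'"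
  unfolding sphere_ip_def
  by (rule integral_surface_cong) (use assms(5,6) in \<open>auto intro!: continuous_intros assms(1-4)\<close>)

lemma sphere_ip_antipode:
  assumes "continuous_on (- {0}) f" "continuous_on (- {0}) g"
  shows "sphere_ip (\<lambda>x. f (- x)) (\<lambda>x. g (- x)) = sphere_ip f g"
proof -
  have "orthogonal_transformation (\<lambda>x::R3. - x)"
    by (simp add: orthogonal_transformation_neg)
  then show ?thesis
    unfolding sphere_ip_def using assms
    by (intro integral_surface_orthogonal[of "\<lambda>x. - x" "\<lambda>x. f x * g x"] borel_measurable_punctured continuous_intros)
qed

text \<open>Rotation fields are tangent to the sphere, so they see only the restriction of a function to it: their
  flow lines starting on the sphere stay on it.\<close>

lemma rot_cong:
  assumes "C1 F" "C1 G" "\<And>x. x \<in> S2 \<Longrightarrow> F x = G x" and x: "x \<in> S2"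
  shows "rot i j F x = rot i j G x"
proof (cases "i = j")
  case False
  have "((\<lambda>t. F (turn i j t x)) has_real_derivative rot i j F (turn i j 0 x)) (at 0)"
    by (rule turn_deriv[OF assms(1) False x])
  moreover have "((\<lambda>t. G (turn i j t x)) has_real_derivative rot i j G (turn i j 0 x)) (at 0)"
    by (rule turn_deriv[OF assms(2) False x])
  moreover have "(\<lambda>t. F (turn i j t x)) = (\<lambda>t. G (turn i j t x))"
    using turn_S2[OF False x] assms(3) by blast
  ultimately show ?thesis
    using DERIV_unique by (simp add: turn_0)
qed (simp add: rot_def)

lemma energy_cong:
  assumes "C1 F" "C1 F'" "C1 G" "C1 G'"
    and "\<And>x. x \<in> S2 \<Longrightarrow> F x = F' x" "\<And>x. x \<in> S2 \<Longrightarrow> G x = G' x"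
  shows "energy F G = energy F' G'"
  unfolding energy_sphere_ip[OF assms(1,3)] energy_sphere_ip[OF assms(2,4)]
  by (intro arg_cong2[where f = "(*)"] refl sum.cong sphere_ip_cong C1_continuous_rot assms(1-4) rot_cong)
     (use assms in auto)

text \<open>Green's formula; one factor is only \<open>C\<^sup>1\<close>, the second derivatives fall on the polynomial.\<close>

lemma energy_casimir:
  assumes F: "C1 F" and p: "hom_poly n p"
  shows "energy F p = sphere_ip F (casimir p)"
proof -
  have c: "continuous_on (- {0}) F" "continuous_on (- {0}) (rot i j (rot i j p))" for i j
    by (intro C1_continuous C1_continuous_rot F hom_poly_C1[OF rot_hom_poly[OF p]])+
  have "sphere_ip (rot i j F) (rot i j p) = - sphere_ip F (rot i j (rot i j p))" for i j
    unfolding sphere_ip_def by (rule integral_rot_by_parts[OF F hom_poly_C1[OF rot_hom_poly[OF p]]])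
  then have "energy F p = - (1/2) * (\<Sum>i\<in>UNIV. \<Sum>j\<in>UNIV. sphere_ip F (rot i j (rot i j p)))"
    by (simp add: energy_sphere_ip[OF F hom_poly_C1[OF p]] sum_negf)
  also have "\<dots> = sphere_ip F (casimir p)"
    unfolding sphere_ip_def casimir_def using integrable_mult_surface[OF c]
    by (simp add: sum_distrib_left mult.left_commute)
  finally show ?thesis .
qed

definition poly_dim :: "nat \<Rightarrow> nat" where
  "poly_dim n = (n + 1) * (n + 2) div 2"

text \<open>An orthonormal family, possibly with null vectors, that spans the homogeneous polynomials of degree
  \<open>n\<close> for the inner product of the sphere.\<close>

definition onb :: "nat \<Rightarrow> nat \<Rightarrow> R3 \<Rightarrow> real" where
  "onb n = (SOME e. sph.ortho {..<poly_dim n} e \<and> (\<forall>i<poly_dim n. hom_poly n (e i)) \<and>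
     (\<forall>p. hom_poly n p \<longrightarrow> (\<exists>c. \<forall>x. p x = (\<Sum>i<poly_dim n. c i * e i x))))"

lemma hom_poly_continuous: "hom_poly n p \<Longrightarrow> continuous_on (- {0}) p"
  by (intro C1_continuous hom_poly_C1)

lemma onb_exists: "\<exists>e. sph.ortho {..<poly_dim n} e \<and> (\<forall>i<poly_dim n. hom_poly n (e i)) \<and>
     (\<forall>p. hom_poly n p \<longrightarrow> (\<exists>c. \<forall>x. p x = (\<Sum>i<poly_dim n. c i * e i x)))"
proof -
  obtain b where b: "\<And>i. hom_poly n (b i)" and span: "\<And>p. hom_poly n p \<Longrightarrow> \<exists>c. \<forall>x. p x = (\<Sum>i<poly_dim n. c i * b i x)"
    using hom_poly_basis[of n] unfolding poly_dim_def by metis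
  obtain e where e: "sph.ortho {..<poly_dim n} e"
    and et: "\<forall>j<poly_dim n. \<exists>t. t j \<noteq> 0 \<and> (\<forall>x. e j x = (\<Sum>i<poly_dim n. t i *\<^sub>R b i x))"
    and es: "\<forall>j<poly_dim n. \<exists>s. \<forall>x. b j x = (\<Sum>i<poly_dim n. s i *\<^sub>R e i x)"
    using sph.gram_schmidt[of "poly_dim n" b] hom_poly_continuous[OF b] by auto
  have "hom_poly n (e j)" if j: "j < poly_dim n" for j
  proof -
    obtain t where "\<forall>x. e j x = (\<Sum>i<poly_dim n. t i * b i x)" using et j by auto
    then have "e j = (\<lambda>x. \<Sum>i<poly_dim n. t i * b i x)" by (intro ext) simp
    moreover have "hom_poly n (\<lambda>x. \<Sum>i<poly_dim n. t i * b i x)" by (intro hom_poly_sum hom_poly_cmult b)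
    ultimately show ?thesis by simp
  qed
  moreover have "\<exists>c. \<forall>x. p x = (\<Sum>i<poly_dim n. c i * e i x)" if p: "hom_poly n p" for p
  proof -
    obtain c where c: "\<And>x. p x = (\<Sum>i<poly_dim n. c i * b i x)" using span[OF p] by blast
    obtain s where s: "\<And>j x. j < poly_dim n \<Longrightarrow> b j x = (\<Sum>i<poly_dim n. s j i * e i x)" using es by (auto; metis)
    have "p x = (\<Sum>i<poly_dim n. (\<Sum>j<poly_dim n. c j * s j i) * e i x)" for x
    proof -
      have "p x = (\<Sum>j<poly_dim n. \<Sum>i<poly_dim n. c j * s j i * e i x)"
        unfolding c using s by (auto simp: sum_distrib_left mult.assoc intro!: sum.cong)
      then show ?thesis by (subst (asm) sum.swap) (simp add: sum_distrib_right)
    qed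
    then show ?thesis by (intro exI[of _ "\<lambda>i. \<Sum>j<poly_dim n. c j * s j i"] allI)
  qed
  ultimately show ?thesis using e by blast
qed

lemma onb: "sph.ortho {..<poly_dim n} (onb n)" "i < poly_dim n \<Longrightarrow> hom_poly n (onb n i)"
     "hom_poly n p \<Longrightarrow> \<exists>c. \<forall>x. p x = (\<Sum>i<poly_dim n. c i * onb n i x)"
  using someI_ex[OF onb_exists[of n]] unfolding onb_def[symmetric] by blast+

lemma onb_continuous: "i < poly_dim n \<Longrightarrow> continuous_on (- {0}) (onb n i)"
  using onb(2) by (rule hom_poly_continuous)

definition poly_proj :: "nat \<Rightarrow> (R3 \<Rightarrow> real) \<Rightarrow> R3 \<Rightarrow> real" where
  "poly_proj n F = sph.proj {..<poly_dim n} (onb n) F"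

definition proj_mass :: "nat \<Rightarrow> (R3 \<Rightarrow> real) \<Rightarrow> real" where
  "proj_mass n F = (\<Sum>i<poly_dim n. (sphere_ip F (onb n i))\<^sup>2)"

lemma proj_hom_poly: "hom_poly n (poly_proj n F)"
  unfolding poly_proj_def sph.proj_def by (auto intro!: hom_poly_sum hom_poly_cmult onb(2))

lemma sphere_ip_proj:
  assumes F: "continuous_on (- {0}) F" and p: "hom_poly n p"
  shows "sphere_ip (poly_proj n F) p = sphere_ip F p"
proof -
  obtain c where "\<forall>x. p x = (\<Sum>i<poly_dim n. c i * onb n i x)" using onb(3)[OF p] by blast
  then have p_eq: "p = (\<lambda>x. \<Sum>i<poly_dim n. c i *\<^sub>R onb n i x)" by (intro ext) simp
  note onb_cont = onb_continuous[of _ n]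
  have eq: "sphere_ip G p = (\<Sum>i<poly_dim n. c i * sphere_ip G (onb n i))" if "continuous_on (- {0}) G" for G
  proof -
    have "sphere_ip p G = (\<Sum>i<poly_dim n. c i * sphere_ip (onb n i) G)"
      unfolding p_eq using that onb_cont by (intro sph.B_sum) auto
    then show ?thesis by (simp add: sphere_ip_def mult.commute)
  qed
  show ?thesis
    unfolding eq[OF F] eq[OF hom_poly_continuous[OF proj_hom_poly]] unfolding poly_proj_def
    using F by (intro sum.cong) (auto simp: sph.B_proj[OF onb(1)])
qed

lemma sphere_ip_proj_self:
  assumes F: "continuous_on (- {0}) F"
  shows "sphere_ip (poly_proj n F) (poly_proj n F) = proj_mass n F" "sphere_ip F (poly_proj n F) = proj_mass n F"
proof -
  show "sphere_ip (poly_proj n F) (poly_proj n F) = proj_mass n F"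
    unfolding poly_proj_def proj_mass_def using F by (intro sph.B_proj_proj onb) auto
  then show "sphere_ip F (poly_proj n F) = proj_mass n F"
    using sphere_ip_proj[OF F proj_hom_poly, of n] by simp
qed

text \<open>Going from degree \<open>n\<close> to degree \<open>n + 2\<close> adds to the projection of \<open>F\<close> a polynomial \<open>r\<close> orthogonal to
  the polynomials of degree \<open>n\<close>. By lemma \<open>casimir_eq\<close> the operator maps \<open>r\<close> to \<open>(n + 2) (n + 3) r\<close> up to a
  polynomial of degree \<open>n\<close>, so \<open>r\<close> contributes exactly \<open>(n + 2) (n + 3)\<close> times its square norm to the energy.
  In other words, \<open>r\<close> is the component of \<open>F\<close> among the spherical harmonics of degree \<open>n + 2\<close>.\<close>

lemma projection_step:
  assumes F: "continuous_on (- {0}) F"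
  shows "energy (poly_proj (n+2) F) (poly_proj (n+2) F) = energy (poly_proj n F) (poly_proj n F) + (real n + 2) * (real n + 3) * (proj_mass (n+2) F - proj_mass n F)"
    and "proj_mass n F \<le> proj_mass (n+2) F"
proof -
  define p where "p = poly_proj (n+2) F"
  define p0 where "p0 = poly_proj n F"
  \<comment> \<open>the projection to degree n, rewritten as a polynomial of degree n + 2\<close>
  define q where "q = (\<lambda>x. (x \<bullet> x) * p0 x)"
  define r where "r = (\<lambda>x. p x - q x)"
  have hom_poly: "hom_poly (n+2) p" "hom_poly n p0" "hom_poly (n+2) q" "hom_poly (n+2) r"
    unfolding r_def q_def p_def p0_def by (intro proj_hom_poly hom_poly_raise hom_poly_diff)+
  note cont = hom_poly[THEN hom_poly_continuous]
  note C = hom_poly[THEN hom_poly_C1]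
  have q_eq: "q x = p0 x" if "x \<in> S2" for x
    using that by (simp add: q_def dot_square_norm)
  have r_perp: "sphere_ip r s = 0" if s: "hom_poly n s" for s
  proof -
    have "sphere_ip p s = sphere_ip p (\<lambda>x. (x \<bullet> x) * s x)"
      by (rule sphere_ip_cong) (use cont hom_poly_continuous[OF s] hom_poly_continuous[OF hom_poly_raise[OF s]] in \<open>auto simp: dot_square_norm\<close>)
    also have "\<dots> = sphere_ip F (\<lambda>x. (x \<bullet> x) * s x)"
      unfolding p_def by (rule sphere_ip_proj[OF F hom_poly_raise[OF s]])
    also have "\<dots> = sphere_ip F s"
      by (rule sphere_ip_cong) (use F hom_poly_continuous[OF s] hom_poly_continuous[OF hom_poly_raise[OF s]] in \<open>auto simp: dot_square_norm\<close>)
    finally have "sphere_ip p s = sphere_ip F s" .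
    moreover have "sphere_ip q s = sphere_ip F s"
      using sphere_ip_proj[OF F s] sphere_ip_cong[OF cont(3,2) hom_poly_continuous[OF s] hom_poly_continuous[OF s]] q_eq by (simp add: p0_def)
    moreover have "sphere_ip r s = sphere_ip p s - sphere_ip q s"
      unfolding r_def using cont hom_poly_continuous[OF s] by (intro sph.B_minus) auto
    ultimately show ?thesis by simp
  qed
  have rr: "sphere_ip r r = proj_mass (n+2) F - proj_mass n F"
  proof -
    have "sphere_ip r r = sphere_ip p p - 2 * sphere_ip p q + sphere_ip q q"
      unfolding r_def using cont by (intro sph.B_minus_minus) auto
    moreover have "sphere_ip q q = proj_mass n F"
      using sphere_ip_cong[OF cont(3,2,3,2)] q_eq sphere_ip_proj_self(1)[OF F, of n] by (simp add: p0_def)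
    moreover have "sphere_ip p q = proj_mass n F"
    proof -
      have "sphere_ip p q = sphere_ip F q" unfolding p_def by (rule sphere_ip_proj[OF F hom_poly(3)])
      also have "\<dots> = sphere_ip F p0" using sphere_ip_cong[OF F F cont(3,2)] q_eq by simp
      finally show ?thesis using sphere_ip_proj_self(2)[OF F] by (simp add: p0_def)
    qed
    ultimately show ?thesis using sphere_ip_proj_self(1)[OF F] by (simp add: p_def)
  qed
  then show "proj_mass n F \<le> proj_mass (n+2) F"
    using sph.nonneg[of r] cont by simp
  have "energy r q = energy r p0"
    using energy_cong[OF C(4,4,3,2)] q_eq by simp
  also have "\<dots> = sphere_ip r (casimir p0)"
    by (rule energy_casimir[OF C(4) hom_poly(2)])
  also have "\<dots> = 0"
    by (rule r_perp[OF casimir_hom_poly[OF hom_poly(2)]])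
  finally have rq: "energy r q = 0" .
  have "energy r r = sphere_ip r (casimir r)"
    by (rule energy_casimir[OF C(4) hom_poly(4)])
  also have "\<dots> = sphere_ip r (\<lambda>x. (real n + 2) * (real n + 3) * r x - laplacian r x)"
  proof (rule sphere_ip_cong)
    show "continuous_on (- {0}) (\<lambda>x. (real n + 2) * (real n + 3) * r x - laplacian r x)"
      by (intro continuous_intros cont hom_poly_continuous[OF laplacian_hom_poly[OF hom_poly(4)]])
    show "casimir r x = (real n + 2) * (real n + 3) * r x - laplacian r x" if "x \<in> S2" for x
      using that casimir_eq[OF hom_poly(4), of x] by (simp add: dot_square_norm algebra_simps)
  qed (use cont hom_poly_continuous[OF casimir_hom_poly[OF hom_poly(4)]] in auto)
  also have "\<dots> = (real n + 2) * (real n + 3) * sphere_ip r r - sphere_ip r (laplacian r)"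
  proof -
    have "sphere_ip (\<lambda>x. (real n + 2) * (real n + 3) * r x - laplacian r x) r
        = sphere_ip (\<lambda>x. (real n + 2) * (real n + 3) * r x) r - sphere_ip (laplacian r) r"
      using cont(4) hom_poly_continuous[OF laplacian_hom_poly[OF hom_poly(4)]]
      by (intro sph.B_minus) (auto intro: continuous_intros)
    then show ?thesis
      using sphere_ip_cmult[of r "(real n + 2) * (real n + 3)" r]
      by (simp add: sphere_ip_sym[of r "\<lambda>x. (real n + 2) * (real n + 3) * r x - laplacian r x"] sphere_ip_sym[of r "laplacian r"]
        sphere_ip_sym[of "\<lambda>x. (real n + 2) * (real n + 3) * r x" r])
  qed
  also have "sphere_ip r (laplacian r) = 0"
    by (rule r_perp[OF laplacian_hom_poly[OF hom_poly(4)]])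
  finally have err: "energy r r = (real n + 2) * (real n + 3) * (proj_mass (n+2) F - proj_mass n F)"
    by (simp add: rr)
  have "energy r r = energy p p - 2 * energy p q + energy q q"
    unfolding r_def using C by (intro en.B_minus_minus) auto
  moreover have "energy r q = energy p q - energy q q"
    unfolding r_def using C by (intro en.B_minus) auto
  moreover have "energy q q = energy p0 p0"
    using energy_cong[OF C(3,2,3,2)] q_eq by simp
  ultimately show "energy (poly_proj (n+2) F) (poly_proj (n+2) F) = energy (poly_proj n F) (poly_proj n F) + (real n + 2) * (real n + 3) * (proj_mass (n+2) F - proj_mass n F)"
    using rq err by (simp add: p_def p0_def)
qed

lemma energy_proj_small:
  assumes F: "continuous_on (- {0}) F" and n: "n < 2"
  shows "energy (poly_proj n F) (poly_proj n F) = real n * (real n + 1) * proj_mass n F"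
proof -
  have "energy (poly_proj n F) (poly_proj n F) = sphere_ip (poly_proj n F) (casimir (poly_proj n F))"
    by (rule energy_casimir[OF hom_poly_C1[OF proj_hom_poly] proj_hom_poly])
  also have "casimir (poly_proj n F) = (\<lambda>x. real n * (real n + 1) * poly_proj n F x)"
    using casimir_eq[OF proj_hom_poly] laplacian_hom_poly_small[OF proj_hom_poly n] by auto
  also have "sphere_ip (poly_proj n F) \<dots> = real n * (real n + 1) * proj_mass n F"
    unfolding sphere_ip_proj_self(1)[OF F, symmetric] by (rule sphere_ip_cmult)
  finally show ?thesis .
qed

text \<open>The sum of \<open>(L (n + 2) - L n) a n\<close> over the \<open>n < l\<close> of the parity of \<open>l\<close>, where \<open>L n = n (n + 1)\<close> is the \<open>n\<close>-th
  eigenvalue of the sphere; indeed \<open>L (n + 2) - L n = 4 n + 6\<close>. It arises from the sum of \<open>(L l - L n)\<close>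
  times the mass of \<open>F\<close> in degree \<open>n\<close> by summation by parts.\<close>

fun lower_sum :: "(nat \<Rightarrow> real) \<Rightarrow> nat \<Rightarrow> real" where
  "lower_sum a 0 = 0"
| "lower_sum a (Suc 0) = 0"
| "lower_sum a (Suc (Suc l)) = lower_sum a l + (4 * real l + 6) * a l"

lemma lower_sum_cong:
  "(\<And>n. n < l \<Longrightarrow> even n = even l \<Longrightarrow> a n = b n) \<Longrightarrow> lower_sum a l = lower_sum b l"
  by (induction l rule: induct_nat_012) auto

lemma lower_sum_mono:
  "(\<And>n. a n \<le> b n) \<Longrightarrow> lower_sum a l \<le> lower_sum b l"
  by (induction l rule: induct_nat_012) (auto intro!: add_mono mult_left_mono)

lemma lower_sum_cmult: "lower_sum (\<lambda>n. c * a n) l = c * lower_sum a l"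
  by (induction l rule: induct_nat_012) (auto simp: algebra_simps)

lemma lower_sum_sum: "lower_sum (\<lambda>n. \<Sum>j\<in>F. a j n) l = (\<Sum>j\<in>F. lower_sum (a j) l)"
  by (induction l rule: induct_nat_012) (auto simp: sum.distrib sum_distrib_left)

lemma lower_sum_tendsto:
  "(\<And>n. (\<lambda>k. a k n) \<longlonglongrightarrow> b n) \<Longrightarrow> (\<lambda>k. lower_sum (a k) l) \<longlonglongrightarrow> lower_sum b l"
  by (induction l rule: induct_nat_012) (auto intro!: tendsto_intros)

lemma energy_proj:
  assumes F: "continuous_on (- {0}) F"
  shows "energy (poly_proj l F) (poly_proj l F) = real l * (real l + 1) * proj_mass l F - lower_sum (\<lambda>n. proj_mass n F) l"
proof (induction "\<lambda>n. proj_mass n F" l rule: lower_sum.induct)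
  case (3 l)
  then show ?case
    using projection_step(1)[OF F, of l] by (simp add: algebra_simps)
qed (use energy_proj_small[OF F, of 0] energy_proj_small[OF F, of 1] in auto)

text \<open>Each step beyond degree \<open>l\<close> adds mass whose energy is counted with a factor larger than \<open>l (l + 1)\<close>.\<close>

lemma energy_proj_ge:
  assumes F: "continuous_on (- {0}) F"
  shows "energy (poly_proj (l + 2 * k) F) (poly_proj (l + 2 * k) F) \<ge> real l * (real l + 1) * proj_mass (l + 2 * k) F - lower_sum (\<lambda>n. proj_mass n F) l"
proof (induction k)
  case 0
  then show ?case by (simp add: energy_proj[OF F])
next
  case (Suc k)
  let ?n = "l + 2 * k"
  have "real l * (real l + 1) * (proj_mass (?n + 2) F - proj_mass ?n F) \<le> (real ?n + 2) * (real ?n + 3) * (proj_mass (?n + 2) F - proj_mass ?n F)"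
    using projection_step(2)[OF F, of ?n] by (intro mult_right_mono mult_mono) auto
  then show ?case
    using Suc projection_step(1)[OF F, of ?n] by (simp add: algebra_simps)
qed

text \<open>The energy form is semidefinite and the projection is orthogonal for it as well: the operator
  maps the polynomials of degree \<open>n\<close> into themselves.\<close>

lemma energy_ge_proj:
  assumes F: "C1 F"
  shows "energy (poly_proj n F) (poly_proj n F) \<le> energy F F"
proof -
  have p: "hom_poly n (poly_proj n F)" by (rule proj_hom_poly)
  have "energy F (poly_proj n F) = sphere_ip F (casimir (poly_proj n F))"
    by (rule energy_casimir[OF F p])
  also have "\<dots> = sphere_ip (poly_proj n F) (casimir (poly_proj n F))"
    by (rule sphere_ip_proj[symmetric, OF C1_continuous[OF F] casimir_hom_poly[OF p]])
  also have "\<dots> = energy (poly_proj n F) (poly_proj n F)"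
    by (rule energy_casimir[symmetric, OF hom_poly_C1[OF p] p])
  finally have "energy F (poly_proj n F) = energy (poly_proj n F) (poly_proj n F)" .
  moreover have "0 \<le> energy (\<lambda>x. F x - poly_proj n F x) (\<lambda>x. F x - poly_proj n F x)"
    using C1_diff[OF F hom_poly_C1[OF p]] by (intro en.nonneg) simp
  moreover have "energy (\<lambda>x. F x - poly_proj n F x) (\<lambda>x. F x - poly_proj n F x) = energy F F - 2 * energy F (poly_proj n F) + energy (poly_proj n F) (poly_proj n F)"
    using F hom_poly_C1[OF p] by (intro en.B_minus_minus) auto
  ultimately show ?thesis by simp
qed

lemma proj_mass_approx:
  assumes F: "continuous_on (- {0}) F" and q: "hom_poly n q" and e: "\<And>x. x \<in> S2 \<Longrightarrow> \<bar>F x - q x\<bar> \<le> e"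
  shows "sphere_ip F F - proj_mass n F \<le> 4 * pi * e\<^sup>2"
proof -
  have qc: "continuous_on (- {0}) q" by (rule hom_poly_continuous[OF q])
  have pc: "continuous_on (- {0}) (poly_proj n F)" by (rule hom_poly_continuous[OF proj_hom_poly])
  have "sphere_ip (\<lambda>x. F x - q x) (\<lambda>x. F x - q x) = sphere_ip F F - 2 * sphere_ip F q + sphere_ip q q"
    using F qc by (intro sph.B_minus_minus) auto
  moreover have "0 \<le> sphere_ip (\<lambda>x. poly_proj n F x - q x) (\<lambda>x. poly_proj n F x - q x)"
    using qc pc by (intro sph.nonneg) (auto intro: continuous_intros)
  moreover have "sphere_ip (\<lambda>x. poly_proj n F x - q x) (\<lambda>x. poly_proj n F x - q x) = proj_mass n F - 2 * sphere_ip F q + sphere_ip q q"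
    using qc pc by (subst sph.B_minus_minus) (auto simp: sphere_ip_proj[OF F q] sphere_ip_proj_self[OF F])
  moreover have "sphere_ip (\<lambda>x. F x - q x) (\<lambda>x. F x - q x) \<le> (LINT x|surface_measure. e\<^sup>2)"
    unfolding sphere_ip_def
  proof (rule integral_mono_AE)
    show "AE x in surface_measure. (F x - q x) * (F x - q x) \<le> e\<^sup>2"
      using AE_surface
    proof eventually_elim
      case (elim x)
      then have "\<bar>F x - q x\<bar>\<^sup>2 \<le> e\<^sup>2" by (intro power_mono e) auto
      then show ?case by (simp add: power2_eq_square)
    qed
    show "integrable surface_measure (\<lambda>x. (F x - q x) * (F x - q x))"
      by (intro integrable_surface continuous_intros F qc)
    show "integrable surface_measure (\<lambda>x. e\<^sup>2)"
      by (intro integrable_surface continuous_intros)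
  qed
  ultimately show ?thesis by (simp add: measure_surface_UNIV)
qed

text \<open>The spectral inequality \<open>- \<Delta> \<ge> L l - \<Sum> (L l - L n) \<Pi> n\<close> for functions with the parity of \<open>l\<close>, where the
  sum runs over the \<open>n < l\<close> of that parity and \<open>\<Pi> n\<close> projects to the spherical harmonics of degree \<open>n\<close>.
  Lemmas \<open>energy_proj_ge\<close> and \<open>energy_ge_proj\<close> give it for the mass that \<open>F\<close> has in degrees up to
  \<open>l + 2 k\<close>, and by density of the polynomials this mass comes arbitrarily close to the square norm.\<close>

theorem sphere_energy_bound:
  assumes F: "C1 F" and par: "\<And>x. x \<in> S2 \<Longrightarrow> F (- x) = (-1) ^ l * F x"
  shows "energy F F \<ge> real l * (real l + 1) * sphere_ip F F - lower_sum (\<lambda>n. proj_mass n F) l"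
proof (rule field_le_epsilon)
  fix d :: real assume d: "d > 0"
  define L where "L = real l * (real l + 1)"
  have L: "L \<ge> 0" by (simp add: L_def)
  define e where "e = sqrt (d / (4 * pi * (L + 1)))"
  have e: "e > 0" using d L by (simp add: e_def)
  have e2: "4 * pi * (L + 1) * e\<^sup>2 = d"
    using d L by (simp add: e_def)
  have Fc: "continuous_on (- {0}) F" by (rule C1_continuous[OF F])
  have "continuous_on S2 F" by (rule continuous_on_subset[OF Fc]) auto
  then obtain k q where q: "hom_poly (l + 2 * k) q" "\<And>x. x \<in> S2 \<Longrightarrow> \<bar>F x - q x\<bar> < e"
    using hom_poly_dense[of F l e] par e by blast
  have "sphere_ip F F - proj_mass (l + 2 * k) F \<le> 4 * pi * e\<^sup>2"
    using q by (intro proj_mass_approx[OF Fc q(1)]) (simp add: less_imp_le)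
  then have "L * (sphere_ip F F - proj_mass (l + 2 * k) F) \<le> L * (4 * pi * e\<^sup>2)"
    using L by (rule mult_left_mono)
  also have "\<dots> \<le> d"
    unfolding e2[symmetric] using L by (simp add: algebra_simps)
  finally show "real l * (real l + 1) * sphere_ip F F - lower_sum (\<lambda>n. proj_mass n F) l \<le> energy F F + d"
    using energy_proj_ge[OF Fc, of l k] energy_ge_proj[OF F, of "l + 2 * k"] unfolding L_def[symmetric]
    by (simp add: right_diff_distrib)
qed

section \<open>The density of the polynomial spaces\<close>

definition onb_density :: "nat \<Rightarrow> R3 \<Rightarrow> real" where
  "onb_density n x = (\<Sum>i<poly_dim n. (onb n i x)\<^sup>2)"

text \<open>The density is the square of the norm of the evaluation functional \<open>p \<mapsto> p x\<close> on the polynomials of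
  degree \<open>n\<close>. A rotation taking \<open>x\<close> to \<open>y\<close> maps this space isometrically onto itself, hence the density is
  constant.\<close>

lemma onb_density_le:
  assumes x: "x \<in> S2" and y: "y \<in> S2"
  shows "onb_density n y \<le> onb_density n x"
proof -
  obtain R where R: "orthogonal_transformation R" "R x = y"
    using orthogonal_transformation_exists_1[of x y] x y by auto
  \<comment> \<open>the extremal polynomial for the evaluation at y, rotated back to x\<close>
  define p where "p = (\<lambda>z. \<Sum>i<poly_dim n. onb n i y * onb n i (R z))"
  have p: "hom_poly n p"
    unfolding p_def
    by (intro hom_poly_sum hom_poly_cmult hom_poly_linear[OF onb(2) orthogonal_transformation_linear[OF R(1)]]) simp
  have pc: "continuous_on (- {0}) p" by (rule hom_poly_continuous[OF p])
  define p1 where "p1 = (\<lambda>z. \<Sum>i<poly_dim n. onb n i y *\<^sub>R onb n i z)"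
  note onb_cont = onb_continuous[of _ n]
  have p1c: "continuous_on (- {0}) p1"
    unfolding p1_def using onb_cont by (intro continuous_intros) auto
  have "sphere_ip p p = (LINT z|surface_measure. p1 (R z) * p1 (R z))"
    by (simp add: sphere_ip_def p_def p1_def)
  also have "\<dots> = sphere_ip p1 p1"
    unfolding sphere_ip_def
    by (rule integral_surface_orthogonal[OF R(1)]) (intro borel_measurable_punctured continuous_intros p1c)
  also have "\<dots> = (\<Sum>i<poly_dim n. onb n i y * sphere_ip (onb n i) p1)"
    using sph.B_sum[of "{..<poly_dim n}" "onb n" p1 "\<lambda>i. onb n i y"] onb_cont p1c unfolding p1_def[symmetric] by auto
  also have "\<dots> \<le> onb_density n y"
    unfolding onb_density_def
  proof (rule sum_mono)
    fix i assume i: "i \<in> {..<poly_dim n}"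
    have "sphere_ip p1 (onb n i) = (\<Sum>j<poly_dim n. onb n j y * sphere_ip (onb n j) (onb n i))"
      unfolding p1_def using onb_cont i by (intro sph.B_sum) auto
    also have "\<dots> = (\<Sum>j<poly_dim n. if j = i then onb n i y * sphere_ip (onb n i) (onb n i) else 0)"
      using onb(1)[of n] i by (intro sum.cong) (auto simp: sph.ortho_def)
    also have "\<dots> = onb n i y * sphere_ip (onb n i) (onb n i)" using i by simp
    finally have "sphere_ip (onb n i) p1 = onb n i y * sphere_ip (onb n i) (onb n i)" by (simp add: sphere_ip_sym)
    moreover have "sphere_ip (onb n i) (onb n i) = 0 \<or> sphere_ip (onb n i) (onb n i) = 1"
      using onb(1)[of n] i by (auto simp: sph.ortho_def)
    ultimately show "onb n i y * sphere_ip (onb n i) p1 \<le> (onb n i y)\<^sup>2"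
      by (auto simp: power2_eq_square)
  qed
  finally have pp: "sphere_ip p p \<le> onb_density n y" .
  have px: "p x = onb_density n y"
    unfolding p_def onb_density_def by (simp add: R power2_eq_square)
  have "p x = poly_proj n p x"
  proof -
    have "sphere_ip (\<lambda>z. p z - poly_proj n p z) (\<lambda>z. p z - poly_proj n p z) = sphere_ip p p - 2 * sphere_ip p (poly_proj n p) + sphere_ip (poly_proj n p) (poly_proj n p)"
      using pc hom_poly_continuous[OF proj_hom_poly] by (intro sph.B_minus_minus) auto
    also have "\<dots> = 0"
      using sphere_ip_proj_self[OF pc, of n] sphere_ip_proj[OF pc p] sphere_ip_sym[of "poly_proj n p" p] by simp
    finally have "(\<lambda>z. p z - poly_proj n p z) x = 0"
      unfolding sphere_ip_def using x by (intro surface_null_imp_zero[of "\<lambda>z. p z - poly_proj n p z"])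
         (auto intro!: continuous_intros pc hom_poly_continuous[OF proj_hom_poly])
    then show ?thesis by simp
  qed
  also have "poly_proj n p x = (\<Sum>i<poly_dim n. sphere_ip p (onb n i) * onb n i x)"
    by (simp add: poly_proj_def sph.proj_def)
  finally have "(p x)\<^sup>2 \<le> (\<Sum>i<poly_dim n. (sphere_ip p (onb n i))\<^sup>2) * (\<Sum>i<poly_dim n. (onb n i x)\<^sup>2)"
    by (simp add: Cauchy_Schwarz_ineq_sum)
  also have "\<dots> \<le> sphere_ip p p * onb_density n x"
    unfolding onb_density_def using pc by (intro mult_right_mono sph.bessel[OF onb(1)] sum_nonneg) auto
  also have "\<dots> \<le> onb_density n y * onb_density n x"
    using pp by (intro mult_right_mono) (auto simp: onb_density_def intro: sum_nonneg)
  finally have "onb_density n y * onb_density n y \<le> onb_density n y * onb_density n x"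
    by (simp add: px power2_eq_square)
  moreover have "onb_density n y \<ge> 0" "onb_density n x \<ge> 0" by (auto simp: onb_density_def intro: sum_nonneg)
  ultimately show ?thesis
    by (cases "onb_density n y = 0") auto
qed

text \<open>The constant is found by integrating over the sphere: each member of the family contributes at most
  one.\<close>

lemma onb_density_bound:
  assumes x: "x \<in> S2"
  shows "onb_density n x \<le> real (poly_dim n) / (4 * pi)"
proof -
  note onb_cont = onb_continuous[of _ n]
  have kc: "continuous_on (- {0}) (onb_density n)"
    unfolding onb_density_def using onb_cont by (intro continuous_intros) auto
  have "4 * pi * onb_density n x = (LINT z|surface_measure. onb_density n x)"
    by (simp add: measure_surface_UNIV)
  also have "\<dots> = (LINT z|surface_measure. onb_density n z)"
    using onb_density_le[OF x] onb_density_le[OF _ x] by (intro integral_surface_cong kc continuous_on_const antisym) auto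
  also have "\<dots> = (\<Sum>i<poly_dim n. sphere_ip (onb n i) (onb n i))"
    unfolding onb_density_def sphere_ip_def power2_eq_square
    using onb_cont by (intro Bochner_Integration.integral_sum integrable_mult_surface) auto
  also have "\<dots> \<le> (\<Sum>i<poly_dim n. 1)"
  proof (rule sum_mono)
    fix i assume "i \<in> {..<poly_dim n}"
    then have "sphere_ip (onb n i) (onb n i) = 0 \<or> sphere_ip (onb n i) (onb n i) = 1"
      using onb(1)[of n] by (auto simp: sph.ortho_def)
    then show "sphere_ip (onb n i) (onb n i) \<le> 1" by auto
  qed
  finally show ?thesis
    by (simp add: field_simps)
qed

lemma real_poly_dim: "real (poly_dim n) = (real n + 1) * (real n + 2) / 2"
proof -
  have "even ((n + 1) * (n + 2))" by simp
  then have "2 * poly_dim n = (n + 1) * (n + 2)"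
    unfolding poly_dim_def by (rule dvd_mult_div_cancel)
  then have "real (2 * poly_dim n) = real ((n + 1) * (n + 2))"
    by (rule arg_cong)
  then show ?thesis by (simp add: algebra_simps)
qed

text \<open>The identity behind the exact constant of the theorem: at an eigenvalue \<open>L\<close> of the sphere, the Riesz
  mean over the spherical harmonics of one parity falls short of half of \<open>L\<^sup>2 / 2\<close> by \<open>L / 2\<close>.\<close>

lemma lower_sum_poly_dim:
  "lower_sum (\<lambda>n. real (poly_dim n)) l = ((real l * (real l + 1))\<^sup>2 - 2 * (real l * (real l + 1))) / 4"
proof (induction l rule: induct_nat_012)
  case (ge2 l)
  have "lower_sum (\<lambda>n. real (poly_dim n)) (Suc (Suc l))
      = ((real l * (real l + 1))\<^sup>2 - 2 * (real l * (real l + 1))) / 4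
        + (4 * real l + 6) * ((real l + 1) * (real l + 2) / 2)"
    by (simp only: lower_sum.simps ge2.IH(1) real_poly_dim[of l])
  also have "\<dots> = (((real l + 2) * (real l + 3))\<^sup>2 - 2 * ((real l + 2) * (real l + 3))) / 4"
    by (simp add: power2_eq_square field_simps)
  finally show ?case by (simp add: add.commute)
qed simp_all

section \<open>Functions supported in a set disjoint from its antipode\<close>

text \<open>Test functions with one continuous derivative, which is all that the energy bound on the sphere
  requires; unlike for \<open>test_function\<close>, closure under linear combinations follows at once from the rules for
  \<open>C1\<close>.\<close>

definition c1_test :: "R3 set \<Rightarrow> (R3 \<Rightarrow> real) \<Rightarrow> bool" where
  "c1_test \<Omega> f \<longleftrightarrow> C1 (\<lambda>y. f (sgn y)) \<and> (\<exists>K. compact K \<and> K \<subseteq> \<Omega> \<and> (\<forall>x\<in>S2 - K. f x = 0))"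

lemma c1_test_C1: "c1_test \<Omega> f \<Longrightarrow> C1 (\<lambda>y. f (sgn y))"
  by (simp add: c1_test_def)

lemma test_function_c1_test: "test_function \<Omega> f \<Longrightarrow> c1_test \<Omega> f"
proof -
  assume f: "test_function \<Omega> f"
  then have "\<forall>k. C_k_on k (\<lambda>y. f (sgn y)) (- {0})"
    unfolding test_function_def smooth_on_sphere_def by blast
  then have "C_k_on (Suc 0) (\<lambda>y. f (sgn y)) (- {0})" ..
  then have "C1 (\<lambda>y. f (sgn y))"
    by (simp add: C1_def partial_def[abs_def])
  with f show ?thesis by (simp add: c1_test_def test_function_def)
qed

lemma c1_test_lin:
  assumes "c1_test \<Omega> f" "c1_test \<Omega> g"
  shows "c1_test \<Omega> (\<lambda>x. f x + c * g x)"
proof -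
  obtain K K' where "compact K" "K \<subseteq> \<Omega>" "\<forall>x\<in>S2 - K. f x = 0" "compact K'" "K' \<subseteq> \<Omega>" "\<forall>x\<in>S2 - K'. g x = 0"
    using assms by (auto simp: c1_test_def)
  then show ?thesis
    unfolding c1_test_def using C1_add[OF c1_test_C1[OF assms(1)] C1_cmult[OF c1_test_C1[OF assms(2)], of c]]
    by (intro conjI exI[of _ "K \<union> K'"]) auto
qed

lemma surface_grad_eq:
  assumes "C1 (\<lambda>y. f (sgn y))" "x \<noteq> 0"
  shows "surface_grad f x = (\<chi> i. partial i (\<lambda>y. f (sgn y)) x)"
proof -
  define D where "D = (\<chi> i. partial i (\<lambda>y. f (sgn y)) x)"
  have diff: "(\<lambda>y. f (sgn y)) differentiable (at x)" by (rule C1_differentiable[OF assms])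
  have "frechet_derivative (\<lambda>y. f (sgn y)) (at x) = (\<lambda>h. h \<bullet> D)"
    using derivative_eq_partial[OF diff] by (auto simp: D_def inner_vec_def)
  then have G: "GDERIV (\<lambda>y. f (sgn y)) x :> D"
    using diff unfolding gderiv_def frechet_derivative_works by simp
  show ?thesis
    unfolding surface_grad_def D_def[symmetric]
  proof (rule the_equality)
    show "GDERIV (\<lambda>y. f (sgn y)) x :> D" by (rule G)
    show "D' = D" if "GDERIV (\<lambda>y. f (sgn y)) x :> D'" for D'
    proof -
      have "(\<lambda>h. h \<bullet> D') = (\<lambda>h. h \<bullet> D)"
        using that G unfolding gderiv_def by (rule has_derivative_unique)
      then have "h \<bullet> D' = h \<bullet> D" for h by (rule fun_cong)
      then have "h \<bullet> (D' - D) = 0" for h by (simp add: inner_diff_right)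
      from this[of "D' - D"] show ?thesis by simp
    qed
  qed
qed

lemma surface_grad_lin:
  assumes "C1 (\<lambda>y. f (sgn y))" "C1 (\<lambda>y. g (sgn y))" "x \<noteq> 0"
  shows "surface_grad (\<lambda>x. f x + c * g x) x = surface_grad f x + c *\<^sub>R surface_grad g x"
proof -
  have "C1 (\<lambda>y. f (sgn y) + c * g (sgn y))"
    using assms by (intro C1_add C1_cmult)
  then show ?thesis
    using assms by (simp add: surface_grad_eq vec_eq_iff partial_add partial_cmult C1_differentiable C1_cmult)
qed

text \<open>The extension \<open>y \<mapsto> f (sgn y)\<close> is constant along rays.\<close>

lemma surface_grad_radial:
  assumes f: "C1 (\<lambda>y. f (sgn y))" and x: "x \<noteq> 0"
  shows "x \<bullet> surface_grad f x = 0"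
proof -
  define F where "F = (\<lambda>y. f (sgn y))"
  have F: "(F has_derivative frechet_derivative F (at x)) (at x)"
    unfolding F_def by (rule C1_has_derivative[OF f x])
  have "((\<lambda>t. F (t *\<^sub>R x)) has_derivative (\<lambda>h. frechet_derivative F (at x) (h *\<^sub>R x))) (at 1)"
    by (rule has_derivative_compose[of "\<lambda>t. t *\<^sub>R x" "\<lambda>h. h *\<^sub>R x" 1 UNIV F "frechet_derivative F (at x)"])
       (use F in \<open>auto intro!: derivative_eq_intros\<close>)
  moreover have "((\<lambda>t. F (t *\<^sub>R x)) has_derivative (\<lambda>h. 0)) (at 1)"
  proof (rule has_derivative_transform_within_open[of "\<lambda>t. F x" "\<lambda>h. 0" 1 UNIV "{0<..}"])
    show "F x = F (t *\<^sub>R x)" if "t \<in> {0<..}" for t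
      using that by (simp add: F_def sgn_scaleR)
  qed auto
  ultimately have "(\<lambda>h. frechet_derivative F (at x) (h *\<^sub>R x)) = (\<lambda>h. 0)"
    by (rule has_derivative_unique)
  from fun_cong[OF this, of 1] have "frechet_derivative F (at x) x = 0" by simp
  then show ?thesis
    using derivative_eq_partial[OF C1_differentiable[OF f x], of x]
    by (simp add: surface_grad_eq[OF f x] inner_vec_def F_def)
qed

text \<open>Lagrange's identity, the radial component of the gradient being zero.\<close>

lemma norm_surface_grad:
  assumes f: "C1 (\<lambda>y. f (sgn y))" and x: "x \<in> S2"
  shows "surface_grad f x \<bullet> surface_grad f x
    = (1/2) * (\<Sum>i\<in>UNIV. \<Sum>j\<in>UNIV. rot i j (\<lambda>y. f (sgn y)) x * rot i j (\<lambda>y. f (sgn y)) x)"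
proof -
  define D where "D = surface_grad f x"
  have x0: "x \<noteq> 0" using x by (rule S2_nonzero)
  have partial: "partial i (\<lambda>y. f (sgn y)) x = D $ i" for i
    by (simp add: D_def surface_grad_eq[OF f x0])
  have "(1/2) * (\<Sum>i\<in>UNIV. \<Sum>j\<in>UNIV. rot i j (\<lambda>y. f (sgn y)) x * rot i j (\<lambda>y. f (sgn y)) x)
      = (x \<bullet> x) * (D \<bullet> D) - (x \<bullet> D) * (x \<bullet> D)"
    by (simp add: rot_def partial sum_3 inner_vec_def algebra_simps)
  also have "\<dots> = D \<bullet> D"
    using surface_grad_radial[OF f x0] x by (simp add: D_def dot_square_norm)
  finally show ?thesis by (simp add: D_def)
qed

text \<open>The support is a compact subset of \<open>\<Omega>\<close>, hence the extension \<open>f \<circ> sgn\<close> vanishes in a whole neighbourhood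
  of each point of the sphere outside \<open>\<Omega>\<close>, and so do its derivatives there.\<close>

lemma c1_test_support:
  assumes "c1_test \<Omega> f" "x \<in> S2" "x \<notin> \<Omega>"
  shows "f x = 0" "rot i j (\<lambda>y. f (sgn y)) x = 0" "surface_grad f x = 0"
proof -
  obtain K where K: "compact K" "K \<subseteq> \<Omega>" "\<forall>x\<in>S2 - K. f x = 0"
    using assms(1) by (auto simp: c1_test_def)
  show "f x = 0" using K assms by auto
  have x0: "x \<noteq> 0" using assms(2) by (rule S2_nonzero)
  let ?U = "sgn -` (- K) \<inter> (- {0})"
  have "open ?U"
    using continuous_sgn open_Compl[OF compact_imp_closed[OF K(1)]]
    by (subst (asm) continuous_on_open_vimage) auto
  moreover have "x \<in> ?U" using assms(3) K(2) x0 by (auto simp: sgn_on_S2[OF assms(2)])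
  moreover have "0 = f (sgn y)" if "y \<in> ?U" for y
    using that K(3) sgn_in_S2[of y] by auto
  ultimately have "((\<lambda>y. f (sgn y)) has_derivative (\<lambda>h. 0)) (at x)"
    using has_derivative_transform_within_open[of "\<lambda>_. 0" "\<lambda>h. 0" x UNIV ?U "\<lambda>y. f (sgn y)"] by simp
  then have partial: "partial i (\<lambda>y. f (sgn y)) x = 0" for i
    by (rule partial_eqI)
  then show "rot i j (\<lambda>y. f (sgn y)) x = 0" by (simp add: rot_def)
  show "surface_grad f x = 0"
    using surface_grad_eq[OF c1_test_C1[OF assms(1)] x0] partial by (simp add: vec_eq_iff)
qed

definition L2ip :: "R3 set \<Rightarrow> (R3 \<Rightarrow> 'b::euclidean_space) \<Rightarrow> (R3 \<Rightarrow> 'b) \<Rightarrow> real" where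
  "L2ip \<Omega> u v = (LINT x|area_on \<Omega>. u x \<bullet> v x)"

lemma L2_integrable:
  assumes "L2 \<Omega> u" "L2 \<Omega> v"
  shows "integrable (area_on \<Omega>) (\<lambda>x. u x \<bullet> v x)"
proof (rule Bochner_Integration.integrable_bound)
  show "integrable (area_on \<Omega>) (\<lambda>x. (norm (u x))\<^sup>2 + (norm (v x))\<^sup>2)"
    using assms by (simp add: L2_def)
  show "(\<lambda>x. u x \<bullet> v x) \<in> borel_measurable (area_on \<Omega>)"
    using assms by (simp add: L2_def borel_measurable_inner)
  show "AE x in area_on \<Omega>. norm (u x \<bullet> v x) \<le> norm ((norm (u x))\<^sup>2 + (norm (v x))\<^sup>2)"
  proof (rule AE_I2)
    fix x
    have "norm (u x \<bullet> v x) \<le> norm (u x) * norm (v x)"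
      by (simp add: Cauchy_Schwarz_ineq2)
    also have "\<dots> \<le> 2 * norm (u x) * norm (v x)"
      by (intro mult_right_mono) auto
    also have "\<dots> \<le> (norm (u x))\<^sup>2 + (norm (v x))\<^sup>2"
      by (rule sum_squares_bound)
    finally show "norm (u x \<bullet> v x) \<le> norm ((norm (u x))\<^sup>2 + (norm (v x))\<^sup>2)" by simp
  qed
qed

lemma L2_lin:
  assumes u: "L2 \<Omega> u" and v: "L2 \<Omega> v"
  shows "L2 \<Omega> (\<lambda>x. u x + c *\<^sub>R v x)"
  unfolding L2_def
proof
  show "(\<lambda>x. u x + c *\<^sub>R v x) \<in> borel_measurable (area_on \<Omega>)"
    using assms by (auto simp: L2_def)
  have "integrable (area_on \<Omega>) (\<lambda>x. u x \<bullet> u x + 2 * c * (u x \<bullet> v x) + c * c * (v x \<bullet> v x))"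
    using L2_integrable[OF u u] L2_integrable[OF u v] L2_integrable[OF v v] by simp
  then show "integrable (area_on \<Omega>) (\<lambda>x. (norm (u x + c *\<^sub>R v x))\<^sup>2)"
    by (simp add: power2_norm_eq_inner inner_simps inner_commute algebra_simps)
qed

lemma L2_zero: "L2 \<Omega> (\<lambda>x. 0)"
  by (simp add: L2_def)

lemma L2ip_sym: "L2ip \<Omega> u v = L2ip \<Omega> v u"
  by (simp add: L2ip_def inner_commute)

lemma L2ip_lin: "L2 \<Omega> u \<Longrightarrow> L2 \<Omega> v \<Longrightarrow> L2 \<Omega> w \<Longrightarrow>
    L2ip \<Omega> (\<lambda>x. u x + c *\<^sub>R v x) w = L2ip \<Omega> u w + c * L2ip \<Omega> v w"
  using L2_integrable[of \<Omega> u w] L2_integrable[of \<Omega> v w]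
  by (simp add: L2ip_def inner_add_left)

lemma L2ip_nonneg: "0 \<le> L2ip \<Omega> u u"
  by (simp add: L2ip_def)

lemma semi_inner_L2: "semi_inner {u :: R3 \<Rightarrow> 'b::euclidean_space. L2 \<Omega> u} (L2ip \<Omega>)"
  by unfold_locales (simp_all add: L2_zero L2_lin L2ip_lin L2ip_nonneg, rule L2ip_sym)

lemma L2_continuous:
  fixes f :: "R3 \<Rightarrow> 'b::euclidean_space"
  assumes \<Omega>: "\<Omega> \<in> sets borel" and f: "continuous_on (- {0}) f"
  shows "L2 \<Omega> f"
proof -
  have "f \<in> borel_measurable surface_measure"
    using borel_measurable_punctured[OF f] by simp
  moreover have "integrable surface_measure (\<lambda>x. (norm (f x))\<^sup>2)"
    by (intro integrable_surface continuous_intros f)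
  ultimately show ?thesis
    unfolding L2_def using \<Omega> integrable_mult_indicator[of \<Omega> surface_measure "\<lambda>x. (norm (f x))\<^sup>2"]
    by (simp add: integrable_restrict_space measurable_restrict_space1)
qed

lemma L2ip_cong:
  assumes "\<Omega> \<in> sets borel" "\<And>x. x \<in> \<Omega> \<Longrightarrow> u x = u' x" "\<And>x. x \<in> \<Omega> \<Longrightarrow> v x = v' x"
  shows "L2ip \<Omega> u v = L2ip \<Omega> u' v'"
  unfolding L2ip_def by (rule Bochner_Integration.integral_cong) (use assms in \<open>auto simp: space_restrict_space\<close>)

lemma L2_cong:
  assumes "\<Omega> \<in> sets borel" "\<And>x. x \<in> \<Omega> \<Longrightarrow> u x = u' x" "L2 \<Omega> u"
  shows "L2 \<Omega> u'"
proof -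
  have sp: "space (area_on \<Omega>) = \<Omega>" by (simp add: space_restrict_space)
  have "u' \<in> borel_measurable (area_on \<Omega>) \<longleftrightarrow> u \<in> borel_measurable (area_on \<Omega>)"
    by (rule measurable_cong) (simp add: sp assms)
  moreover have "integrable (area_on \<Omega>) (\<lambda>x. (norm (u' x))\<^sup>2) \<longleftrightarrow> integrable (area_on \<Omega>) (\<lambda>x. (norm (u x))\<^sup>2)"
    by (rule Bochner_Integration.integrable_cong) (simp_all add: sp assms)
  ultimately show ?thesis using assms(3) by (simp add: L2_def)
qed

lemma c1_test_L2:
  assumes \<Omega>: "\<Omega> \<in> sets borel" "\<Omega> \<subseteq> S2" and f: "c1_test \<Omega> f"
  shows "L2 \<Omega> f" "L2 \<Omega> (surface_grad f)"
proof -
  have "L2 \<Omega> (\<lambda>y. f (sgn y))"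
    by (rule L2_continuous[OF \<Omega>(1) C1_continuous[OF c1_test_C1[OF f]]])
  then show "L2 \<Omega> f"
    by (rule L2_cong[OF \<Omega>(1), rotated]) (use \<Omega>(2) in \<open>auto simp: sgn_on_S2 simp del: mem_sphere\<close>)
  have "continuous_on (- {0}) (\<lambda>x. \<chi> i. partial i (\<lambda>y. f (sgn y)) x)"
    by (intro continuous_intros C1_continuous_partial c1_test_C1[OF f])
  from L2_continuous[OF \<Omega>(1) this] show "L2 \<Omega> (surface_grad f)"
    by (rule L2_cong[OF \<Omega>(1), rotated])
       (use \<Omega>(2) S2_nonzero surface_grad_eq[OF c1_test_C1[OF f]] in \<open>auto simp del: mem_sphere\<close>)
qed

lemma L2ip_eq_sphere_ip:
  assumes \<Omega>: "\<Omega> \<in> sets borel" "\<Omega> \<subseteq> S2" and f: "c1_test \<Omega> f" and e: "continuous_on (- {0}) e"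
  shows "L2ip \<Omega> f e = sphere_ip (\<lambda>y. f (sgn y)) e"
proof -
  have "L2ip \<Omega> f e = (LINT x|surface_measure. indicator \<Omega> x *\<^sub>R (f x * e x))"
    unfolding L2ip_def using \<Omega>(1) by (simp add: integral_restrict_space)
  also have "\<dots> = sphere_ip (\<lambda>y. f (sgn y)) e"
    unfolding sphere_ip_def
  proof (rule integral_cong_AE)
    have "(\<lambda>x. indicator \<Omega> x *\<^sub>R (f x * e x)) = (\<lambda>x. indicator \<Omega> x *\<^sub>R (f (sgn x) * e x))"
    proof
      fix x show "indicator \<Omega> x *\<^sub>R (f x * e x) = indicator \<Omega> x *\<^sub>R (f (sgn x) * e x)"
        using \<Omega>(2) sgn_on_S2[of x] by (cases "x \<in> \<Omega>") auto
    qed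
    moreover have "(\<lambda>x. f (sgn x) * e x) \<in> borel_measurable borel"
      by (intro borel_measurable_punctured continuous_intros C1_continuous[OF c1_test_C1[OF f]] e)
    ultimately show "(\<lambda>x. indicator \<Omega> x *\<^sub>R (f x * e x)) \<in> borel_measurable surface_measure"
      using \<Omega>(1) by simp
    show "(\<lambda>x. f (sgn x) * e x) \<in> borel_measurable surface_measure"
      using \<open>(\<lambda>x. f (sgn x) * e x) \<in> borel_measurable borel\<close> by simp
    show "AE x in surface_measure. indicator \<Omega> x *\<^sub>R (f x * e x) = f (sgn x) * e x"
      using AE_surface
    proof eventually_elim
      case (elim x)
      then show ?case using c1_test_support(1)[OF f elim] by (auto simp: sgn_on_S2[OF elim] indicator_def)
    qed
  qed
  finally show ?thesis .
qed

lemma L2ip_self_eq_sphere_ip: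
  assumes \<Omega>: "\<Omega> \<in> sets borel" "\<Omega> \<subseteq> S2" and f: "c1_test \<Omega> f"
  shows "L2ip \<Omega> f f = sphere_ip (\<lambda>y. f (sgn y)) (\<lambda>y. f (sgn y))"
proof -
  have "L2ip \<Omega> f f = L2ip \<Omega> f (\<lambda>y. f (sgn y))"
    by (rule L2ip_cong[OF \<Omega>(1)]) (use \<Omega>(2) in \<open>auto simp: sgn_on_S2 simp del: mem_sphere\<close>)
  then show ?thesis
    using L2ip_eq_sphere_ip[OF \<Omega> f C1_continuous[OF c1_test_C1[OF f]]] by simp
qed

lemma L2ip_grad_eq_energy:
  assumes \<Omega>: "\<Omega> \<in> sets borel" "\<Omega> \<subseteq> S2" and f: "c1_test \<Omega> f"
  shows "L2ip \<Omega> (surface_grad f) (surface_grad f) = energy (\<lambda>y. f (sgn y)) (\<lambda>y. f (sgn y))"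
proof -
  let ?e = "\<lambda>x. (1/2) * (\<Sum>i\<in>UNIV. \<Sum>j\<in>UNIV. rot i j (\<lambda>y. f (sgn y)) x * rot i j (\<lambda>y. f (sgn y)) x)"
  have C: "C1 (\<lambda>y. f (sgn y))" by (rule c1_test_C1[OF f])
  have ec: "continuous_on (- {0}) ?e"
    by (intro continuous_intros C1_continuous_rot C)
  have "L2ip \<Omega> (surface_grad f) (surface_grad f) = (LINT x|area_on \<Omega>. ?e x)"
    unfolding L2ip_def
    by (rule Bochner_Integration.integral_cong)
       (use \<Omega> norm_surface_grad[OF C] in \<open>auto simp: space_restrict_space simp del: mem_sphere\<close>)
  also have "\<dots> = (LINT x|surface_measure. indicator \<Omega> x *\<^sub>R ?e x)"
    using \<Omega>(1) by (simp add: integral_restrict_space del: scaleR_eq_0_iff)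
  also have "\<dots> = energy (\<lambda>y. f (sgn y)) (\<lambda>y. f (sgn y))"
    unfolding energy_def
  proof (rule integral_cong_AE)
    show m: "?e \<in> borel_measurable surface_measure"
      using borel_measurable_punctured[OF ec] by simp
    show "(\<lambda>x. indicator \<Omega> x *\<^sub>R ?e x) \<in> borel_measurable surface_measure"
      using \<Omega>(1) by (intro borel_measurable_scaleR borel_measurable_indicator m) simp
    show "AE x in surface_measure. indicator \<Omega> x *\<^sub>R ?e x = ?e x"
      using AE_surface
    proof eventually_elim
      case (elim x)
      then show ?case using c1_test_support(2)[OF f elim] by (auto simp: indicator_def)
    qed
  qed
  finally show ?thesis .
qed

text \<open>The step that uses the hemisphere, through \<open>\<Omega> \<inter> - \<Omega> = {}\<close>. The function \<open>F x = f x + (-1)\<^sup>l f (- x)\<close> has the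
  parity of \<open>l\<close>. Its two summands have disjoint supports, so its energy and square norm are twice those
  of \<open>f\<close>, while its inner products with polynomials of that parity are twice those of \<open>f\<close>, hence four
  times in the square. Halving the energy bound of the sphere leaves the factor two in front of the sum.\<close>

lemma c1_test_bound:
  assumes \<Omega>: "\<Omega> \<in> sets borel" "\<Omega> \<subseteq> S2" and disj: "\<And>x. x \<in> \<Omega> \<Longrightarrow> - x \<notin> \<Omega>" and f: "c1_test \<Omega> f"
  shows "L2ip \<Omega> (surface_grad f) (surface_grad f) \<ge>
     real l * (real l + 1) * L2ip \<Omega> f f - 2 * lower_sum (\<lambda>n. \<Sum>i<poly_dim n. (L2ip \<Omega> f (onb n i))\<^sup>2) l"
proof -
  define G where "G = (\<lambda>y. f (sgn y))"
  define H where "H = (\<lambda>y. G (- y))"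
  define s where "s = (-1::real) ^ l"
  have s: "s * s = 1" by (simp add: s_def flip: power_add mult_2)
  define F where "F = (\<lambda>y. G y + s *\<^sub>R H y)"
  have G: "C1 G" unfolding G_def by (rule c1_test_C1[OF f])
  have H: "C1 H" unfolding H_def by (rule C1_antipode[OF G])
  have F: "C1 F" unfolding F_def using C1_add[OF G C1_cmult[OF H, of s]] by simp
  note c = C1_continuous[OF G] C1_continuous[OF H] C1_continuous[OF F]
  \<comment> \<open>all cross terms vanish because a point and its antipode are not both in the domain\<close>
  have disj': "G x = 0 \<and> rot i j G x = 0 \<or> H x = 0 \<and> rot i j H x = 0" if x: "x \<in> S2" for x i j
  proof (cases "x \<in> \<Omega>")
    case True
    have mx: "- x \<in> S2" using x by simp
    have "H x = 0" using c1_test_support(1)[OF f mx disj[OF True]] by (simp add: H_def G_def sgn_on_S2[OF mx])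
    moreover have "rot i j H x = 0"
      using C1_antipode(2)[OF G S2_nonzero[OF x], of i j] c1_test_support(2)[OF f mx disj[OF True], of i j]
      by (simp add: H_def[symmetric] G_def[symmetric])
    ultimately show ?thesis by blast
  next
    case False
    then show ?thesis using c1_test_support(1,2)[OF f x] by (simp add: G_def sgn_on_S2[OF x])
  qed
  have "sphere_ip F F = sphere_ip G G + 2 * s * sphere_ip G H + s * s * sphere_ip H H"
    unfolding F_def using c by (intro sph.B_lin_lin) auto
  moreover have "sphere_ip H H = sphere_ip G G"
    unfolding H_def by (rule sphere_ip_antipode[OF c(1,1)])
  moreover have "sphere_ip G H = 0"
  proof -
    have "sphere_ip G H = (LINT x|surface_measure. 0)"
      unfolding sphere_ip_def by (rule integral_surface_cong) (use disj' c in \<open>auto intro!: continuous_intros\<close>)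
    then show ?thesis by simp
  qed
  ultimately have FF: "sphere_ip F F = 2 * L2ip \<Omega> f f"
    using s L2ip_self_eq_sphere_ip[OF \<Omega> f] by (simp add: G_def)
  have "energy F F = energy G G + 2 * s * energy G H + s * s * energy H H"
    unfolding F_def using G H by (intro en.B_lin_lin) auto
  moreover have "energy H H = energy G G"
  proof -
    have "sphere_ip (rot i j H) (rot i j H) = sphere_ip (rot i j G) (rot i j G)" for i j
    proof -
      have cG: "continuous_on (- {0}) (rot i j G)" by (rule C1_continuous_rot[OF G])
      have "sphere_ip (rot i j H) (rot i j H) = sphere_ip (\<lambda>x. rot i j G (- x)) (\<lambda>x. rot i j G (- x))"
        by (rule sphere_ip_cong)
           (use C1_antipode(2)[OF G S2_nonzero] in \<open>auto simp: H_def simp del: mem_sphere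
               intro!: C1_continuous_rot C1_antipode(1) G continuous_on_compose2[OF cG] continuous_intros\<close>)
      then show ?thesis using sphere_ip_antipode[OF cG cG] by simp
    qed
    then show ?thesis by (simp add: energy_sphere_ip G H)
  qed
  moreover have "energy G H = 0"
  proof -
    have "sphere_ip (rot i j G) (rot i j H) = 0" for i j
    proof -
      have "sphere_ip (rot i j G) (rot i j H) = (LINT x|surface_measure. 0)"
        unfolding sphere_ip_def
        by (rule integral_surface_cong) (use disj' in \<open>fastforce intro!: continuous_intros C1_continuous_rot G H\<close>)+
      then show ?thesis by simp
    qed
    then show ?thesis by (simp add: energy_sphere_ip G H)
  qed
  ultimately have EF: "energy F F = 2 * L2ip \<Omega> (surface_grad f) (surface_grad f)"
    using s L2ip_grad_eq_energy[OF \<Omega> f] by (simp add: G_def)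
  have mass_F: "proj_mass n F = 4 * (\<Sum>i<poly_dim n. (L2ip \<Omega> f (onb n i))\<^sup>2)" if n: "even n = even l" for n
  proof -
    have "sphere_ip F (onb n i) = 2 * L2ip \<Omega> f (onb n i)" if i: "i < poly_dim n" for i
    proof -
      have e: "hom_poly n (onb n i)" by (rule onb(2)[OF i])
      have ec: "continuous_on (- {0}) (onb n i)" by (rule hom_poly_continuous[OF e])
      have "sphere_ip F (onb n i) = sphere_ip G (onb n i) + s * sphere_ip H (onb n i)"
        unfolding F_def using c ec by (intro sph.B_lin) auto
      also have "sphere_ip H (onb n i) = sphere_ip (\<lambda>x. H (- x)) (\<lambda>x. onb n i (- x))"
        by (rule sphere_ip_antipode[symmetric, OF c(2) ec])
      also have "\<dots> = sphere_ip G (\<lambda>x. s * onb n i x)"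
        using n by (simp add: H_def hom_poly_parity[OF e] s_def minus_one_power_iff)
      also have "\<dots> = s * sphere_ip G (onb n i)" by (rule sphere_ip_cmult)
      finally show ?thesis
        using s L2ip_eq_sphere_ip[OF \<Omega> f ec] by (simp add: G_def mult.assoc[symmetric])
    qed
    then show ?thesis by (simp add: proj_mass_def sum_distrib_left power_mult_distrib)
  qed
  have "lower_sum (\<lambda>n. proj_mass n F) l = lower_sum (\<lambda>n. 4 * (\<Sum>i<poly_dim n. (L2ip \<Omega> f (onb n i))\<^sup>2)) l"
    by (rule lower_sum_cong) (rule mass_F)
  then have sum_F: "lower_sum (\<lambda>n. proj_mass n F) l = 4 * lower_sum (\<lambda>n. \<Sum>i<poly_dim n. (L2ip \<Omega> f (onb n i))\<^sup>2) l"
    by (simp add: lower_sum_cmult)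
  have "F (- x) = (-1) ^ l * F x" for x
    using s unfolding F_def H_def s_def[symmetric] by (simp add: algebra_simps mult.assoc[symmetric])
  from sphere_energy_bound[OF F this]
  show ?thesis unfolding EF FF sum_F by simp
qed

section \<open>Passage to the Sobolev space\<close>

text \<open>Limits in mean square of test functions together with their gradients: the property of \<open>H10\<close> through
  which the energy bound passes to the limit. Linear combinations of such pairs are again of this kind,
  which supplies the bound for the orthonormalised eigenfunctions.\<close>

definition approximable :: "R3 set \<Rightarrow> (R3 \<Rightarrow> real) \<Rightarrow> (R3 \<Rightarrow> R3) \<Rightarrow> bool" where
  "approximable \<Omega> u g \<longleftrightarrow> L2 \<Omega> u \<and> L2 \<Omega> g \<and> (\<exists>f. (\<forall>n. c1_test \<Omega> (f n)) \<and>
     (\<lambda>n. L2ip \<Omega> (\<lambda>x. f n x - u x) (\<lambda>x. f n x - u x)) \<longlonglongrightarrow> 0 \<and>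
     (\<lambda>n. L2ip \<Omega> (\<lambda>x. surface_grad (f n) x - g x) (\<lambda>x. surface_grad (f n) x - g x)) \<longlonglongrightarrow> 0)"

lemma L2_diff:
  fixes u v :: "R3 \<Rightarrow> 'b::euclidean_space"
  shows "L2 \<Omega> u \<Longrightarrow> L2 \<Omega> v \<Longrightarrow> L2 \<Omega> (\<lambda>x. u x - v x)"
  using L2_lin[of \<Omega> u v "-1"] by simp

lemma H10_approximable:
  assumes \<Omega>: "\<Omega> \<in> sets borel" "\<Omega> \<subseteq> S2" and u: "H10 \<Omega> u g"
  shows "approximable \<Omega> u g"
proof -
  have L: "L2 \<Omega> u" "L2 \<Omega> g" using u by (simp_all add: H10_def H1_def)
  obtain f where f: "\<And>n. test_function \<Omega> (f n)" and
    lim: "(\<lambda>n. LINT x|area_on \<Omega>. (f n x - u x)\<^sup>2 + (norm (surface_grad (f n) x - g x))\<^sup>2) \<longlonglongrightarrow> 0"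
    using u by (auto simp: H10_def)
  have c1_test: "c1_test \<Omega> (f n)" for n by (rule test_function_c1_test[OF f])
  have eq: "(LINT x|area_on \<Omega>. (f n x - u x)\<^sup>2 + (norm (surface_grad (f n) x - g x))\<^sup>2)
     = L2ip \<Omega> (\<lambda>x. f n x - u x) (\<lambda>x. f n x - u x) + L2ip \<Omega> (\<lambda>x. surface_grad (f n) x - g x) (\<lambda>x. surface_grad (f n) x - g x)" for n
  proof -
    have a: "L2 \<Omega> (\<lambda>x. f n x - u x)" "L2 \<Omega> (\<lambda>x. surface_grad (f n) x - g x)"
      by (intro L2_diff L c1_test_L2[OF \<Omega> c1_test])+
    show ?thesis
      unfolding L2ip_def Bochner_Integration.integral_add[OF L2_integrable[OF a(1,1)] L2_integrable[OF a(2,2)], symmetric]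
      by (intro Bochner_Integration.integral_cong refl) (simp add: dot_square_norm flip: power2_eq_square)
  qed
  have "(\<lambda>n. L2ip \<Omega> (\<lambda>x. f n x - u x) (\<lambda>x. f n x - u x)) \<longlonglongrightarrow> 0"
    by (rule tendsto_sandwich[OF _ _ tendsto_const lim])
       (auto intro!: always_eventually simp: eq L2ip_nonneg)
  moreover have "(\<lambda>n. L2ip \<Omega> (\<lambda>x. surface_grad (f n) x - g x) (\<lambda>x. surface_grad (f n) x - g x)) \<longlonglongrightarrow> 0"
    by (rule tendsto_sandwich[OF _ _ tendsto_const lim])
       (auto intro!: always_eventually simp: eq L2ip_nonneg)
  ultimately show ?thesis
    unfolding approximable_def using L c1_test by blast
qed

lemma approximable_zero: "approximable \<Omega> (\<lambda>x. 0) (\<lambda>x. 0)"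
proof -
  have tf0: "c1_test \<Omega> (\<lambda>x. 0)"
    unfolding c1_test_def using C1_const[of 0] by (auto intro: exI[of _ "{}"])
  have "surface_grad (\<lambda>x. 0) = (\<lambda>x. 0)"
  proof
    fix x :: R3
    show "surface_grad (\<lambda>x. 0) x = 0"
      unfolding surface_grad_def
    proof (rule the_equality)
      show "GDERIV (\<lambda>y. 0) x :> 0" by (simp add: gderiv_def)
      fix D assume "GDERIV (\<lambda>y::R3. 0) x :> D"
      then have "(\<lambda>h. h \<bullet> D) = (\<lambda>h. 0)"
        unfolding gderiv_def by (rule has_derivative_unique) simp
      from fun_cong[OF this, of D] show "D = 0" by simp
    qed
  qed
  then show ?thesis
    unfolding approximable_def using tf0
    by (intro conjI exI[of _ "\<lambda>n x. 0"]) (auto simp: L2_zero L2ip_def)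
qed

lemma L2ip_lin_tendsto_0:
  fixes u v :: "nat \<Rightarrow> R3 \<Rightarrow> 'b::euclidean_space"
  assumes "\<And>n. L2 \<Omega> (u n)" "\<And>n. L2 \<Omega> (v n)"
    and lim: "(\<lambda>n. L2ip \<Omega> (u n) (u n)) \<longlonglongrightarrow> 0" "(\<lambda>n. L2ip \<Omega> (v n) (v n)) \<longlonglongrightarrow> 0"
  shows "(\<lambda>n. L2ip \<Omega> (\<lambda>x. u n x + c *\<^sub>R v n x) (\<lambda>x. u n x + c *\<^sub>R v n x)) \<longlonglongrightarrow> 0"
proof -
  interpret semi_inner "{u :: R3 \<Rightarrow> 'b. L2 \<Omega> u}" "L2ip \<Omega>" by (rule semi_inner_L2)
  have "(\<lambda>n. L2ip \<Omega> (u n) (v n)) \<longlonglongrightarrow> 0"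
    by (rule tendsto_B_null[OF _ _ lim]) (simp_all add: assms(1,2))
  then have "(\<lambda>n. L2ip \<Omega> (u n) (u n) + 2 * c * L2ip \<Omega> (u n) (v n) + c * c * L2ip \<Omega> (v n) (v n)) \<longlonglongrightarrow> 0 + 2 * c * 0 + c * c * 0"
    by (intro tendsto_intros lim)
  then show ?thesis using assms(1,2) by (simp add: B_lin_lin)
qed

lemma approximable_lin:
  assumes \<Omega>: "\<Omega> \<in> sets borel" "\<Omega> \<subseteq> S2" and u: "approximable \<Omega> u g" and v: "approximable \<Omega> v h"
  shows "approximable \<Omega> (\<lambda>x. u x + c * v x) (\<lambda>x. g x + c *\<^sub>R h x)"
proof -
  obtain f where f: "\<And>n. c1_test \<Omega> (f n)"
     "(\<lambda>n. L2ip \<Omega> (\<lambda>x. f n x - u x) (\<lambda>x. f n x - u x)) \<longlonglongrightarrow> 0"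
     "(\<lambda>n. L2ip \<Omega> (\<lambda>x. surface_grad (f n) x - g x) (\<lambda>x. surface_grad (f n) x - g x)) \<longlonglongrightarrow> 0"
    using u by (auto simp: approximable_def)
  obtain f' where f': "\<And>n. c1_test \<Omega> (f' n)"
     "(\<lambda>n. L2ip \<Omega> (\<lambda>x. f' n x - v x) (\<lambda>x. f' n x - v x)) \<longlonglongrightarrow> 0"
     "(\<lambda>n. L2ip \<Omega> (\<lambda>x. surface_grad (f' n) x - h x) (\<lambda>x. surface_grad (f' n) x - h x)) \<longlonglongrightarrow> 0"
    using v by (auto simp: approximable_def)
  have L: "L2 \<Omega> u" "L2 \<Omega> g" "L2 \<Omega> v" "L2 \<Omega> h" using u v by (auto simp: approximable_def)
  note Lf = c1_test_L2[OF \<Omega> f(1)] c1_test_L2[OF \<Omega> f'(1)]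
  let ?F = "\<lambda>n x. f n x + c * f' n x"
  have 1: "(\<lambda>x. ?F n x - (u x + c * v x)) = (\<lambda>x. (f n x - u x) + c *\<^sub>R (f' n x - v x))" for n
    by (auto simp: algebra_simps)
  have "(\<lambda>n. L2ip \<Omega> (\<lambda>x. ?F n x - (u x + c * v x)) (\<lambda>x. ?F n x - (u x + c * v x))) \<longlonglongrightarrow> 0"
    unfolding 1 by (intro L2ip_lin_tendsto_0 L2_diff L Lf f(2) f'(2))
  moreover have "(\<lambda>n. L2ip \<Omega> (\<lambda>x. surface_grad (?F n) x - (g x + c *\<^sub>R h x)) (\<lambda>x. surface_grad (?F n) x - (g x + c *\<^sub>R h x))) \<longlonglongrightarrow> 0"
  proof -
    have 2: "surface_grad (?F n) x - (g x + c *\<^sub>R h x) = (surface_grad (f n) x - g x) + c *\<^sub>R (surface_grad (f' n) x - h x)" if "x \<in> \<Omega>" for n x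
    proof -
      have "x \<noteq> 0" using that \<Omega>(2) by (intro S2_nonzero) blast
      then show ?thesis
        using surface_grad_lin[OF c1_test_C1[OF f(1)] c1_test_C1[OF f'(1)]] by (simp add: algebra_simps)
    qed
    have "L2ip \<Omega> (\<lambda>x. surface_grad (?F n) x - (g x + c *\<^sub>R h x)) (\<lambda>x. surface_grad (?F n) x - (g x + c *\<^sub>R h x)) =
       L2ip \<Omega> (\<lambda>x. (surface_grad (f n) x - g x) + c *\<^sub>R (surface_grad (f' n) x - h x)) (\<lambda>x. (surface_grad (f n) x - g x) + c *\<^sub>R (surface_grad (f' n) x - h x))" for n
      by (rule L2ip_cong[OF \<Omega>(1)]) (rule 2, assumption)+
    moreover have "(\<lambda>n. L2ip \<Omega> (\<lambda>x. (surface_grad (f n) x - g x) + c *\<^sub>R (surface_grad (f' n) x - h x)) (\<lambda>x. (surface_grad (f n) x - g x) + c *\<^sub>R (surface_grad (f' n) x - h x))) \<longlonglongrightarrow> 0"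
      by (intro L2ip_lin_tendsto_0 L2_diff L Lf f(3) f'(3))
    ultimately show ?thesis by simp
  qed
  moreover have "L2 \<Omega> (\<lambda>x. u x + c * v x)" "L2 \<Omega> (\<lambda>x. g x + c *\<^sub>R h x)"
    using L2_lin[OF L(1,3), of c] L2_lin[OF L(2,4), of c] by simp_all
  ultimately show ?thesis
    unfolding approximable_def using c1_test_lin[OF f(1) f'(1)] by (intro conjI exI[of _ ?F] allI)
qed

text \<open>Both sides of lemma \<open>c1_test_bound\<close> are continuous for convergence in mean square of the function and of
  its gradient.\<close>

lemma approximable_bound:
  assumes \<Omega>: "\<Omega> \<in> sets borel" "\<Omega> \<subseteq> S2" and disj: "\<And>x. x \<in> \<Omega> \<Longrightarrow> - x \<notin> \<Omega>" and u: "approximable \<Omega> u g"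
  shows "L2ip \<Omega> g g \<ge>
     real l * (real l + 1) * L2ip \<Omega> u u - 2 * lower_sum (\<lambda>n. \<Sum>i<poly_dim n. (L2ip \<Omega> u (onb n i))\<^sup>2) l"
proof -
  obtain f where f: "\<And>n. c1_test \<Omega> (f n)"
     "(\<lambda>n. L2ip \<Omega> (\<lambda>x. f n x - u x) (\<lambda>x. f n x - u x)) \<longlonglongrightarrow> 0"
     "(\<lambda>n. L2ip \<Omega> (\<lambda>x. surface_grad (f n) x - g x) (\<lambda>x. surface_grad (f n) x - g x)) \<longlonglongrightarrow> 0"
    using u by (auto simp: approximable_def)
  have L: "L2 \<Omega> u" "L2 \<Omega> g" using u by (auto simp: approximable_def)
  note Lf = c1_test_L2[OF \<Omega> f(1)]
  interpret r: semi_inner "{u :: R3 \<Rightarrow> real. L2 \<Omega> u}" "L2ip \<Omega>" by (rule semi_inner_L2)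
  interpret v: semi_inner "{u :: R3 \<Rightarrow> R3. L2 \<Omega> u}" "L2ip \<Omega>" by (rule semi_inner_L2)
  have gl: "(\<lambda>n. L2ip \<Omega> (surface_grad (f n)) (surface_grad (f n))) \<longlonglongrightarrow> L2ip \<Omega> g g"
    using L Lf v.zero by (intro v.tendsto_B(2)[OF _ _ v.zero f(3)]) auto
  have ul: "(\<lambda>n. L2ip \<Omega> (f n) (f n)) \<longlonglongrightarrow> L2ip \<Omega> u u"
    using L Lf by (intro r.tendsto_B(2)[OF _ _ r.zero f(2)]) auto
  have el: "(\<lambda>k. L2ip \<Omega> (f k) (onb n i)) \<longlonglongrightarrow> L2ip \<Omega> u (onb n i)" if "i < poly_dim n" for n i
    using L Lf L2_continuous[OF \<Omega>(1) onb_continuous[OF that]] by (intro r.tendsto_B(1)[OF _ _ _ f(2)]) auto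
  have "(\<lambda>k. real l * (real l + 1) * L2ip \<Omega> (f k) (f k) - 2 * lower_sum (\<lambda>n. \<Sum>i<poly_dim n. (L2ip \<Omega> (f k) (onb n i))\<^sup>2) l)
    \<longlonglongrightarrow> real l * (real l + 1) * L2ip \<Omega> u u - 2 * lower_sum (\<lambda>n. \<Sum>i<poly_dim n. (L2ip \<Omega> u (onb n i))\<^sup>2) l"
    by (intro tendsto_diff tendsto_mult tendsto_const ul lower_sum_tendsto tendsto_sum tendsto_power el) simp
  then show ?thesis
    using gl by (rule LIMSEQ_le) (use c1_test_bound[OF \<Omega> disj f(1)] in auto)
qed

section \<open>Orthonormal families of eigenfunctions\<close>

definition pairs :: "R3 set \<Rightarrow> (R3 \<Rightarrow> real \<times> R3) set" where
  "pairs \<Omega> = {w. L2 \<Omega> (\<lambda>x. fst (w x)) \<and> L2 \<Omega> (\<lambda>x. snd (w x))}"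

definition values_ip :: "R3 set \<Rightarrow> (R3 \<Rightarrow> real \<times> R3) \<Rightarrow> (R3 \<Rightarrow> real \<times> R3) \<Rightarrow> real" where
  "values_ip \<Omega> v w = L2ip \<Omega> (\<lambda>x. fst (v x)) (\<lambda>x. fst (w x))"

definition gradients_ip :: "R3 set \<Rightarrow> (R3 \<Rightarrow> real \<times> R3) \<Rightarrow> (R3 \<Rightarrow> real \<times> R3) \<Rightarrow> real" where
  "gradients_ip \<Omega> v w = L2ip \<Omega> (\<lambda>x. snd (v x)) (\<lambda>x. snd (w x))"

lemma pairs_lin: "v \<in> pairs \<Omega> \<Longrightarrow> w \<in> pairs \<Omega> \<Longrightarrow> (\<lambda>x. v x + c *\<^sub>R w x) \<in> pairs \<Omega>"
  unfolding pairs_def by (auto intro: L2_lin simp del: real_scaleR_def)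

lemma semi_inner_fst: "semi_inner (pairs \<Omega>) (values_ip \<Omega>)"
proof
  show "values_ip \<Omega> v w = values_ip \<Omega> w v" for v w unfolding values_ip_def by (rule L2ip_sym)
  show "values_ip \<Omega> (\<lambda>x. f x + c *\<^sub>R g x) h = values_ip \<Omega> f h + c * values_ip \<Omega> g h"
    if "f \<in> pairs \<Omega>" "g \<in> pairs \<Omega>" "h \<in> pairs \<Omega>" for f g h c
    using that unfolding values_ip_def pairs_def by (simp add: L2ip_lin del: real_scaleR_def)
qed (simp_all add: pairs_lin values_ip_def L2ip_nonneg, simp add: pairs_def L2_zero)

lemma semi_inner_snd: "semi_inner (pairs \<Omega>) (gradients_ip \<Omega>)"
proof
  show "gradients_ip \<Omega> v w = gradients_ip \<Omega> w v" for v w unfolding gradients_ip_def by (rule L2ip_sym)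
  show "gradients_ip \<Omega> (\<lambda>x. f x + c *\<^sub>R g x) h = gradients_ip \<Omega> f h + c * gradients_ip \<Omega> g h"
    if "f \<in> pairs \<Omega>" "g \<in> pairs \<Omega>" "h \<in> pairs \<Omega>" for f g h c
    using that unfolding gradients_ip_def pairs_def by (simp add: L2ip_lin)
qed (simp_all add: pairs_lin gradients_ip_def L2ip_nonneg, simp add: pairs_def L2_zero)

text \<open>Eigenfunctions paired with their weak gradients, the gradient being carried along as a second
  component because it is determined only almost everywhere.\<close>

definition eigenpairs :: "R3 set \<Rightarrow> real \<Rightarrow> (R3 \<Rightarrow> real \<times> R3) set" where
  "eigenpairs \<Omega> \<mu> = {w. approximable \<Omega> (\<lambda>x. fst (w x)) (\<lambda>x. snd (w x)) \<and>
     (\<forall>v. H10 \<Omega> (\<lambda>x. fst (v x)) (\<lambda>x. snd (v x)) \<longrightarrow> gradients_ip \<Omega> w v = \<mu> * values_ip \<Omega> w v)}"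

text \<open>The pairs that the weak eigenvalue equations may be tested with. They include the graph of the
  gradient on \<open>H10\<close> and are closed under linear combinations, so two combinations of eigenfunctions can
  be tested against each other.\<close>

definition testpairs :: "R3 set \<Rightarrow> (R3 \<Rightarrow> real \<times> R3) set" where
  "testpairs \<Omega> = {v \<in> pairs \<Omega>. \<forall>\<mu>. \<forall>w\<in>eigenpairs \<Omega> \<mu>. gradients_ip \<Omega> w v = \<mu> * values_ip \<Omega> w v}"

lemma eigenpairs_pairs: "w \<in> eigenpairs \<Omega> \<mu> \<Longrightarrow> w \<in> pairs \<Omega>"
  by (simp add: eigenpairs_def approximable_def pairs_def)

lemma H10_pairs: "H10 \<Omega> (\<lambda>x. fst (v x)) (\<lambda>x. snd (v x)) \<Longrightarrow> v \<in> pairs \<Omega>"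
  by (simp add: H10_def H1_def pairs_def)

lemma H10_testpairs: "H10 \<Omega> (\<lambda>x. fst (v x)) (\<lambda>x. snd (v x)) \<Longrightarrow> v \<in> testpairs \<Omega>"
  by (simp add: testpairs_def H10_pairs) (simp add: eigenpairs_def)

lemma eigenpairs_lin:
  assumes \<Omega>: "\<Omega> \<in> sets borel" "\<Omega> \<subseteq> S2" and "f \<in> eigenpairs \<Omega> \<mu>" "g \<in> eigenpairs \<Omega> \<mu>"
  shows "(\<lambda>x. f x + c *\<^sub>R g x) \<in> eigenpairs \<Omega> \<mu>"
proof -
  interpret a: semi_inner "pairs \<Omega>" "values_ip \<Omega>" by (rule semi_inner_fst)
  interpret b: semi_inner "pairs \<Omega>" "gradients_ip \<Omega>" by (rule semi_inner_snd)
  have p: "f \<in> pairs \<Omega>" "g \<in> pairs \<Omega>" using assms eigenpairs_pairs by blast+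
  have "gradients_ip \<Omega> (\<lambda>x. f x + c *\<^sub>R g x) v = \<mu> * values_ip \<Omega> (\<lambda>x. f x + c *\<^sub>R g x) v"
    if v: "H10 \<Omega> (\<lambda>x. fst (v x)) (\<lambda>x. snd (v x))" for v
    using assms v unfolding a.B_lin[OF p H10_pairs[OF v]] b.B_lin[OF p H10_pairs[OF v]]
    by (simp add: eigenpairs_def algebra_simps)
  moreover have "approximable \<Omega> (\<lambda>x. fst (f x) + c * fst (g x)) (\<lambda>x. snd (f x) + c *\<^sub>R snd (g x))"
    using assms(3,4) by (intro approximable_lin[OF \<Omega>]) (auto simp: eigenpairs_def)
  ultimately show ?thesis by (simp add: eigenpairs_def)
qed

lemma eigenpairs_zero: "(\<lambda>x. 0) \<in> eigenpairs \<Omega> \<mu>"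
  using approximable_zero by (simp add: eigenpairs_def values_ip_def gradients_ip_def L2ip_def)

lemma testpairs_lin:
  assumes "f \<in> testpairs \<Omega>" "g \<in> testpairs \<Omega>"
  shows "(\<lambda>x. f x + c *\<^sub>R g x) \<in> testpairs \<Omega>"
proof -
  interpret a: semi_inner "pairs \<Omega>" "values_ip \<Omega>" by (rule semi_inner_fst)
  interpret b: semi_inner "pairs \<Omega>" "gradients_ip \<Omega>" by (rule semi_inner_snd)
  have p: "f \<in> pairs \<Omega>" "g \<in> pairs \<Omega>" using assms by (auto simp: testpairs_def)
  have "gradients_ip \<Omega> w (\<lambda>x. f x + c *\<^sub>R g x) = \<mu> * values_ip \<Omega> w (\<lambda>x. f x + c *\<^sub>R g x)"
    if w: "w \<in> eigenpairs \<Omega> \<mu>" for w \<mu>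
  proof -
    have wp: "w \<in> pairs \<Omega>" using w by (rule eigenpairs_pairs)
    have "gradients_ip \<Omega> w f = \<mu> * values_ip \<Omega> w f" "gradients_ip \<Omega> w g = \<mu> * values_ip \<Omega> w g"
      using assms w by (auto simp: testpairs_def)
    then show ?thesis
      unfolding a.sym[OF wp pairs_lin[OF p]] b.sym[OF wp pairs_lin[OF p]] a.B_lin[OF p wp] b.B_lin[OF p wp]
      using a.sym[OF wp p(1)] a.sym[OF wp p(2)] b.sym[OF wp p(1)] b.sym[OF wp p(2)]
      by (simp add: algebra_simps)
  qed
  then show ?thesis using pairs_lin[OF p] by (simp add: testpairs_def)
qed

lemma testpairs_zero: "(\<lambda>x. 0) \<in> testpairs \<Omega>"
  by (auto simp: testpairs_def pairs_def values_ip_def gradients_ip_def L2ip_def L2_zero)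

text \<open>Gram-Schmidt in an eigenspace: a null vector among the new functions would be a linear relation,
  holding almost everywhere, between the members of the basis that witnesses the multiplicity.\<close>

lemma orthonormal_eigenpairs:
  assumes \<Omega>: "\<Omega> \<in> sets borel" "\<Omega> \<subseteq> S2"
    and dim: "has_dim_ae (area_on \<Omega>) (dirichlet_eigenspace \<Omega> \<mu>) n"
  shows "\<exists>e. (\<forall>i<n. e i \<in> eigenpairs \<Omega> \<mu> \<inter> testpairs \<Omega>) \<and>
     (\<forall>i<n. \<forall>j<n. values_ip \<Omega> (e i) (e j) = (if i = j then 1 else 0))"
proof -
  interpret a: semi_inner "pairs \<Omega>" "values_ip \<Omega>" by (rule semi_inner_fst)
  obtain b where b: "\<And>i. i < n \<Longrightarrow> b i \<in> dirichlet_eigenspace \<Omega> \<mu>"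
    and indep: "\<And>c. (AE x in area_on \<Omega>. (\<Sum>i<n. c i * b i x) = 0) \<Longrightarrow> \<forall>i<n. c i = 0"
    using dim unfolding has_dim_ae_def by blast
  have "\<forall>i. \<exists>g. i < n \<longrightarrow> H10 \<Omega> (b i) g \<and> (\<forall>\<phi> h. H10 \<Omega> \<phi> h \<longrightarrow> (LINT x|area_on \<Omega>. g x \<bullet> h x) = \<mu> * (LINT x|area_on \<Omega>. b i x * \<phi> x))"
    using b unfolding dirichlet_eigenspace_def by blast
  from choice[OF this] obtain g where g: "\<And>i. i < n \<Longrightarrow> H10 \<Omega> (b i) (g i)"
    "\<And>i \<phi> h. i < n \<Longrightarrow> H10 \<Omega> \<phi> h \<Longrightarrow> (LINT x|area_on \<Omega>. g i x \<bullet> h x) = \<mu> * (LINT x|area_on \<Omega>. b i x * \<phi> x)"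
    by blast
  define p where "p i = (\<lambda>x. (b i x, g i x))" for i
  have pE: "p i \<in> eigenpairs \<Omega> \<mu>" if "i < n" for i
    using g[OF that] H10_approximable[OF \<Omega> g(1)[OF that]]
    by (auto simp: eigenpairs_def p_def values_ip_def gradients_ip_def L2ip_def)
  have pT: "p i \<in> testpairs \<Omega>" if "i < n" for i
    by (rule H10_testpairs) (use g(1)[OF that] in \<open>simp add: p_def\<close>)
  obtain e where e: "a.ortho {..<n} e" and et: "\<forall>j<n. \<exists>t. t j \<noteq> 0 \<and> (\<forall>x. e j x = (\<Sum>i<n. t i *\<^sub>R p i x))"
    using a.gram_schmidt[of n p] eigenpairs_pairs[OF pE] by blast
  have ep: "e j \<in> eigenpairs \<Omega> \<mu> \<inter> testpairs \<Omega> \<and> values_ip \<Omega> (e j) (e j) = 1" if j: "j < n" for j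
  proof -
    obtain t where t: "t j \<noteq> 0" "\<And>x. e j x = (\<Sum>i<n. t i *\<^sub>R p i x)" using et j by blast
    have ej: "e j = (\<lambda>x. \<Sum>i<n. t i *\<^sub>R p i x)" using t(2) by (rule ext)
    have "e j \<in> eigenpairs \<Omega> \<mu>"
      unfolding ej by (intro lin_closed_sum eigenpairs_zero eigenpairs_lin[OF \<Omega>]) (use pE in auto)
    moreover have "e j \<in> testpairs \<Omega>"
      unfolding ej by (intro lin_closed_sum testpairs_zero testpairs_lin) (use pT in auto)
    moreover have "values_ip \<Omega> (e j) (e j) \<noteq> 0"
    proof
      assume z: "values_ip \<Omega> (e j) (e j) = 0"
      have L: "L2 \<Omega> (\<lambda>x. fst (e j x))"
        using eigenpairs_pairs[OF \<open>e j \<in> eigenpairs \<Omega> \<mu>\<close>] by (simp add: pairs_def)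
      have "AE x in area_on \<Omega>. fst (e j x) \<bullet> fst (e j x) = 0"
        using integral_nonneg_eq_0_iff_AE[OF L2_integrable[OF L L]] z by (simp add: values_ip_def L2ip_def)
      then have "AE x in area_on \<Omega>. (\<Sum>i<n. t i * b i x) = 0"
        by (rule AE_mp) (auto simp: ej p_def fst_sum intro!: AE_I2)
      then show False using indep[of t] t(1) j by blast
    qed
    moreover have "values_ip \<Omega> (e j) (e j) = 0 \<or> values_ip \<Omega> (e j) (e j) = 1"
      using e j by (auto simp: a.ortho_def)
    ultimately show ?thesis by auto
  qed
  then show ?thesis
    using e by (intro exI[of _ e]) (auto simp: a.ortho_def)
qed

text \<open>The usual argument: the gradient form of the two functions equals \<open>\<mu>\<close> times and \<open>\<nu>\<close> times their inner
  product.\<close>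

lemma eigenpairs_orthogonal:
  assumes v: "v \<in> eigenpairs \<Omega> \<mu> \<inter> testpairs \<Omega>" and w: "w \<in> eigenpairs \<Omega> \<nu> \<inter> testpairs \<Omega>" and "\<mu> \<noteq> \<nu>"
  shows "values_ip \<Omega> v w = 0"
proof -
  have "\<mu> * values_ip \<Omega> v w = gradients_ip \<Omega> v w" using v w by (auto simp: testpairs_def)
  also have "\<dots> = gradients_ip \<Omega> w v" unfolding gradients_ip_def by (rule L2ip_sym)
  also have "\<dots> = \<nu> * values_ip \<Omega> w v" using v w by (auto simp: testpairs_def)
  also have "values_ip \<Omega> w v = values_ip \<Omega> v w" unfolding values_ip_def by (rule L2ip_sym)
  finally show ?thesis using assms(3) by simp
qed

text \<open>Every eigenvalue \<open>\<mu>\<close> is listed by \<open>ev\<close> as often as its eigenspace has dimensions, so the indices \<open>j\<close> with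
  \<open>ev j = \<mu>\<close> can be matched with an orthonormal basis of the eigenspace.\<close>

lemma spectrum_eigenpairs:
  assumes \<Omega>: "\<Omega> \<in> sets borel" "\<Omega> \<subseteq> S2" and spec: "dirichlet_spectrum \<Omega> ev"
  shows "\<exists>w. (\<forall>j\<ge>1. w j \<in> eigenpairs \<Omega> (ev j) \<inter> testpairs \<Omega>) \<and>
     (\<forall>i\<ge>1. \<forall>j\<ge>1. values_ip \<Omega> (w i) (w j) = (if i = j then 1 else 0))"
proof -
  define J where "J \<mu> = {j\<in>{1..}. ev j = \<mu>}" for \<mu>
  have ev: "dirichlet_eigenvalue \<Omega> (ev j)" if "j \<ge> 1" for j
    using spec that unfolding dirichlet_spectrum_def by blast
  have fin: "finite (J (ev j))" and dim: "has_dim_ae (area_on \<Omega>) (dirichlet_eigenspace \<Omega> (ev j)) (card (J (ev j)))" if "j \<ge> 1" for j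
    using spec ev[OF that] unfolding dirichlet_spectrum_def J_def by blast+
  have "\<forall>\<mu>. \<exists>e. (\<exists>j\<ge>1. ev j = \<mu>) \<longrightarrow> (\<forall>i<card (J \<mu>). e i \<in> eigenpairs \<Omega> \<mu> \<inter> testpairs \<Omega>) \<and>
     (\<forall>i<card (J \<mu>). \<forall>j<card (J \<mu>). values_ip \<Omega> (e i) (e j) = (if i = j then 1 else 0))"
    using orthonormal_eigenpairs[OF \<Omega> dim] by blast
  then obtain e where e: "\<And>\<mu> j. j \<ge> 1 \<Longrightarrow> ev j = \<mu> \<Longrightarrow> (\<forall>i<card (J \<mu>). e \<mu> i \<in> eigenpairs \<Omega> \<mu> \<inter> testpairs \<Omega>) \<and>
     (\<forall>i<card (J \<mu>). \<forall>j<card (J \<mu>). values_ip \<Omega> (e \<mu> i) (e \<mu> j) = (if i = j then 1 else 0))"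
    by metis
  have "\<forall>\<mu>. \<exists>h. finite (J \<mu>) \<longrightarrow> bij_betw h (J \<mu>) {0..<card (J \<mu>)}"
    using ex_bij_betw_finite_nat by blast
  then obtain h where h: "\<And>\<mu>. finite (J \<mu>) \<Longrightarrow> bij_betw (h \<mu>) (J \<mu>) {0..<card (J \<mu>)}"
    by metis
  define w where "w j = e (ev j) (h (ev j) j)" for j
  have hj: "h (ev j) j < card (J (ev j))" if "j \<ge> 1" for j
    using bij_betwE[OF h[OF fin[OF that]]] that by (auto simp: J_def)
  have w: "w j \<in> eigenpairs \<Omega> (ev j) \<inter> testpairs \<Omega>" if "j \<ge> 1" for j
    using e[OF that refl] hj[OF that] by (simp add: w_def)
  moreover have "values_ip \<Omega> (w i) (w j) = (if i = j then 1 else 0)" if i: "i \<ge> 1" and j: "j \<ge> 1" for i j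
  proof (cases "ev i = ev j")
    case False
    then show ?thesis using eigenpairs_orthogonal[OF w[OF i] w[OF j]] by auto
  next
    case True
    have "h (ev j) i = h (ev j) j \<longleftrightarrow> i = j"
      using bij_betw_imp_inj_on[OF h[OF fin[OF j]]] i j True by (auto simp: J_def inj_on_def)
    then show ?thesis
      using e[OF j refl] hj[OF i] hj[OF j] True by (simp add: w_def)
  qed
  ultimately show ?thesis by blast
qed

section \<open>Riesz means\<close>

lemma onb_density_integral:
  assumes \<Omega>: "\<Omega> \<in> sets borel" "\<Omega> \<subseteq> S2"
  shows "(\<Sum>i<poly_dim n. L2ip \<Omega> (onb n i) (onb n i)) \<le> real (poly_dim n) / (4 * pi) * measure surface_measure \<Omega>"
proof -
  have L: "L2 \<Omega> (onb n i)" if "i < poly_dim n" for i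
    by (rule L2_continuous[OF \<Omega>(1) onb_continuous[OF that]])
  have int: "integrable (area_on \<Omega>) (\<lambda>x. onb n i x \<bullet> onb n i x)" if "i < poly_dim n" for i
    by (rule L2_integrable[OF L[OF that] L[OF that]])
  have "(\<Sum>i<poly_dim n. L2ip \<Omega> (onb n i) (onb n i)) = (LINT x|area_on \<Omega>. onb_density n x)"
    unfolding L2ip_def onb_density_def using int
    by (subst Bochner_Integration.integral_sum[symmetric]) (auto simp: power2_eq_square)
  also have "\<dots> \<le> (LINT x|area_on \<Omega>. real (poly_dim n) / (4 * pi))"
  proof (rule integral_mono)
    show "integrable (area_on \<Omega>) (onb_density n)"
      unfolding onb_density_def power2_eq_square using int by (intro Bochner_Integration.integrable_sum) simp
    show "integrable (area_on \<Omega>) (\<lambda>x. real (poly_dim n) / (4 * pi))"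
      using L2_integrable[OF L2_continuous[OF \<Omega>(1) continuous_on_const[of _ "1 :: real"]]
          L2_continuous[OF \<Omega>(1) continuous_on_const[of _ "real (poly_dim n) / (4 * pi)"]]] by simp
    show "onb_density n x \<le> real (poly_dim n) / (4 * pi)" if "x \<in> space (area_on \<Omega>)" for x
      using that \<Omega> by (intro onb_density_bound) (auto simp: space_restrict_space simp del: mem_sphere)
  qed
  also have "\<dots> = real (poly_dim n) / (4 * pi) * measure surface_measure \<Omega>"
    using \<Omega> by (simp add: space_restrict_space measure_restrict_space)
  finally show ?thesis .
qed

text \<open>Berezin's argument. For a normalised eigenfunction with \<open>ev j < L\<close>, lemma \<open>approximable_bound\<close> estimates
  \<open>L - ev j\<close> by squares of its inner products with polynomials. Summed over \<open>j\<close> these are at most the square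
  norms of the polynomials on \<open>\<Omega>\<close>, by Bessel's inequality, and the sum of the latter over an
  orthonormal family is the area of \<open>\<Omega>\<close> times the constant density.\<close>

lemma riesz_mean_at_sphere_eigenvalue:
  fixes l :: nat
  assumes \<Omega>: "\<Omega> \<in> sets borel" "\<Omega> \<subseteq> S2" and disj: "\<And>x. x \<in> \<Omega> \<Longrightarrow> - x \<notin> \<Omega>"
    and spec: "dirichlet_spectrum \<Omega> ev" and F: "finite F" "F \<subseteq> {1..}"
  defines "L \<equiv> real l * (real l + 1)"
  shows "(\<Sum>j\<in>F. max 0 (L - ev j)) \<le> measure surface_measure \<Omega> / (8 * pi) * (L\<^sup>2 - 2 * L)"
proof -
  obtain w where w: "\<And>j. j \<ge> 1 \<Longrightarrow> w j \<in> eigenpairs \<Omega> (ev j) \<inter> testpairs \<Omega>"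
    and on: "\<And>i j. i \<ge> 1 \<Longrightarrow> j \<ge> 1 \<Longrightarrow> values_ip \<Omega> (w i) (w j) = (if i = j then 1 else 0)"
    using spectrum_eigenpairs[OF \<Omega> spec] by blast
  define u where "u j = (\<lambda>x. fst (w j x))" for j
  interpret r: semi_inner "{u :: R3 \<Rightarrow> real. L2 \<Omega> u}" "L2ip \<Omega>" by (rule semi_inner_L2)
  define G where "G = {j\<in>F. ev j < L}"
  have G: "finite G" "\<And>j. j \<in> G \<Longrightarrow> j \<ge> 1" using F by (auto simp: G_def)
  have uL: "L2 \<Omega> (u j)" if "j \<in> G" for j
    using eigenpairs_pairs[of "w j"] w[OF G(2)[OF that]] by (auto simp: pairs_def u_def)
  have ortho: "r.ortho G u"
    unfolding r.ortho_def using G(1) uL on[OF G(2) G(2)] by (auto simp: values_ip_def u_def)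
  have bound: "L - ev j \<le> 2 * lower_sum (\<lambda>n. \<Sum>i<poly_dim n. (L2ip \<Omega> (u j) (onb n i))\<^sup>2) l" if j: "j \<in> G" for j
  proof -
    have w1: "w j \<in> eigenpairs \<Omega> (ev j)" "w j \<in> testpairs \<Omega>" using w[OF G(2)[OF j]] by auto
    have "gradients_ip \<Omega> (w j) (w j) = ev j * values_ip \<Omega> (w j) (w j)"
      using w1 by (auto simp: testpairs_def)
    then have "gradients_ip \<Omega> (w j) (w j) = ev j" "values_ip \<Omega> (w j) (w j) = 1"
      using on[OF G(2)[OF j] G(2)[OF j]] by simp_all
    moreover have "approximable \<Omega> (u j) (\<lambda>x. snd (w j x))"
      using w1(1) by (simp add: eigenpairs_def u_def)
    from approximable_bound[OF \<Omega> disj this, of l]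
    have "L * values_ip \<Omega> (w j) (w j) - 2 * lower_sum (\<lambda>n. \<Sum>i<poly_dim n. (L2ip \<Omega> (u j) (onb n i))\<^sup>2) l \<le> gradients_ip \<Omega> (w j) (w j)"
      unfolding values_ip_def gradients_ip_def u_def L_def .
    ultimately show ?thesis by simp
  qed
  have "(\<Sum>j\<in>F. max 0 (L - ev j)) = (\<Sum>j\<in>G. L - ev j)"
    unfolding G_def using F by (intro sum.mono_neutral_cong_right) auto
  also have "\<dots> \<le> (\<Sum>j\<in>G. 2 * lower_sum (\<lambda>n. \<Sum>i<poly_dim n. (L2ip \<Omega> (u j) (onb n i))\<^sup>2) l)"
    by (rule sum_mono) (rule bound)
  also have "\<dots> = 2 * lower_sum (\<lambda>n. \<Sum>j\<in>G. \<Sum>i<poly_dim n. (L2ip \<Omega> (u j) (onb n i))\<^sup>2) l"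
    by (simp add: lower_sum_sum sum_distrib_left)
  also have "\<dots> \<le> 2 * lower_sum (\<lambda>n. measure surface_measure \<Omega> / (4 * pi) * real (poly_dim n)) l"
  proof (intro mult_left_mono lower_sum_mono)
    fix n
    have "(\<Sum>j\<in>G. \<Sum>i<poly_dim n. (L2ip \<Omega> (u j) (onb n i))\<^sup>2) = (\<Sum>i<poly_dim n. \<Sum>j\<in>G. (L2ip \<Omega> (onb n i) (u j))\<^sup>2)"
      by (subst sum.swap) (simp add: L2ip_sym)
    also have "\<dots> \<le> (\<Sum>i<poly_dim n. L2ip \<Omega> (onb n i) (onb n i))"
      by (intro sum_mono r.bessel[OF ortho]) (simp add: L2_continuous[OF \<Omega>(1) onb_continuous])
    also have "\<dots> \<le> real (poly_dim n) / (4 * pi) * measure surface_measure \<Omega>"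
      by (rule onb_density_integral[OF \<Omega>])
    finally show "(\<Sum>j\<in>G. \<Sum>i<poly_dim n. (L2ip \<Omega> (u j) (onb n i))\<^sup>2) \<le> measure surface_measure \<Omega> / (4 * pi) * real (poly_dim n)"
      by (simp add: mult.commute)
  qed simp
  also have "\<dots> = measure surface_measure \<Omega> / (8 * pi) * (L\<^sup>2 - 2 * L)"
    unfolding lower_sum_cmult lower_sum_poly_dim L_def by simp
  finally show ?thesis .
qed

text \<open>The Riesz mean is convex in \<open>z\<close>. Between consecutive eigenvalues \<open>a = l (l + 1)\<close> and
  \<open>b = (l + 1) (l + 2)\<close> of the sphere it lies below the chord of \<open>x\<^sup>2 - 2 x\<close>, which exceeds this parabola by
  \<open>(z - a) (b - z)\<close>. The excess is at most \<open>2 z\<close>, so the chord lies below \<open>z\<^sup>2\<close>.\<close>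

lemma riesz_mean_bound:
  assumes \<Omega>: "\<Omega> \<in> sets borel" "\<Omega> \<subseteq> S2" and disj: "\<And>x. x \<in> \<Omega> \<Longrightarrow> - x \<notin> \<Omega>"
    and spec: "dirichlet_spectrum \<Omega> ev" and F: "finite F" "F \<subseteq> {1..}" and z: "z \<ge> 0"
  shows "(\<Sum>j\<in>F. max 0 (z - ev j)) \<le> measure surface_measure \<Omega> / (8 * pi) * z\<^sup>2"
proof -
  define E where "E l = real l * (real l + 1)" for l
  have ex: "\<exists>m. z < E m"
  proof -
    obtain m where "z < real m" using reals_Archimedean2 by blast
    moreover have "real m \<le> E m" by (simp add: E_def algebra_simps)
    ultimately have "z < E m" by (rule less_le_trans)
    then show ?thesis ..
  qed
  define m where "m = (LEAST m. z < E m)"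
  have m: "z < E m" unfolding m_def by (rule LeastI_ex[OF ex])
  have "m \<noteq> 0" using m z by (intro notI) (simp add: E_def)
  then obtain l where l: "m = Suc l" using not0_implies_Suc by blast
  have lz: "E l \<le> z" using not_less_Least[of l "\<lambda>m. z < E m"] l unfolding m_def by force
  define a b s where "a = E l" and "b = E (Suc l)" and "s = (z - a) / (b - a)"
  have ba: "b - a = 2 * (real l + 1)" by (simp add: a_def b_def E_def algebra_simps)
  then have ba': "b - a > 0" by simp
  have s: "0 \<le> s" "s \<le> 1" "z = (1 - s) * a + s * b"
  proof -
    show "0 \<le> s" "s \<le> 1" using lz m ba' by (simp_all add: s_def a_def b_def l field_simps)
    have "s * (b - a) = z - a" using ba' by (simp add: s_def)
    then show "z = (1 - s) * a + s * b" by (simp add: algebra_simps)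
  qed
  let ?c = "measure surface_measure \<Omega> / (8 * pi)"
  have "(\<Sum>j\<in>F. max 0 (z - ev j)) \<le> (\<Sum>j\<in>F. (1 - s) * max 0 (a - ev j) + s * max 0 (b - ev j))"
  proof (rule sum_mono)
    fix j
    have "z - ev j = (1 - s) * (a - ev j) + s * (b - ev j)" using s(3) by (simp add: algebra_simps)
    also have "\<dots> \<le> (1 - s) * max 0 (a - ev j) + s * max 0 (b - ev j)"
      using s by (intro add_mono mult_left_mono) auto
    finally show "max 0 (z - ev j) \<le> (1 - s) * max 0 (a - ev j) + s * max 0 (b - ev j)"
      using s by simp
  qed
  also have "\<dots> = (1 - s) * (\<Sum>j\<in>F. max 0 (a - ev j)) + s * (\<Sum>j\<in>F. max 0 (b - ev j))"
    by (simp add: sum.distrib sum_distrib_left)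
  also have "\<dots> \<le> (1 - s) * (?c * (a\<^sup>2 - 2 * a)) + s * (?c * (b\<^sup>2 - 2 * b))"
    using s riesz_mean_at_sphere_eigenvalue[OF \<Omega> disj spec F, of l]
      riesz_mean_at_sphere_eigenvalue[OF \<Omega> disj spec F, of "Suc l"]
    unfolding a_def b_def E_def by (intro add_mono mult_left_mono) auto
  also have "\<dots> = ?c * ((1 - s) * (a\<^sup>2 - 2 * a) + s * (b\<^sup>2 - 2 * b))"
    by (simp only: distrib_left mult.left_commute[of ?c])
  also have "\<dots> \<le> ?c * z\<^sup>2"
  proof (rule mult_left_mono)
    have chord: "(1 - s) * (a\<^sup>2 - 2 * a) + s * (b\<^sup>2 - 2 * b) = z\<^sup>2 - 2 * z + (z - a) * (b - z)"
      unfolding s(3) by (simp add: power2_eq_square algebra_simps)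
    \<comment> \<open>the interval between a and b is centred at the square of h and has length 2 h\<close>
    define h d where "h = real l + 1" and "d = z - h\<^sup>2"
    have ab: "a = h\<^sup>2 - h" "b = h\<^sup>2 + h"
      by (simp_all add: a_def b_def E_def h_def power2_eq_square algebra_simps)
    have "(z - a) * (b - z) - 2 * z = 1 - h\<^sup>2 - (d + 1)\<^sup>2"
      unfolding ab d_def by (simp add: power2_eq_square algebra_simps)
    also have "\<dots> \<le> 0"
    proof -
      have "1 \<le> h\<^sup>2" by (simp add: h_def)
      then show ?thesis using zero_le_power2[of "d + 1"] by linarith
    qed
    finally show "(1 - s) * (a\<^sup>2 - 2 * a) + s * (b\<^sup>2 - 2 * b) \<le> z\<^sup>2" unfolding chord by simp
  qed simp
  finally show ?thesis .
qed

theorem theorem3p2p4: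
  fixes \<Omega> :: "(real ^ 3) set" and ev :: "nat \<Rightarrow> real" and z :: real
  assumes "openin (top_of_set S2) \<Omega>" and "connected \<Omega>" and "\<Omega> \<noteq> {}"
    and "\<Omega> \<subseteq> hemisphere"
    and "dirichlet_spectrum \<Omega> ev"
    and "z \<ge> 0"
  shows "(\<lambda>j. max 0 (z - ev j)) summable_on {1..} \<and>
         infsum (\<lambda>j. max 0 (z - ev j)) {1..} \<le> 1 / (8 * pi) * measure surface_measure \<Omega> * z\<^sup>2"
proof -
  obtain T where T: "open T" "\<Omega> = S2 \<inter> T"
    using assms(1) by (auto simp: openin_open)
  then have "S2 \<in> sets borel" "T \<in> sets borel" by (simp_all add: borel_closed borel_open)
  then have \<Omega>: "\<Omega> \<in> sets borel" unfolding T(2) by (rule sets.Int)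
  have sub: "\<Omega> \<subseteq> S2" using T(2) by blast
  have disj: "- x \<notin> \<Omega>" if "x \<in> \<Omega>" for x
  proof
    assume "- x \<in> \<Omega>"
    then have "x $ 3 > 0" "(- x) $ 3 > 0"
      using that assms(4) unfolding hemisphere_def by blast+
    then show False by simp
  qed
  have bound: "sum (\<lambda>j. max 0 (z - ev j)) F \<le> 1 / (8 * pi) * measure surface_measure \<Omega> * z\<^sup>2"
    if "finite F" "F \<subseteq> {1..}" for F
    using riesz_mean_bound[OF \<Omega> sub disj assms(5) that assms(6)] by simp
  have "(\<lambda>j. max 0 (z - ev j)) summable_on {1..}"
    by (rule nonneg_bdd_above_summable_on) (use bound in \<open>auto intro!: bdd_aboveI2\<close>)
  moreover from this have "infsum (\<lambda>j. max 0 (z - ev j)) {1..} \<le> 1 / (8 * pi) * measure surface_measure \<Omega> * z\<^sup>2"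
    by (rule infsum_le_finite_sums) (rule bound)
  ultimately show ?thesis by blast
qed

end
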